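(* Let $\alpha,\beta,p\in(0,\infty)$. Consider the approximation problem $\mathrm{APP}=\{\mathrm{APP}_d\}_{d\in\mathbb N}$, $\mathrm{APP}_d:C(\mathbb T^d)\to L_2(\mathbb T^d)$, $\mathrm{APP}_d f=f$, in the average case setting with respect to the zero-mean Gaussian measure $\mu_d$ on $C(\mathbb T^d)$ whose covariance kernel is the Gevrey kernel $$K_{d,\alpha,\beta,p}(\mathbf x,\mathbf y)=\sum_{\mathbf k\in\mathbb Z^d}\exp(-2\beta|\mathbf k|_p^\alpha)\exp(i\,\mathbf k(\mathbf x-\mathbf y)).$$ Then, for the absolute error criterion as well as for the normalized error criterion, the following hold. (i) $\mathrm{APP}$ is EXP with exponent $p^{*,\rm avg}(d)=\alpha/d$, and is not UEXP. (ii) $\mathrm{APP}$ is not EXP-UWT, not EXP-QPT, not EXP-PT and not EXP-SPT. (iii) $\mathrm{APP}$ is EXP-WT if and only if $\alpha>p$. (iv) $\mathrm{APP}$ is EXP-$(s,t)$-WT for all $s>0$ and $t>1$. (v) For $0<t\le1$ and $0<s\le1$, $\mathrm{APP}$ is EXP-$(s,t)$-WT if and only if $s>\frac p\alpha$. (vi) For $0<t\le1$ and $s>1$, $\mathrm{APP}$ is EXP-$(s,t)$-WT if and only if $\alpha>p$.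
   Context: Notation. $\mathbb T^d=[0,2\pi]^d$ is the $d$-dimensional torus, $C(\mathbb T^d)$ is the space of continuous (real-valued) functions on it, and $L_2(\mathbb T^d)$ is taken with respect to the normalized measure $(2\pi)^{-d}d\mathbf x$, with norm $\|\cdot\|_2$. For $\mathbf x,\mathbf y\in\mathbb T^d$ and $\mathbf k\in\mathbb Z^d$, $\mathbf k\mathbf x=\sum_{j=1}^d k_jx_j$ and $|\mathbf k|_p=(\sum_{j=1}^d|k_j|^p)^{1/p}$. That $\mu_d$ has covariance kernel $K_{d,\alpha,\beta,p}$ means $\int_{C(\mathbb T^d)}f(\mathbf x)f(\mathbf y)\,\mu_d(df)=K_{d,\alpha,\beta,p}(\mathbf x,\mathbf y)$. Algorithms and errors. An algorithm using $n\ge1$ pieces of information has the form $A_{n,d}f=\phi_{n,d}(L_1(f),\dots,L_n(f))$ with continuous linear functionals $L_1,\dots,L_n$ on $C(\mathbb T^d)$ and an arbitrary measurable map $\phi_{n,d}:\mathbb R^n\to L_2(\mathbb T^d)$; for $n=0$, $A_{0,d}=0$. Its average case error is $e^{\rm avg}(A_{n,d})=\big(\int_{C(\mathbb T^d)}\|f-A_{n,d}f\|_2^2\,\mu_d(df)\big)^{1/2}$. Put $e^{\rm avg}(n,d)=\inf_{A_{n,d}}e^{\rm avg}(A_{n,d})$ and $e^{\rm avg}(0,d)=\big(\int_{C(\mathbb T^d)}\|f\|_2^2\,\mu_d(df)\big)^{1/2}$ (initial error). Information complexity. For $\varepsilon\in(0,1)$ and $\star\in\{\mathrm{ABS},\mathrm{NOR}\}$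 (absolute, normalized error criterion), $n^\star(\varepsilon,d)=\inf\{n\in\mathbb N_0: e^{\rm avg}(n,d)\le\varepsilon\,\mathrm{CRI}_d\}$, where $\mathrm{CRI}_d=1$ for $\star=\mathrm{ABS}$ and $\mathrm{CRI}_d=e^{\rm avg}(0,d)$ for $\star=\mathrm{NOR}$. Exponential convergence. $\mathrm{APP}$ is EXP (exponentially convergent) if there exist a number $q\in(0,1)$ and functions $r,C,C_1:\mathbb N\to(0,\infty)$ such that $$e^{\rm avg}(n,d)\le C(d)\,q^{(n/C_1(d))^{r(d)}}\qquad\text{for all } n\in\mathbb N_0,\ d\in\mathbb N. \qquad( * )$$ In that case the exponent of EXP is $p^{*,\rm avg}(d)=\sup\{r(d): r(d)\text{ satisfies }( * )\}$. $\mathrm{APP}$ is UEXP (uniformly exponentially convergent) if the function $r$ in $( * )$ can be taken to be a positive constant, $r(d)\equiv r>0$ for all $d\in\mathbb N$. Tractability notions (for error criterion $\star$). $\mathrm{APP}$ is: - EXP-SPT if there are $C>0$, $a\ge0$ with $n^\star(\varepsilon,d)\le C(\ln\varepsilon^{-1}+1)^{a}$ for all $d\in\mathbb N$, $\varepsilon\in(0,1)$; - EXP-PT if there are $C>0$, $a,b\ge0$ with $n^\star(\varepsilon,d)\le Cd^{b}(\ln\varepsilon^{-1}+1)^{a}$ for all $d\in\mathbb N$, $\varepsilon\in(0,1)$; - EXP-QPT if there are $C>0$, $a\ge0$ with $n^\star(\varepsilon,d)\le C\exp\big(a(1+\ln d)(1+\ln(\ln\varepsilon^{-1}+1))\big)$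 for all $d\in\mathbb N$, $\varepsilon\in(0,1)$; - EXP-$(s,t)$-WT, for fixed $s,t>0$, if $\lim_{\varepsilon^{-1}+d\to\infty}\frac{\ln n^\star(\varepsilon,d)}{(1+\ln\varepsilon^{-1})^{s}+d^t}=0$; - EXP-WT if it is EXP-$(1,1)$-WT; - EXP-UWT if it is EXP-$(\sigma,\tau)$-WT for all $\sigma,\tau>0$. *)

theory Defs
  imports "HOL-Probability.Probability"
begin

section \<open>The torus, continuous functions on it, and \<open>L\<^sub>2\<close>\<close>

text \<open>
  The dimension \<open>d\<close> varies inside the problem, so points are functions on \<open>{..<d}\<close>
  (coordinates \<open>x 0, \<dots>, x (d - 1)\<close>).
\<close>

definition torus :: "nat \<Rightarrow> (nat \<Rightarrow> real) set" where
  "torus d = {..<d} \<rightarrow>\<^sub>E {0..2 * pi}"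

text \<open>
  A continuous function on the torus is represented by the bounded continuous function on
  \<open>nat \<Rightarrow> real\<close> (product topology) that depends on the first \<open>d\<close> coordinates only and is
  \<open>2\<pi>\<close>-periodic in each of them. This is a closed subspace of the Banach space
  \<open>(nat \<Rightarrow> real) \<Rightarrow>\<^sub>C real\<close>, isometric to the space of continuous functions on
  the \<open>d\<close>-dimensional torus with the supremum norm.
\<close>

type_synonym cfun = "(nat \<Rightarrow> real) \<Rightarrow>\<^sub>C real"

definition C_torus :: "nat \<Rightarrow> cfun set" where
  "C_torus d = {f. \<forall>x y. (\<forall>j<d. \<exists>m::int. x j = y j + 2 * pi * of_int m) \<longrightarrow>
                         apply_bcontfun f x = apply_bcontfun f y}"

text \<open>Continuous linear functionals; only the values on \<^term>\<open>C_torus d\<close> matter.\<close>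

definition C_torus_dual :: "nat \<Rightarrow> (cfun \<Rightarrow> real) set" where
  "C_torus_dual d = {L. (\<forall>f\<in>C_torus d. \<forall>g\<in>C_torus d. L (f + g) = L f + L g) \<and>
                        (\<forall>c. \<forall>f\<in>C_torus d. L (c *\<^sub>R f) = c * L f) \<and>
                        continuous_on (C_torus d) L}"

definition torus_measure :: "nat \<Rightarrow> (nat \<Rightarrow> real) measure" where
  "torus_measure d = PiM {..<d} (\<lambda>_. uniform_measure lborel {0..2 * pi})"

text \<open>
  Elements of \<open>L\<^sub>2\<close> are given by representatives. The seminorm does not distinguish
  representatives of the same class, and the Borel sigma-algebra below is generated by the sets that
  are open for it, so a map into this space is measurable iff the induced map into the quotient
  by almost-everywhere equality is Borel measurable.
\<close>

definition L2_space :: "nat \<Rightarrow> ((nat \<Rightarrow> real) \<Rightarrow> real) set" where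
  "L2_space d = {g \<in> borel_measurable (torus_measure d).
                   integrable (torus_measure d) (\<lambda>x. (g x)\<^sup>2)}"

definition L2_norm :: "nat \<Rightarrow> ((nat \<Rightarrow> real) \<Rightarrow> real) \<Rightarrow> real" where
  "L2_norm d g = sqrt (\<integral>x. (g x)\<^sup>2 \<partial>torus_measure d)"

definition L2_open :: "nat \<Rightarrow> ((nat \<Rightarrow> real) \<Rightarrow> real) set \<Rightarrow> bool" where
  "L2_open d U \<longleftrightarrow> U \<subseteq> L2_space d \<and>
     (\<forall>g\<in>U. \<exists>e>0. \<forall>h\<in>L2_space d. L2_norm d (\<lambda>x. h x - g x) < e \<longrightarrow> h \<in> U)"

definition L2_borel :: "nat \<Rightarrow> ((nat \<Rightarrow> real) \<Rightarrow> real) measure" where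
  "L2_borel d = sigma (L2_space d) {U. L2_open d U}"

section \<open>Gaussian measures and the Gevrey kernel\<close>

text \<open>Degenerate one-dimensional marginals (Dirac measures) are allowed.\<close>

definition gaussian_measure :: "nat \<Rightarrow> cfun measure \<Rightarrow> bool" where
  "gaussian_measure d M \<longleftrightarrow>
     prob_space M \<and> sets M = sets (restrict_space borel (C_torus d)) \<and>
     (\<forall>L\<in>C_torus_dual d. \<exists>m \<sigma>. 0 \<le> \<sigma> \<and>
        distr M borel L =
          (if \<sigma> = 0 then return borel m
           else density lborel (\<lambda>t. ennreal (normal_density m \<sigma> t))))"

definition zero_mean :: "nat \<Rightarrow> cfun measure \<Rightarrow> bool" where
  "zero_mean d M \<longleftrightarrow> (\<forall>L\<in>C_torus_dual d. (\<integral>f. L f \<partial>M) = 0)"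

definition has_covariance_kernel ::
    "nat \<Rightarrow> cfun measure \<Rightarrow> ((nat \<Rightarrow> real) \<Rightarrow> (nat \<Rightarrow> real) \<Rightarrow> complex) \<Rightarrow> bool" where
  "has_covariance_kernel d M K \<longleftrightarrow>
     (\<forall>x\<in>torus d. \<forall>y\<in>torus d.
        complex_of_real (\<integral>f. apply_bcontfun f x * apply_bcontfun f y \<partial>M) = K x y)"

definition lp_norm :: "nat \<Rightarrow> real \<Rightarrow> (nat \<Rightarrow> int) \<Rightarrow> real" where
  "lp_norm d p k = (\<Sum>j<d. \<bar>real_of_int (k j)\<bar> powr p) powr (1 / p)"

definition gevrey_kernel ::
    "nat \<Rightarrow> real \<Rightarrow> real \<Rightarrow> real \<Rightarrow> (nat \<Rightarrow> real) \<Rightarrow> (nat \<Rightarrow> real) \<Rightarrow> complex" where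
  "gevrey_kernel d \<alpha> \<beta> p x y =
     (\<Sum>\<^sub>\<infinity>k\<in>{..<d} \<rightarrow>\<^sub>E (UNIV :: int set).
        complex_of_real (exp (- 2 * \<beta> * lp_norm d p k powr \<alpha>)) *
        exp (\<i> * complex_of_real (\<Sum>j<d. real_of_int (k j) * (x j - y j))))"

section \<open>Algorithms and average case errors\<close>

definition algorithms :: "nat \<Rightarrow> nat \<Rightarrow> (cfun \<Rightarrow> (nat \<Rightarrow> real) \<Rightarrow> real) set" where
  "algorithms n d =
     (if n = 0 then {\<lambda>f x. 0}
      else {\<lambda>f. \<phi> (\<lambda>i\<in>{..<n}. L i f) | \<phi> L.
              (\<forall>i<n. L i \<in> C_torus_dual d) \<and>
              \<phi> \<in> measurable (PiM {..<n} (\<lambda>_. borel)) (L2_borel d)})"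

definition ennreal_sqrt :: "ennreal \<Rightarrow> ennreal" where
  "ennreal_sqrt z = (if z = \<infinity> then \<infinity> else ennreal (sqrt (enn2real z)))"

definition alg_error :: "nat \<Rightarrow> cfun measure \<Rightarrow> (cfun \<Rightarrow> (nat \<Rightarrow> real) \<Rightarrow> real) \<Rightarrow> ennreal" where
  "alg_error d M A =
     ennreal_sqrt (\<integral>\<^sup>+f. ennreal ((L2_norm d (\<lambda>x. apply_bcontfun f x - A f x))\<^sup>2) \<partial>M)"

text \<open>For \<open>n = 0\<close> this is the initial error, the zero algorithm being the only one.\<close>

definition avg_error :: "(nat \<Rightarrow> cfun measure) \<Rightarrow> nat \<Rightarrow> nat \<Rightarrow> ennreal" where
  "avg_error \<mu> n d = (INF A\<in>algorithms n d. alg_error d (\<mu> d) A)"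

datatype criterion = ABS | NOR

fun CRI :: "criterion \<Rightarrow> (nat \<Rightarrow> cfun measure) \<Rightarrow> nat \<Rightarrow> ennreal" where
  "CRI ABS \<mu> d = 1"
| "CRI NOR \<mu> d = avg_error \<mu> 0 d"

text \<open>Valued in \<^typ>\<open>enat\<close>, so that the infimum of the empty set is \<open>\<infinity>\<close>.\<close>

definition info_complexity :: "criterion \<Rightarrow> (nat \<Rightarrow> cfun measure) \<Rightarrow> real \<Rightarrow> nat \<Rightarrow> enat" where
  "info_complexity crit \<mu> \<epsilon> d =
     (INF n\<in>{n. avg_error \<mu> n d \<le> ennreal \<epsilon> * CRI crit \<mu> d}. enat n)"

section \<open>Exponential convergence\<close>

text \<open>
  In this and the next section the dimension ranges over \<open>d \<ge> 1\<close>; \<open>e n d\<close> stands for the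
  \<open>n\<close>-th minimal error and \<open>N \<epsilon> d\<close> for the information complexity.
\<close>

definition exp_rate :: "(nat \<Rightarrow> nat \<Rightarrow> ennreal) \<Rightarrow> (nat \<Rightarrow> real) \<Rightarrow> bool" where
  "exp_rate e r \<longleftrightarrow>
     (\<exists>q C C1. 0 < q \<and> q < 1 \<and> (\<forall>d\<ge>1. 0 < r d \<and> 0 < C d \<and> 0 < C1 d) \<and>
        (\<forall>n. \<forall>d\<ge>1. e n d \<le> ennreal (C d * q powr ((real n / C1 d) powr r d))))"

definition is_EXP :: "(nat \<Rightarrow> nat \<Rightarrow> ennreal) \<Rightarrow> bool" where
  "is_EXP e \<longleftrightarrow> (\<exists>r. exp_rate e r)"

definition EXP_exponent :: "(nat \<Rightarrow> nat \<Rightarrow> ennreal) \<Rightarrow> nat \<Rightarrow> ereal" where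
  "EXP_exponent e d = (SUP r\<in>{r. exp_rate e r}. ereal (r d))"

definition is_UEXP :: "(nat \<Rightarrow> nat \<Rightarrow> ennreal) \<Rightarrow> bool" where
  "is_UEXP e \<longleftrightarrow> (\<exists>r>0. exp_rate e (\<lambda>d. r))"

section \<open>Tractability notions\<close>

definition EXP_SPT :: "(real \<Rightarrow> nat \<Rightarrow> enat) \<Rightarrow> bool" where
  "EXP_SPT N \<longleftrightarrow>
     (\<exists>C>0. \<exists>a\<ge>0. \<forall>d\<ge>1. \<forall>\<epsilon>\<in>{0<..<1}.
        ereal_of_enat (N \<epsilon> d) \<le> ereal (C * (ln (1 / \<epsilon>) + 1) powr a))"

definition EXP_PT :: "(real \<Rightarrow> nat \<Rightarrow> enat) \<Rightarrow> bool" where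
  "EXP_PT N \<longleftrightarrow>
     (\<exists>C>0. \<exists>a\<ge>0. \<exists>b\<ge>0. \<forall>d\<ge>1. \<forall>\<epsilon>\<in>{0<..<1}.
        ereal_of_enat (N \<epsilon> d) \<le> ereal (C * real d powr b * (ln (1 / \<epsilon>) + 1) powr a))"

definition EXP_QPT :: "(real \<Rightarrow> nat \<Rightarrow> enat) \<Rightarrow> bool" where
  "EXP_QPT N \<longleftrightarrow>
     (\<exists>C>0. \<exists>a\<ge>0. \<forall>d\<ge>1. \<forall>\<epsilon>\<in>{0<..<1}.
        ereal_of_enat (N \<epsilon> d) \<le>
          ereal (C * exp (a * (1 + ln (real d)) * (1 + ln (ln (1 / \<epsilon>) + 1)))))"

fun ln_enat :: "enat \<Rightarrow> ereal" where
  "ln_enat (enat m) = (if m = 0 then - \<infinity> else ereal (ln (real m)))"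
| "ln_enat \<infinity> = \<infinity>"

text \<open>The filter describing \<open>1 / \<epsilon> + d \<rightarrow> \<infinity>\<close> over \<open>0 < \<epsilon> < 1\<close>, \<open>d \<ge> 1\<close>.\<close>

definition eps_dim_filter :: "(real \<times> nat) filter" where
  "eps_dim_filter =
     inf (filtercomap (\<lambda>(\<epsilon>, d). 1 / \<epsilon> + real d) at_top) (principal ({0<..<1} \<times> {1..}))"

definition EXP_st_WT :: "real \<Rightarrow> real \<Rightarrow> (real \<Rightarrow> nat \<Rightarrow> enat) \<Rightarrow> bool" where
  "EXP_st_WT s t N \<longleftrightarrow>
     ((\<lambda>(\<epsilon>, d). ln_enat (N \<epsilon> d) / ereal ((1 + ln (1 / \<epsilon>)) powr s + real d powr t))
        \<longlongrightarrow> 0) eps_dim_filter"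

definition EXP_WT :: "(real \<Rightarrow> nat \<Rightarrow> enat) \<Rightarrow> bool" where
  "EXP_WT N \<longleftrightarrow> EXP_st_WT 1 1 N"

definition EXP_UWT :: "(real \<Rightarrow> nat \<Rightarrow> enat) \<Rightarrow> bool" where
  "EXP_UWT N \<longleftrightarrow> (\<forall>\<sigma>>0. \<forall>\<tau>>0. EXP_st_WT \<sigma> \<tau> N)"

end

theory Submission
  imports Defs
begin

text \<open>
  Write \<open>\<lambda>\<^sub>k = exp (- 2\<beta> |k|\<^sub>p\<^sup>\<alpha>)\<close> for \<open>k \<in> \<int>\<^sup>d\<close>. The Gevrey kernel is diagonalised by the real
  functions \<open>h\<^sub>k(x) = cos (k x) + sin (k x)\<close>, which are orthonormal in \<open>L\<^sub>2\<close> and stay inside one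
  eigenspace because \<open>\<lambda>\<^sub>k = \<lambda>\<^sub>-\<^sub>k\<close>. Under the measure the coefficients of \<open>f\<close> in this system are
  therefore uncorrelated with variances \<open>\<lambda>\<^sub>k\<close>, and all statements become statements about the numbers
  \<open>\<lambda>\<^sub>k\<close>.

  Upper bound for the error: projecting on \<open>n\<close> of the \<open>h\<^sub>k\<close> leaves exactly the sum of the other
  \<open>\<lambda>\<^sub>k\<close> (\<open>projection_error\<close>). Lower bound: for jointly Gaussian variables the part of a variable that
  is uncorrelated with the data is orthogonal to every function of the data, so no nonlinear algorithm
  beats the linear regression (\<open>uncorrelated_with_function\<close>), and by Bessel's inequality \<open>n\<close>
  functionals can explain at most \<open>n \<delta>\<close> of a family of variances that are all at most \<open>\<delta>\<close>
  (\<open>weighted_estimates_lower_bound\<close>).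

  What remains is counting lattice points. Put \<open>m(k) = \<Sum>\<^sub>j |k\<^sub>j|\<^sup>p\<close> and \<open>\<gamma> = \<alpha> / p\<close>, so that
  \<open>|k|\<^sub>p\<^sup>\<alpha> = m(k)\<^sup>\<gamma>\<close>. Boxes \<open>{-r..r}\<^sup>d\<close> contain about \<open>r\<^sup>d\<close> points and \<open>\<lambda>\<close> decays like
  \<open>exp (- c r\<^sup>\<alpha>)\<close> outside them, which gives the rate \<open>exp (- c n\<^bsup>\<alpha>/d\<^esup>)\<close> and shows that the exponent
  \<open>\<alpha> / d\<close> is sharp; it tends to \<open>0\<close> as \<open>d\<close> grows, so the convergence is not uniform.

  For tractability, three facts matter. All \<open>3\<^sup>d\<close> points of \<open>{-1,0,1}\<^sup>d\<close> have
  \<open>\<lambda> \<ge> exp (- 2\<beta> d\<^sup>\<gamma>)\<close>, so at an accuracy with \<open>ln (1/\<epsilon>)\<close> of order \<open>d\<^sup>g\<close>, where \<open>g > 1\<close> and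
  \<open>g \<ge> \<gamma>\<close>, at least \<open>3\<^sup>d\<close> functionals are needed (\<open>info_lower_exponential\<close>). This excludes the
  quasi-polynomial notion and the stronger ones, uniform weak tractability and, for \<open>\<alpha> > p\<close>, weak
  tractability with \<open>s \<le> p / \<alpha>\<close> and \<open>t \<le> 1\<close>. If \<open>\<alpha> \<le> p\<close>, the total variance itself grows at
  least exponentially in \<open>d\<close> while every \<open>\<lambda>\<^sub>k\<close> is at most \<open>1\<close>, so exponentially many functionals
  are needed already for \<open>\<epsilon> = 1/2\<close> (\<open>info_lower_fixed\<close>). If \<open>\<alpha> > p\<close>, few coordinates of a relevant \<open>k\<close> are nonzero, and an
  exponential Chebyshev bound on \<open>m\<close> shows that the logarithm of the complexity is at
  most of the order of a power of \<open>1 + ln d\<close> plus \<open>(1 + ln d) (1 + ln (1/\<epsilon>))\<^bsup>p/\<alpha>\<^esup>\<close>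
  (\<open>info_bound_polylog\<close>). In every case it is \<open>O(d (1 + ln d + ln (1 + ln (1/\<epsilon>))))\<close>
  (\<open>info_bound_general\<close>), which is enough for \<open>t > 1\<close>.

  The absolute criterion is the harder one because the initial error is at least \<open>1\<close>: upper bounds
  are proved for the threshold \<open>\<epsilon>\<close> and lower bounds for the threshold \<open>\<epsilon>\<close> times the initial
  error, and both then hold for both criteria.
\<close>

section \<open>Signed weights with vanishing Fourier transform\<close>

text \<open>
  Uniqueness of characteristic functions with a signed weight: the positive and the negative part of
  \<open>Z\<close>, normalised to the same mass, push forward to two distributions of \<open>X\<close> with the same
  characteristic function.
\<close>

lemma fourier_weight_real:
  fixes Z X :: "'a \<Rightarrow> real"
  assumes Z: "integrable M Z" and X[measurable]: "X \<in> borel_measurable M"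
    and zero: "\<And>t. (CLINT w|M. complex_of_real (Z w) * iexp (t * X w)) = 0"
    and B[measurable]: "B \<in> sets borel"
  shows "(LINT w|M. Z w * indicator B (X w)) = 0"
proof -
  have [measurable]: "Z \<in> borel_measurable M" using Z by auto
  define P where "P = (\<lambda>w. max 0 (Z w))"
  define N where "N = (\<lambda>w. max 0 (- Z w))"
  have [measurable]: "P \<in> borel_measurable M" "N \<in> borel_measurable M" unfolding P_def N_def by auto
  have P: "integrable M P" and N: "integrable M N"
    unfolding P_def N_def using Z by (auto intro!: integrable_max)
  have PN: "Z w = P w - N w" "0 \<le> P w" "0 \<le> N w" for w unfolding P_def N_def by auto
  have mult_int: "integrable M (\<lambda>w. complex_of_real (f w) * iexp (t * X w))"
    if "integrable M f" for f t
    by (rule Bochner_Integration.integrable_bound[OF that]) (use that in \<open>auto simp: norm_mult\<close>)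
  have eq: "(CLINT w|M. complex_of_real (P w) * iexp (t * X w)) =
            (CLINT w|M. complex_of_real (N w) * iexp (t * X w))" for t
  proof -
    have "(CLINT w|M. complex_of_real (P w) * iexp (t * X w)) -
            (CLINT w|M. complex_of_real (N w) * iexp (t * X w)) =
          (CLINT w|M. complex_of_real (P w) * iexp (t * X w) - complex_of_real (N w) * iexp (t * X w))"
      using mult_int[OF P] mult_int[OF N] by simp
    also have "\<dots> = (CLINT w|M. complex_of_real (Z w) * iexp (t * X w))"
      by (simp add: PN(1) algebra_simps)
    finally show ?thesis using zero by simp
  qed
  define c where "c = integral\<^sup>L M P"
  have "complex_of_real (integral\<^sup>L M P) = complex_of_real (integral\<^sup>L M N)"
    using eq[of 0] by simp
  then have cN: "integral\<^sup>L M N = c" unfolding c_def by simp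
  have c0: "0 \<le> c" unfolding c_def by (rule integral_nonneg_AE) (simp add: PN)
  have ind: "integrable M (\<lambda>w. f w * indicator B (X w))" if "integrable M f" for f :: "'a \<Rightarrow> real"
    by (rule Bochner_Integration.integrable_bound[OF that]) (use that in \<open>auto simp: indicator_def\<close>)
  show ?thesis
  proof (cases "c = 0")
    case True
    have "AE w in M. P w = 0" using True integral_nonneg_eq_0_iff_AE[OF P] PN unfolding c_def by simp
    moreover have "AE w in M. N w = 0" using True cN integral_nonneg_eq_0_iff_AE[OF N] PN by simp
    ultimately have "AE w in M. Z w * indicator B (X w) = 0" by eventually_elim (simp add: PN(1))
    then show ?thesis by (simp add: integral_eq_zero_AE)
  next
    case False
    then have c: "0 < c" using c0 by simp
    (* the distribution of X under the probability measure with density f / c *)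
    define D where "D f = distr (density M (\<lambda>w. ennreal (f w / c))) borel X" for f :: "'a \<Rightarrow> real"
    have D: "real_distribution (D f)"
      if "integrable M f" "\<And>w. 0 \<le> f w" "integral\<^sup>L M f = c" for f
    proof -
      have [measurable]: "f \<in> borel_measurable M" using that by auto
      have "emeasure (density M (\<lambda>w. ennreal (f w / c))) (space M) = (\<integral>\<^sup>+w. ennreal (f w / c) \<partial>M)"
        by (simp add: emeasure_density cong: nn_integral_cong)
      also have "\<dots> = ennreal (LINT w|M. f w / c)"
        using that c by (intro nn_integral_eq_integral) auto
      also have "\<dots> = 1" using that c by simp
      finally interpret prob_space "density M (\<lambda>w. ennreal (f w / c))" by (intro prob_spaceI) simp
      show ?thesis unfolding D_def by (rule real_distribution_distr) simp
    qed
    have Dchar: "char (D f) t = (CLINT w|M. complex_of_real (f w) * iexp (t * X w)) / c"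
      if "integrable M f" "\<And>w. 0 \<le> f w" for f t
    proof -
      have [measurable]: "f \<in> borel_measurable M" using that by auto
      have "char (D f) t = (CLINT w|M. (f w / c) *\<^sub>R iexp (t * X w))"
        unfolding D_def char_def using that c
        by (subst integral_distr) (auto intro!: integral_density)
      also have "\<dots> = (CLINT w|M. complex_of_real (f w) * iexp (t * X w) / c)"
        by (intro Bochner_Integration.integral_cong) (auto simp: scaleR_conv_of_real)
      finally show ?thesis by simp
    qed
    have Dmeas: "measure (D f) B = (LINT w|M. f w * indicator B (X w)) / c"
      if "integrable M f" "\<And>w. 0 \<le> f w" "integral\<^sup>L M f = c" for f
    proof -
      have [measurable]: "f \<in> borel_measurable M" using that by auto
      interpret D: real_distribution "D f" by (rule D[OF that])
      have "measure (D f) B = (LINT y|D f. indicator B y)" by simp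
      also have "\<dots> = (LINT w|density M (\<lambda>w. ennreal (f w / c)). indicator B (X w))"
        unfolding D_def by (rule integral_distr) auto
      also have "\<dots> = (LINT w|M. (f w / c) *\<^sub>R indicator B (X w))"
        by (rule integral_density) (use that c in auto)
      also have "\<dots> = (LINT w|M. f w * indicator B (X w) / c)"
        by (intro Bochner_Integration.integral_cong) auto
      finally show ?thesis by simp
    qed
    have "D P = D N"
      by (rule Levy_uniqueness[OF D[OF P _ c_def[symmetric]] D[OF N _ cN]])
         (use eq in \<open>auto simp: PN Dchar P N fun_eq_iff\<close>)
    then have "(LINT w|M. P w * indicator B (X w)) = (LINT w|M. N w * indicator B (X w))"
      using Dmeas[OF P PN(2) c_def[symmetric]] Dmeas[OF N PN(3) cN] c by simp
    moreover have "(LINT w|M. Z w * indicator B (X w)) =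
      (LINT w|M. P w * indicator B (X w)) - (LINT w|M. N w * indicator B (X w))"
      by (subst Bochner_Integration.integral_diff[symmetric]) (auto simp: ind P N PN(1) algebra_simps)
    ultimately show ?thesis by simp
  qed
qed

text \<open>
  A complex weight reduces to its real and imaginary part, since conjugation turns the hypothesis at
  \<open>t\<close> into the one at \<open>- t\<close> for the conjugate weight.
\<close>

lemma fourier_weight_complex:
  fixes Z :: "'a \<Rightarrow> complex" and X :: "'a \<Rightarrow> real"
  assumes Z: "integrable M Z" and X[measurable]: "X \<in> borel_measurable M"
    and zero: "\<And>t. (CLINT w|M. Z w * iexp (t * X w)) = 0"
    and B[measurable]: "B \<in> sets borel"
  shows "(CLINT w|M. Z w * indicator B (X w)) = 0"
proof -
  have [measurable]: "Z \<in> borel_measurable M" using Z by auto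
  have int: "integrable M (\<lambda>w. f w * iexp (t * X w))" if "integrable M f" for f t
    by (rule Bochner_Integration.integrable_bound[OF that]) (use that in \<open>auto simp: norm_mult\<close>)
  have Zc: "integrable M (\<lambda>w. cnj (Z w))" using Z by simp
  have zc: "(CLINT w|M. cnj (Z w) * iexp (t * X w)) = 0" for t
  proof -
    have "(CLINT w|M. cnj (Z w * iexp ((-t) * X w))) = cnj (CLINT w|M. Z w * iexp ((-t) * X w))"
      by (rule Bochner_Integration.integral_cnj)
    then show ?thesis using zero[of "-t"] by (simp add: exp_cnj)
  qed
  have re: "(CLINT w|M. complex_of_real (Re (Z w)) * iexp (t * X w)) = 0" for t
  proof -
    have "(CLINT w|M. complex_of_real (Re (Z w)) * iexp (t * X w)) =
      (CLINT w|M. (Z w * iexp (t * X w) + cnj (Z w) * iexp (t * X w)) / 2)"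
      by (intro Bochner_Integration.integral_cong) (auto simp: complex_add_cnj ring_distribs[symmetric])
    also have "\<dots> = 0" using int[OF Z] int[OF Zc] zero zc by simp
    finally show ?thesis .
  qed
  have im: "(CLINT w|M. complex_of_real (Im (Z w)) * iexp (t * X w)) = 0" for t
  proof -
    have "(CLINT w|M. complex_of_real (Im (Z w)) * iexp (t * X w)) =
      (CLINT w|M. (Z w * iexp (t * X w) - cnj (Z w) * iexp (t * X w)) / (2 * \<i>))"
    proof (intro Bochner_Integration.integral_cong refl)
      fix w
      have "Z w - cnj (Z w) = 2 * \<i> * complex_of_real (Im (Z w))"
        by (simp add: complex_diff_cnj)
      then show "complex_of_real (Im (Z w)) * iexp (t * X w) =
          (Z w * iexp (t * X w) - cnj (Z w) * iexp (t * X w)) / (2 * \<i>)"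
        unfolding left_diff_distrib[symmetric] by simp
    qed
    also have "\<dots> = 0" using int[OF Z] int[OF Zc] zero zc by simp
    finally show ?thesis .
  qed
  have i: "integrable M (\<lambda>w. Z w * indicator B (X w))"
    by (rule Bochner_Integration.integrable_bound[OF Z]) (auto simp: indicator_def)
  have "Re (CLINT w|M. Z w * indicator B (X w)) = (LINT w|M. Re (Z w) * indicator B (X w))"
    by (subst integral_Re[symmetric, OF i]) (auto intro!: Bochner_Integration.integral_cong simp: indicator_def)
  moreover have "Im (CLINT w|M. Z w * indicator B (X w)) = (LINT w|M. Im (Z w) * indicator B (X w))"
    by (subst integral_Im[symmetric, OF i]) (auto intro!: Bochner_Integration.integral_cong simp: indicator_def)
  ultimately show ?thesis
    using fourier_weight_real[of M "\<lambda>w. Re (Z w)", OF _ X re B] fourier_weight_real[of M "\<lambda>w. Im (Z w)", OF _ X im B] Z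
    by (simp add: complex_eq_iff integrable_Re integrable_Im)
qed

text \<open>
  Uniqueness in several variables follows from the one-dimensional case by replacing the
  exponentials by indicators one coordinate at a time: the factors of the other coordinates are
  absorbed into a complex weight.
\<close>

lemma fourier_weight_multi:
  fixes Z :: "'a \<Rightarrow> real" and X :: "nat \<Rightarrow> 'a \<Rightarrow> real"
  assumes Z: "integrable M Z" and X: "\<And>i. i < n \<Longrightarrow> X i \<in> borel_measurable M"
    and zero: "\<And>b. (CLINT w|M. complex_of_real (Z w) * iexp (\<Sum>i<n. b i * X i w)) = 0"
    and B: "\<And>i. i < n \<Longrightarrow> B i \<in> sets borel"
  shows "(LINT w|M. Z w * (\<Prod>i<n. indicator (B i) (X i w))) = 0"
proof -
  have [measurable]: "Z \<in> borel_measurable M" using Z by auto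
  have "\<forall>b. (CLINT w|M. complex_of_real (Z w) * (\<Prod>i<j. indicator (B i) (X i w)) * iexp (\<Sum>i=j..<n. b i * X i w)) = 0"
    if "j \<le> n" for j
    using that
  (* the first j coordinates carry indicators, the others still characters *)
  proof (induction j)
    case 0
    then show ?case using zero by (simp add: lessThan_atLeast0)
  next
    case (Suc j)
    show ?case
    proof
      fix b
      have [measurable]: "X i \<in> borel_measurable M" if "i < n" for i using X that by simp
      have [measurable]: "(\<lambda>w. \<Sum>i=Suc j..<n. b i * X i w) \<in> borel_measurable M"
        by (intro borel_measurable_sum borel_measurable_times) (auto simp: X)
      have [measurable]: "(\<lambda>w. \<Prod>i<j. indicator (B i) (X i w) :: complex) \<in> borel_measurable M"
        using Suc.prems B X by (intro borel_measurable_prod) (auto intro!: measurable_compose[OF _ borel_measurable_indicator])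
      define W where "W = (\<lambda>w. complex_of_real (Z w) * (\<Prod>i<j. indicator (B i) (X i w)) * iexp (\<Sum>i=Suc j..<n. b i * X i w))"
      have "integrable M W"
      proof (rule Bochner_Integration.integrable_bound[OF Z])
        show "W \<in> borel_measurable M" unfolding W_def by measurable
        have "(\<Prod>i<j. norm (indicator (B i) (X i w) :: complex)) \<le> 1" for w
          by (intro prod_le_1) (auto simp: indicator_def)
        then show "AE w in M. norm (W w) \<le> norm (Z w)"
          unfolding W_def
          by (auto simp: norm_mult prod_norm[symmetric] intro!: mult_left_le)
      qed
      moreover have "(CLINT w|M. W w * iexp (t * X j w)) = 0" for t
      proof -
        have "(\<Sum>i=j..<n. (b(j:=t)) i * X i w) = t * X j w + (\<Sum>i=Suc j..<n. b i * X i w)" for w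
          using Suc.prems by (subst sum.atLeast_Suc_lessThan) auto
        then have "W w * iexp (t * X j w) = complex_of_real (Z w) * (\<Prod>i<j. indicator (B i) (X i w)) * iexp (\<Sum>i=j..<n. (b(j:=t)) i * X i w)" for w
          unfolding W_def by (simp add: exp_add[symmetric] ring_distribs mult_ac add_ac)
        then show ?thesis using Suc by auto
      qed
      ultimately have "(CLINT w|M. W w * indicator (B j) (X j w)) = 0"
        using Suc.prems X B by (intro fourier_weight_complex) auto
      then show "(CLINT w|M. complex_of_real (Z w) * (\<Prod>i<Suc j. indicator (B i) (X i w)) * iexp (\<Sum>i=Suc j..<n. b i * X i w)) = 0"
        unfolding W_def by (simp add: mult_ac)
    qed
  qed
  from this[of n] have "(CLINT w|M. complex_of_real (Z w) * (\<Prod>i<n. indicator (B i) (X i w))) = 0"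
    by simp
  also have "(\<lambda>w. complex_of_real (Z w) * (\<Prod>i<n. indicator (B i) (X i w))) =
      (\<lambda>w. complex_of_real (Z w * (\<Prod>i<n. indicator (B i) (X i w))))"
    by (auto simp: fun_eq_iff of_real_indicator)
  also have "(CLINT w|M. complex_of_real (Z w * (\<Prod>i<n. indicator (B i) (X i w)))) =
      complex_of_real (LINT w|M. Z w * (\<Prod>i<n. indicator (B i) (X i w)))"
    by (rule integral_complex_of_real)
  finally show ?thesis unfolding of_real_eq_0_iff .
qed

text \<open>
  A weight that is orthogonal to all characters of the data is orthogonal to every function of the
  data: its positive and negative part induce the same measure on the space of data.
\<close>

lemma fourier_weight_orthogonal:
  fixes Z :: "'a \<Rightarrow> real" and X :: "nat \<Rightarrow> 'a \<Rightarrow> real"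
  assumes Z: "integrable M Z" and X: "\<And>i. i < n \<Longrightarrow> X i \<in> borel_measurable M"
    and zero: "\<And>b. (CLINT w|M. complex_of_real (Z w) * iexp (\<Sum>i<n. b i * X i w)) = 0"
    and u[measurable]: "u \<in> borel_measurable (PiM {..<n} (\<lambda>_. borel))"
    and int: "integrable M (\<lambda>w. Z w * u (\<lambda>i\<in>{..<n}. X i w))"
  shows "(LINT w|M. Z w * u (\<lambda>i\<in>{..<n}. X i w)) = 0"
proof -
  have [measurable]: "Z \<in> borel_measurable M" using Z by auto
  define V where "V w = (\<lambda>i\<in>{..<n}. X i w)" for w
  note int = int[folded V_def]
  have V[measurable]: "V \<in> measurable M (PiM {..<n} (\<lambda>_. borel))"
    unfolding V_def[abs_def] by (intro measurable_restrict) (auto simp: X)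
  define P where "P = (\<lambda>w. max 0 (Z w))"
  define N where "N = (\<lambda>w. max 0 (- Z w))"
  have [measurable]: "P \<in> borel_measurable M" "N \<in> borel_measurable M" unfolding P_def N_def by auto
  have P: "integrable M P" and N: "integrable M N"
    unfolding P_def N_def using Z by (auto intro!: integrable_max)
  have PN: "Z w = P w - N w" "0 \<le> P w" "0 \<le> N w" for w unfolding P_def N_def by auto
  define D where "D f = distr (density M (\<lambda>w. ennreal (f w))) (PiM {..<n} (\<lambda>_. borel)) V" for f :: "'a \<Rightarrow> real"
  have Dem: "emeasure (D f) (Pi\<^sub>E {..<n} A) = ennreal (LINT w|M. f w * (\<Prod>i<n. indicator (A i) (X i w)))"
    if f: "integrable M f" "\<And>w. 0 \<le> f w" and A: "\<And>i. i < n \<Longrightarrow> A i \<in> sets borel" for f A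
  proof -
    have [measurable]: "f \<in> borel_measurable M" using that by auto
    have [measurable]: "Pi\<^sub>E {..<n} A \<in> sets (PiM {..<n} (\<lambda>_. borel))"
      using A by (intro sets_PiM_I_finite) auto
    have *: "indicator (Pi\<^sub>E {..<n} A) (V w) = (\<Prod>i<n. indicator (A i) (X i w) :: real)" for w
    proof (cases "\<forall>i<n. X i w \<in> A i")
      case True
      then show ?thesis by (auto simp: V_def indicator_def)
    next
      case False
      then obtain i where "i < n" "X i w \<notin> A i" by auto
      then have "V w \<notin> Pi\<^sub>E {..<n} A" by (auto simp: V_def PiE_def Pi_def)
      then show ?thesis using \<open>i < n\<close> \<open>X i w \<notin> A i\<close> by (auto intro!: prod_zero[symmetric] bexI[of _ i])
    qed
    have i: "integrable M (\<lambda>w. f w * indicator (Pi\<^sub>E {..<n} A) (V w))"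
      by (rule Bochner_Integration.integrable_bound[OF f(1)]) (auto simp: indicator_def)
    have "emeasure (D f) (Pi\<^sub>E {..<n} A) = (\<integral>\<^sup>+w. ennreal (f w) * indicator (V -` Pi\<^sub>E {..<n} A \<inter> space M) w \<partial>M)"
      unfolding D_def by (simp add: emeasure_distr emeasure_density)
    also have "\<dots> = (\<integral>\<^sup>+w. ennreal (f w * indicator (Pi\<^sub>E {..<n} A) (V w)) \<partial>M)"
      by (intro nn_integral_cong) (auto simp: indicator_def)
    also have "\<dots> = ennreal (LINT w|M. f w * indicator (Pi\<^sub>E {..<n} A) (V w))"
      using i f by (intro nn_integral_eq_integral) auto
    finally show ?thesis by (simp add: *)
  qed
  have "D P = D N"
  proof (rule measure_eqI_PiM_finite[where I="{..<n}" and M="\<lambda>_. borel" and A="\<lambda>_. Pi\<^sub>E {..<n} (\<lambda>_. UNIV)"])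
    fix A :: "nat \<Rightarrow> real set" assume A: "\<And>i. i \<in> {..<n} \<Longrightarrow> A i \<in> sets borel"
    have mp[measurable]: "(\<lambda>w. (\<Prod>i<n. indicator (A i) (X i w)) :: real) \<in> borel_measurable M"
      using A X by (intro borel_measurable_prod) (auto intro!: measurable_compose[OF _ borel_measurable_indicator])
    have b: "norm (\<Prod>i<n. indicator (A i) (X i w) :: real) \<le> 1" for w
      unfolding prod_norm[symmetric] by (intro prod_le_1) (auto simp: indicator_def)
    have int': "integrable M (\<lambda>w. f w * (\<Prod>i<n. indicator (A i) (X i w)))" if "integrable M f" for f :: "'a \<Rightarrow> real"
      by (rule Bochner_Integration.integrable_bound[OF that])
         (use that b in \<open>auto simp: abs_mult intro!: mult_left_le\<close>)
    have "(LINT w|M. Z w * (\<Prod>i<n. indicator (A i) (X i w))) = 0"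
      using A by (intro fourier_weight_multi[OF Z X zero]) auto
    moreover have "(LINT w|M. Z w * (\<Prod>i<n. indicator (A i) (X i w))) =
      (LINT w|M. P w * (\<Prod>i<n. indicator (A i) (X i w))) - (LINT w|M. N w * (\<Prod>i<n. indicator (A i) (X i w)))"
      by (subst Bochner_Integration.integral_diff[symmetric]) (auto simp: int' P N PN(1) left_diff_distrib)
    ultimately show "emeasure (D P) (Pi\<^sub>E {..<n} A) = emeasure (D N) (Pi\<^sub>E {..<n} A)"
      using A by (simp add: Dem P N PN)
  next
    show "range (\<lambda>_::nat. Pi\<^sub>E {..<n} (\<lambda>_. UNIV)) \<subseteq> prod_algebra {..<n} (\<lambda>_. borel :: real measure)"
      by (auto intro!: prod_algebraI_finite)
    show "emeasure (D P) (Pi\<^sub>E {..<n} (\<lambda>_. UNIV)) \<noteq> \<infinity>"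
      by (simp add: Dem P PN)
  qed (auto simp: D_def space_PiM)
  have Dint: "integral\<^sup>L (D f) u = (LINT w|M. f w * u (V w))" if "integrable M f" "\<And>w. 0 \<le> f w" for f
  proof -
    have [measurable]: "f \<in> borel_measurable M" using that by auto
    show ?thesis unfolding D_def
      by (subst integral_distr) (auto simp: integral_density that)
  qed
  have iu: "integrable M (\<lambda>w. P w * u (V w))" "integrable M (\<lambda>w. N w * u (V w))"
    by (rule Bochner_Integration.integrable_bound[OF int], simp,
        auto simp: P_def N_def abs_mult intro!: mult_right_mono)+
  have "(LINT w|M. P w * u (V w)) = (LINT w|M. N w * u (V w))"
    using Dint[OF P PN(2)] Dint[OF N PN(3)] \<open>D P = D N\<close> by simp
  moreover have "(LINT w|M. Z w * u (V w)) = (LINT w|M. P w * u (V w)) - (LINT w|M. N w * u (V w))"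
    by (subst Bochner_Integration.integral_diff[symmetric]) (auto simp: iu PN(1) left_diff_distrib)
  ultimately show ?thesis by (simp add: V_def)
qed

section \<open>Estimation in Gaussian spaces\<close>

text \<open>
  A linear space of centred, jointly Gaussian variables. Since the space is closed under linear
  combinations, it is enough to prescribe the characteristic function at \<open>1\<close>; this form also covers
  degenerate variables, which have no density.
\<close>

locale gaussian_space = prob_space M for M :: "'a measure" +
  fixes G :: "('a \<Rightarrow> real) set"
  assumes zero_mem: "(\<lambda>w. 0) \<in> G"
    and add_mem: "X \<in> G \<Longrightarrow> Y \<in> G \<Longrightarrow> (\<lambda>w. X w + Y w) \<in> G"
    and scale_mem: "X \<in> G \<Longrightarrow> (\<lambda>w. c * X w) \<in> G"
    and meas: "X \<in> G \<Longrightarrow> X \<in> borel_measurable M"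
    and sq_integrable: "X \<in> G \<Longrightarrow> integrable M (\<lambda>w. (X w)\<^sup>2)"
    and char_fun: "X \<in> G \<Longrightarrow>
      (CLINT w|M. iexp (X w)) = complex_of_real (exp (- (LINT w|M. (X w)\<^sup>2) / 2))"
begin

lemma sum_mem: "(\<And>i. i \<in> I \<Longrightarrow> X i \<in> G) \<Longrightarrow> (\<lambda>w. \<Sum>i\<in>I. c i * X i w) \<in> G"
  by (induction I rule: infinite_finite_induct) (auto intro!: zero_mem add_mem scale_mem)

lemma diff_mem: "X \<in> G \<Longrightarrow> Y \<in> G \<Longrightarrow> (\<lambda>w. X w - Y w) \<in> G"
  using add_mem[of X "\<lambda>w. -1 * Y w"] scale_mem[of Y "-1"] by simp

lemma product_integrable_of_squares:
  fixes X Y :: "'a \<Rightarrow> real"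
  assumes [measurable]: "X \<in> borel_measurable M" "Y \<in> borel_measurable M"
    and "integrable M (\<lambda>w. (X w)\<^sup>2)" "integrable M (\<lambda>w. (Y w)\<^sup>2)"
  shows "integrable M (\<lambda>w. X w * Y w)"
proof (rule Bochner_Integration.integrable_bound)
  show "integrable M (\<lambda>w. (X w)\<^sup>2 + (Y w)\<^sup>2)" using assms by simp
  have "\<bar>a * b\<bar> \<le> a\<^sup>2 + b\<^sup>2" for a b :: real
  proof -
    have "0 \<le> (\<bar>a\<bar> - \<bar>b\<bar>)\<^sup>2" by simp
    moreover have "0 \<le> \<bar>a * b\<bar>" by simp
    moreover have "(\<bar>a\<bar> - \<bar>b\<bar>)\<^sup>2 = a\<^sup>2 + b\<^sup>2 - 2 * \<bar>a * b\<bar>" by (simp add: power2_diff abs_mult)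
    ultimately show ?thesis by linarith
  qed
  then show "AE w in M. norm (X w * Y w) \<le> norm ((X w)\<^sup>2 + (Y w)\<^sup>2)" by auto
qed measurable

lemma mult_integrable: "X \<in> G \<Longrightarrow> Y \<in> G \<Longrightarrow> integrable M (\<lambda>w. X w * Y w)"
  by (intro product_integrable_of_squares meas sq_integrable)

lemma integrable_mem: "X \<in> G \<Longrightarrow> integrable M X"
  using product_integrable_of_squares[of X "\<lambda>_. 1"] meas sq_integrable by simp

text \<open>
  The characteristic function of \<open>Y + t X\<close> is \<open>exp (- (V Y + t\<^sup>2 V X) / 2)\<close>, which has zero derivative at
  \<open>t = 0\<close>; on the other side this derivative is the expectation of \<open>\<i> X exp (\<i> Y)\<close>. The remainder
  estimate for the exponential replaces differentiation under the integral.
\<close>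

lemma uncorrelated_fourier:
  assumes X: "X \<in> G" and Y: "Y \<in> G" and orth: "(LINT w|M. X w * Y w) = 0"
  shows "(CLINT w|M. complex_of_real (X w) * iexp (Y w)) = 0"
proof -
  have [measurable]: "X \<in> borel_measurable M" "Y \<in> borel_measurable M" using X Y meas by auto
  define V where "V Z = (LINT w|M. (Z w)\<^sup>2)" for Z :: "'a \<Rightarrow> real"
  define c where "c = (CLINT w|M. complex_of_real (X w) * iexp (Y w))"
  have V0: "0 \<le> V Z" for Z unfolding V_def by simp
  have VtX: "V (\<lambda>w. Y w + t * X w) = V Y + t\<^sup>2 * V X" for t
  proof -
    have "V (\<lambda>w. Y w + t * X w) = (LINT w|M. (Y w)\<^sup>2 + (2 * t * (X w * Y w) + t\<^sup>2 * (X w)\<^sup>2))"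
      unfolding V_def by (intro Bochner_Integration.integral_cong) (auto simp: power2_eq_square algebra_simps)
    also have "\<dots> = V Y + (2 * t * (LINT w|M. X w * Y w) + t\<^sup>2 * V X)"
      unfolding V_def using X Y by (subst Bochner_Integration.integral_add) (auto simp: sq_integrable mult_integrable)
    finally show ?thesis using orth by simp
  qed
  have ie: "integrable M (\<lambda>w. iexp (Z w))" if "Z \<in> G" for Z
    using meas[OF that] by (intro integrable_iexp) auto
  have iX: "integrable M (\<lambda>w. complex_of_real (X w) * iexp (Y w))"
    by (rule Bochner_Integration.integrable_bound[OF integrable_mem[OF X]]) (auto simp: norm_mult)
  (* the left side is linear in t and the right side quadratic, so c must vanish *)
  have bound: "\<bar>t\<bar> * norm c \<le> t\<^sup>2 * V X" for t
  proof -
    have GtX: "(\<lambda>w. Y w + t * X w) \<in> G" using X Y by (intro add_mem scale_mem)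
    (* second-order remainder of the expansion of exp (i (Y + t X)) in t *)
    define r where "r w = iexp (Y w + t * X w) - iexp (Y w) - \<i> * t * (complex_of_real (X w) * iexp (Y w))" for w
    have ir: "integrable M r" unfolding r_def using ie[OF GtX] ie[OF Y] iX by auto
    have "norm (r w) \<le> t\<^sup>2 / 2 * (X w)\<^sup>2" for w
    proof -
      have "r w = iexp (Y w) * (iexp (t * X w) - (\<Sum>k\<le>1. (\<i> * (t * X w))^k / fact k))"
        unfolding r_def by (simp add: algebra_simps exp_add)
      then have "norm (r w) = norm (iexp (t * X w) - (\<Sum>k\<le>1. (\<i> * (t * X w))^k / fact k))"
        by (simp add: norm_mult del: of_real_mult)
      also have "\<dots> \<le> \<bar>t * X w\<bar> ^ Suc 1 / fact (Suc 1)" by (rule iexp_approx1)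
      also have "\<dots> = t\<^sup>2 / 2 * (X w)\<^sup>2" by (simp add: power2_eq_square abs_mult algebra_simps numeral_2_eq_2)
      finally show ?thesis .
    qed
    then have "norm (integral\<^sup>L M r) \<le> (LINT w|M. t\<^sup>2 / 2 * (X w)\<^sup>2)"
      using ir X by (intro integral_norm_bound[THEN order_trans] integral_mono) (auto simp: sq_integrable)
    also have "\<dots> = t\<^sup>2 / 2 * V X" unfolding V_def by simp
    finally have r: "norm (integral\<^sup>L M r) \<le> t\<^sup>2 / 2 * V X" .
    have "integral\<^sup>L M r = (CLINT w|M. iexp (Y w + t * X w)) - (CLINT w|M. iexp (Y w)) - \<i> * t * c"
      unfolding r_def c_def using ie[OF GtX] ie[OF Y] iX by (simp del: of_real_add of_real_mult)
    then have c: "\<i> * t * c = (CLINT w|M. iexp (Y w + t * X w)) - (CLINT w|M. iexp (Y w)) - integral\<^sup>L M r"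
      by simp
    have d: "(CLINT w|M. iexp (Y w + t * X w)) - (CLINT w|M. iexp (Y w)) =
      complex_of_real (exp (- (V Y + t\<^sup>2 * V X) / 2) - exp (- V Y / 2))"
      using char_fun[OF GtX] char_fun[OF Y] unfolding V_def[symmetric] VtX by simp
    have "\<bar>exp (- (V Y + t\<^sup>2 * V X) / 2) - exp (- V Y / 2)\<bar> = exp (- V Y / 2) * (1 - exp (- (t\<^sup>2 * V X) / 2))"
    proof -
      have "exp (- (V Y + t\<^sup>2 * V X) / 2) = exp (- V Y / 2) * exp (- (t\<^sup>2 * V X) / 2)"
        by (simp add: exp_add[symmetric] add_divide_distrib)
      moreover have "exp (- (t\<^sup>2 * V X) / 2) \<le> 1" using V0[of X] by simp
      ultimately show ?thesis by (simp add: abs_if algebra_simps)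
    qed
    also have "\<dots> \<le> 1 * (t\<^sup>2 * V X / 2)"
      using V0[of X] V0[of Y] exp_ge_add_one_self[of "- (t\<^sup>2 * V X) / 2"] by (intro mult_mono) auto
    finally have e: "\<bar>exp (- (V Y + t\<^sup>2 * V X) / 2) - exp (- V Y / 2)\<bar> \<le> t\<^sup>2 / 2 * V X" by simp
    have "\<bar>t\<bar> * norm c = norm (\<i> * t * c)" by (simp add: norm_mult)
    also have "\<dots> \<le> norm (complex_of_real (exp (- (V Y + t\<^sup>2 * V X) / 2) - exp (- V Y / 2))) + norm (integral\<^sup>L M r)"
      unfolding c d by (rule norm_triangle_ineq4)
    also have "\<dots> \<le> t\<^sup>2 / 2 * V X + t\<^sup>2 / 2 * V X"
      using e r unfolding norm_of_real by (intro add_mono)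
    finally show ?thesis by (simp add: mult.commute)
  qed
  have "norm c \<le> 0"
  proof (rule field_le_epsilon)
    fix e :: real assume e: "0 < e"
    define t where "t = e / (1 + V X)"
    have t: "0 < t" unfolding t_def using e V0[of X] by simp
    from bound[of t] t have "norm c \<le> t * V X" by (simp add: power2_eq_square)
    also have "\<dots> \<le> e" unfolding t_def using V0[of X] e by (simp add: field_simps)
    finally show "norm c \<le> 0 + e" by simp
  qed
  then show ?thesis unfolding c_def by simp
qed

text \<open>
  The form in which joint Gaussianity enters the lower bound: an uncorrelated variable is orthogonal
  even to nonlinear functions of the data.
\<close>

lemma uncorrelated_with_function:
  fixes N :: "nat \<Rightarrow> 'a \<Rightarrow> real"
  assumes X: "X \<in> G" and N: "\<And>i. i < n \<Longrightarrow> N i \<in> G"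
    and orth: "\<And>i. i < n \<Longrightarrow> (LINT w|M. X w * N i w) = 0"
    and u: "u \<in> borel_measurable (PiM {..<n} (\<lambda>_. borel))"
    and int: "integrable M (\<lambda>w. X w * u (\<lambda>i\<in>{..<n}. N i w))"
  shows "(LINT w|M. X w * u (\<lambda>i\<in>{..<n}. N i w)) = 0"
proof (rule fourier_weight_orthogonal[OF integrable_mem[OF X] _ _ u int])
  fix b :: "nat \<Rightarrow> real"
  have "(LINT w|M. X w * (\<Sum>i<n. b i * N i w)) = (LINT w|M. (\<Sum>i<n. b i * (X w * N i w)))"
    by (simp add: sum_distrib_left mult_ac)
  also have "\<dots> = 0"
    using X N orth by (subst Bochner_Integration.integral_sum) (auto simp: mult_integrable)
  finally show "(CLINT w|M. complex_of_real (X w) * iexp (\<Sum>i<n. b i * N i w)) = 0"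
    using X N by (intro uncorrelated_fourier sum_mem) auto
qed (use N meas in auto)

text \<open>
  The last clause says that the \<open>U i\<close> generate the \<open>N k\<close> up to null sets. It is phrased by
  orthogonality because degenerate directions are dropped, so an equation between functions is
  not available.
\<close>

lemma gram_schmidt:
  fixes N :: "nat \<Rightarrow> 'a \<Rightarrow> real"
  assumes "\<forall>i<n. N i \<in> G"
  shows "\<exists>m U c. m \<le> n \<and> (\<forall>i<m. U i \<in> G) \<and>
     (\<forall>i<m. \<forall>j<m. (LINT w|M. U i w * U j w) = (if i = j then 1 else 0)) \<and>
     (\<forall>i<m. U i = (\<lambda>w. \<Sum>k<n. c i k * N k w)) \<and>
     (\<forall>Y\<in>G. (\<forall>i<m. (LINT w|M. Y w * U i w) = 0) \<longrightarrow> (\<forall>k<n. (LINT w|M. Y w * N k w) = 0))"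
  using assms
proof (induction n)
  case 0
  then show ?case by (intro exI[of _ 0]) simp
next
  case (Suc n)
  have Ns: "\<forall>i<n. N i \<in> G" using Suc.prems by auto
  from Suc.IH[OF Ns] obtain m U c where m: "m \<le> n" and gs: "\<forall>i<m. U i \<in> G"
      "\<forall>i<m. \<forall>j<m. (LINT w|M. U i w * U j w) = (if i = j then 1 else 0)"
      "\<forall>i<m. U i = (\<lambda>w. \<Sum>k<n. c i k * N k w)"
      "\<forall>Y\<in>G. (\<forall>i<m. (LINT w|M. Y w * U i w) = 0) \<longrightarrow> (\<forall>k<n. (LINT w|M. Y w * N k w) = 0)"
    by (elim exE conjE) (rule that)
  note U = gs(1)[rule_format] and on = gs(2)[rule_format] and Uc = gs(3)[rule_format]
  have comp: "(LINT w|M. Y w * N k w) = 0"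
    if "Y \<in> G" "\<And>i. i < m \<Longrightarrow> (LINT w|M. Y w * U i w) = 0" "k < n" for Y k
    using gs(4) that by blast
  have Nn: "N n \<in> G" using Suc.prems by simp
  define a where "a i = (LINT w|M. N n w * U i w)" for i
  (* the part of the new functional that the previous ones do not explain *)
  define R where "R = (\<lambda>w. N n w - (\<Sum>i<m. a i * U i w))"
  have R: "R \<in> G" unfolding R_def using Nn U by (intro diff_mem sum_mem) auto
  have YR: "(LINT w|M. Y w * R w) = (LINT w|M. Y w * N n w) - (\<Sum>i<m. a i * (LINT w|M. Y w * U i w))" if "Y \<in> G" for Y
  proof -
    have "(LINT w|M. Y w * R w) = (LINT w|M. Y w * N n w - (\<Sum>i<m. a i * (Y w * U i w)))"
      unfolding R_def by (simp add: right_diff_distrib sum_distrib_left mult_ac)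
    also have "\<dots> = (LINT w|M. Y w * N n w) - (LINT w|M. (\<Sum>i<m. a i * (Y w * U i w)))"
      using U Nn that by (intro Bochner_Integration.integral_diff Bochner_Integration.integrable_sum) (auto simp: mult_integrable)
    also have "(LINT w|M. (\<Sum>i<m. a i * (Y w * U i w))) = (\<Sum>i<m. a i * (LINT w|M. Y w * U i w))"
      using U that by (subst Bochner_Integration.integral_sum) (auto simp: mult_integrable)
    finally show ?thesis .
  qed
  have RU: "(LINT w|M. U j w * R w) = 0" if "j < m" for j
  proof -
    have "(LINT w|M. U j w * R w) = (LINT w|M. U j w * N n w) - (\<Sum>i<m. if i = j then a i else 0)"
      using on[OF that] by (subst YR[OF U[OF that]]) (intro arg_cong2[where f="(-)"] sum.cong refl; simp)
    also have "(LINT w|M. U j w * N n w) = a j" unfolding a_def by (simp only: mult.commute)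
    also have "a j - (\<Sum>i<m. if i = j then a i else 0) = 0" using that by simp
    finally show ?thesis .
  qed
  define v where "v = (LINT w|M. (R w)\<^sup>2)"
  have v0: "0 \<le> v" unfolding v_def by simp
  show ?case
  proof (cases "v = 0")
    case True
    then have R0: "AE w in M. R w = 0"
      unfolding v_def using integral_nonneg_eq_0_iff_AE[OF sq_integrable[OF R]] by simp
    have compn: "(LINT w|M. Y w * N n w) = 0" if "Y \<in> G" "\<And>i. i < m \<Longrightarrow> (LINT w|M. Y w * U i w) = 0" for Y
    proof -
      have "(LINT w|M. Y w * R w) = 0"
        using R0 by (intro integral_eq_zero_AE) (auto elim!: eventually_mono)
      then show ?thesis using YR[OF that(1)] that(2) by simp
    qed
    show ?thesis
      using m U on comp compn Uc
      by (intro exI[of _ m] exI[of _ U] exI[of _ "\<lambda>i k. if k < n then c i k else 0"]) (auto simp: less_Suc_eq)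
  next
    case False
    then have v: "0 < v" using v0 by simp
    define U' where "U' = U(m := (\<lambda>w. R w / sqrt v))"
    have UG: "U' i \<in> G" if "i < Suc m" for i
      using that U scale_mem[OF R, of "1 / sqrt v"] by (auto simp: U'_def less_Suc_eq)
    have U'm: "(LINT w|M. Y w * U' m w) = (LINT w|M. Y w * R w) / sqrt v" for Y
      by (simp add: U'_def)
    have on': "(LINT w|M. U' i w * U' j w) = (if i = j then 1 else 0)" if "i < Suc m" "j < Suc m" for i j
    proof -
      have "(LINT w|M. U' m w * U' m w) = (LINT w|M. (R w)\<^sup>2 / v)"
        using v by (intro Bochner_Integration.integral_cong) (auto simp: U'_def power2_eq_square)
      also have "\<dots> = 1" using v by (simp add: v_def[symmetric])
      finally have mm: "(LINT w|M. U' m w * U' m w) = 1" .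
      have jm: "(LINT w|M. U' j w * U' m w) = 0" if "j < m" for j
        using RU[OF that] that by (simp add: U'm) (simp add: U'_def)
      have mj: "(LINT w|M. U' m w * U' j w) = 0" if "j < m" for j
        using jm[OF that] by (simp add: mult.commute)
      have jj: "(LINT w|M. U' i w * U' j w) = (if i = j then 1 else 0)" if "i < m" "j < m" for i j
        using on[of i j] that by (simp add: U'_def)
      show ?thesis using that mm jm mj jj by (auto simp: less_Suc_eq)
    qed
    have comp': "(LINT w|M. Y w * N k w) = 0"
      if Y: "Y \<in> G" and YU: "\<And>i. i < Suc m \<Longrightarrow> (LINT w|M. Y w * U' i w) = 0" and k: "k < Suc n" for Y k
    proof -
      have Yi: "(LINT w|M. Y w * U i w) = 0" if "i < m" for i
        using YU[of i] that by (simp add: U'_def)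
      moreover have "(LINT w|M. Y w * R w) = 0"
        using YU[of m] v by (simp add: U'm)
      ultimately have "(LINT w|M. Y w * N n w) = 0" using YR[OF Y] by simp
      then show ?thesis using comp[OF Y Yi] k by (auto simp: less_Suc_eq)
    qed
    define c' where "c' i k = (if i < m then (if k < n then c i k else 0)
       else ((if k = n then 1 else 0) - (if k < n then (\<Sum>l<m. a l * c l k) else 0)) / sqrt v)" for i k
    have "U' i = (\<lambda>w. \<Sum>k<Suc n. c' i k * N k w)" if "i < Suc m" for i
    proof (cases "i < m")
      case True
      then show ?thesis using Uc by (simp add: U'_def c'_def)
    next
      case False
      then have i: "i = m" using that by simp
      have "(\<Sum>k<Suc n. c' m k * N k w) = R w / sqrt v" for w
      proof -
        have "(\<Sum>i<m. a i * U i w) = (\<Sum>i<m. a i * (\<Sum>k<n. c i k * N k w))"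
          by (intro sum.cong refl) (simp add: Uc)
        also have "\<dots> = (\<Sum>k<n. (\<Sum>i<m. a i * c i k) * N k w)"
          by (subst sum_distrib_left, subst sum.swap) (simp add: sum_distrib_left sum_distrib_right mult_ac)
        finally show ?thesis
          by (simp add: c'_def R_def diff_divide_distrib sum_divide_distrib[symmetric] sum_negf)
      qed
      then show ?thesis using i by (simp add: U'_def)
    qed
    then show ?thesis
      using m UG on' comp'
      by (intro exI[of _ "Suc m"] exI[of _ U'] exI[of _ c']) auto
  qed
qed

text \<open>
  The regression residual of \<open>X\<close> is uncorrelated with the data, hence orthogonal to the difference
  of the regression and any other estimate, and Pythagoras' theorem applies.
\<close>

lemma estimate_lower_bound:
  fixes N U :: "nat \<Rightarrow> 'a \<Rightarrow> real"
  assumes X: "X \<in> G" and N: "\<And>i. i < n \<Longrightarrow> N i \<in> G" and U: "\<And>i. i < m \<Longrightarrow> U i \<in> G"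
    and on: "\<And>i j. i < m \<Longrightarrow> j < m \<Longrightarrow> (LINT w|M. U i w * U j w) = (if i = j then 1 else 0)"
    and Uc: "\<And>i. i < m \<Longrightarrow> U i = (\<lambda>w. \<Sum>k<n. c i k * N k w)"
    and comp: "\<And>Y k. Y \<in> G \<Longrightarrow> (\<And>i. i < m \<Longrightarrow> (LINT w|M. Y w * U i w) = 0) \<Longrightarrow> k < n \<Longrightarrow> (LINT w|M. Y w * N k w) = 0"
    and psi[measurable]: "\<psi> \<in> borel_measurable (PiM {..<n} (\<lambda>_. borel))"
  shows "ennreal ((LINT w|M. (X w)\<^sup>2) - (\<Sum>i<m. (LINT w|M. X w * U i w)\<^sup>2))
    \<le> (\<integral>\<^sup>+w. ennreal ((X w - \<psi> (\<lambda>i\<in>{..<n}. N i w))\<^sup>2) \<partial>M)"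
proof (cases "(\<integral>\<^sup>+w. ennreal ((X w - \<psi> (\<lambda>i\<in>{..<n}. N i w))\<^sup>2) \<partial>M) = \<infinity>")
  case True
  then show ?thesis by simp
next
  case False
  define V where "V w = (\<lambda>i\<in>{..<n}. N i w)" for w
  have [measurable]: "V \<in> measurable M (PiM {..<n} (\<lambda>_. borel))"
    unfolding V_def[abs_def] by (intro measurable_restrict) (use N meas in auto)
  have [measurable]: "X \<in> borel_measurable M" using X meas by auto
  define a where "a i = (LINT w|M. X w * U i w)" for i
  define R where "R = (\<lambda>w. X w - (\<Sum>i<m. a i * U i w))"
  have R: "R \<in> G" unfolding R_def using X U by (intro diff_mem sum_mem) auto
  then have [measurable]: "R \<in> borel_measurable M" using meas by auto
  have RY: "(LINT w|M. R w * Y w) = (LINT w|M. X w * Y w) - (\<Sum>i<m. a i * (LINT w|M. U i w * Y w))" if "Y \<in> G" for Y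
  proof -
    have "(LINT w|M. R w * Y w) = (LINT w|M. X w * Y w - (\<Sum>i<m. a i * (U i w * Y w)))"
      unfolding R_def by (intro Bochner_Integration.integral_cong) (auto simp: left_diff_distrib sum_distrib_right mult.assoc)
    also have "\<dots> = (LINT w|M. X w * Y w) - (LINT w|M. (\<Sum>i<m. a i * (U i w * Y w)))"
      using U X that by (intro Bochner_Integration.integral_diff Bochner_Integration.integrable_sum) (auto simp: mult_integrable)
    also have "(LINT w|M. (\<Sum>i<m. a i * (U i w * Y w))) = (\<Sum>i<m. a i * (LINT w|M. U i w * Y w))"
      using U that by (subst Bochner_Integration.integral_sum) (auto simp: mult_integrable)
    finally show ?thesis .
  qed
  have RU: "(LINT w|M. R w * U j w) = 0" if "j < m" for j
  proof -
    have "(LINT w|M. R w * U j w) = (LINT w|M. X w * U j w) - (\<Sum>i<m. if i = j then a i else 0)"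
      using on[OF _ that] by (subst RY[OF U[OF that]]) (intro arg_cong2[where f="(-)"] sum.cong refl; simp)
    also have "(LINT w|M. X w * U j w) = a j" unfolding a_def ..
    also have "a j - (\<Sum>i<m. if i = j then a i else 0) = 0" using that by simp
    finally show ?thesis .
  qed
  have RR: "(LINT w|M. (R w)\<^sup>2) = (LINT w|M. (X w)\<^sup>2) - (\<Sum>i<m. (a i)\<^sup>2)"
  proof -
    have "(LINT w|M. (R w)\<^sup>2) = (LINT w|M. R w * X w - (\<Sum>i<m. a i * (R w * U i w)))"
    proof (intro Bochner_Integration.integral_cong refl)
      fix w
      have "(R w)\<^sup>2 = R w * (X w - (\<Sum>i<m. a i * U i w))"
        unfolding power2_eq_square by (simp only: R_def)
      also have "\<dots> = R w * X w - (\<Sum>i<m. a i * (R w * U i w))"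
        unfolding right_diff_distrib sum_distrib_left by (simp only: mult.left_commute)
      finally show "(R w)\<^sup>2 = R w * X w - (\<Sum>i<m. a i * (R w * U i w))" .
    qed
    also have "\<dots> = (LINT w|M. R w * X w)"
    proof -
      have "(LINT w|M. (\<Sum>i<m. a i * (R w * U i w))) = (\<Sum>i<m. a i * (LINT w|M. R w * U i w))"
        using U R by (subst Bochner_Integration.integral_sum) (auto simp: mult_integrable)
      also have "\<dots> = 0" by (simp add: RU)
      finally show ?thesis using R U X
        by (subst Bochner_Integration.integral_diff) (auto intro!: Bochner_Integration.integrable_sum simp: mult_integrable)
    qed
    also have "\<dots> = (LINT w|M. X w * X w) - (\<Sum>i<m. a i * (LINT w|M. U i w * X w))"
      by (rule RY[OF X])
    also have "\<dots> = (LINT w|M. (X w)\<^sup>2) - (\<Sum>i<m. (a i)\<^sup>2)"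
      unfolding a_def by (simp add: power2_eq_square mult_ac)
    finally show ?thesis .
  qed
  (* linear regression minus the given estimate, as a function of the data alone *)
  define v where "v z = (\<Sum>i<m. a i * (\<Sum>k<n. c i k * z k)) - \<psi> z" for z
  have v[measurable]: "v \<in> borel_measurable (PiM {..<n} (\<lambda>_. borel))"
    unfolding v_def[abs_def]
    by (intro borel_measurable_diff psi borel_measurable_sum borel_measurable_times borel_measurable_const
          measurable_component_singleton) auto
  have decomp: "X w - \<psi> (V w) = R w + v (V w)" for w
  proof -
    have "(\<Sum>i<m. a i * U i w) = (\<Sum>i<m. a i * (\<Sum>k<n. c i k * V w k))"
      by (intro sum.cong refl) (simp add: Uc V_def)
    then show ?thesis by (simp add: R_def v_def)
  qed
  have i1: "integrable M (\<lambda>w. (R w + v (V w))\<^sup>2)"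
    using False unfolding V_def[symmetric] decomp
    by (intro integrableI_bounded) (auto simp: top.not_eq_extremum)
  (* finiteness of the risk makes v square integrable even though psi is arbitrary *)
  have i2: "integrable M (\<lambda>w. (v (V w))\<^sup>2)"
  proof (rule Bochner_Integration.integrable_bound)
    show "integrable M (\<lambda>w. 2 * (R w + v (V w))\<^sup>2 + 2 * (R w)\<^sup>2)"
      using i1 sq_integrable[OF R] by simp
    have "y\<^sup>2 \<le> 2 * (x + y)\<^sup>2 + 2 * x\<^sup>2" for x y :: real
    proof -
      have "2 * (x + y)\<^sup>2 + 2 * x\<^sup>2 - y\<^sup>2 = (2 * x + y)\<^sup>2"
        by (simp add: power2_eq_square algebra_simps)
      then show ?thesis by (metis diff_ge_0_iff_ge zero_le_power2)
    qed
    then show "AE w in M. norm ((v (V w))\<^sup>2) \<le> norm (2 * (R w + v (V w))\<^sup>2 + 2 * (R w)\<^sup>2)" by auto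
  qed measurable
  have i3: "integrable M (\<lambda>w. R w * v (V w))"
    by (intro product_integrable_of_squares i2 sq_integrable[OF R]) auto
  have cross: "(LINT w|M. R w * v (V w)) = 0"
    unfolding V_def
    by (rule uncorrelated_with_function[OF R N comp[OF R RU] v i3[unfolded V_def]]) auto
  have "(LINT w|M. (R w + v (V w))\<^sup>2) = (LINT w|M. (R w)\<^sup>2 + (2 * (R w * v (V w)) + (v (V w))\<^sup>2))"
    by (simp add: power2_sum algebra_simps)
  also have "\<dots> = (LINT w|M. (R w)\<^sup>2) + (LINT w|M. (v (V w))\<^sup>2)"
    using i2 i3 sq_integrable[OF R] cross by simp
  also have "\<dots> \<ge> (LINT w|M. (R w)\<^sup>2)" by simp
  finally have "(LINT w|M. (X w)\<^sup>2) - (\<Sum>i<m. (a i)\<^sup>2) \<le> (LINT w|M. (R w + v (V w))\<^sup>2)"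
    unfolding RR .
  then have "ennreal ((LINT w|M. (X w)\<^sup>2) - (\<Sum>i<m. (a i)\<^sup>2)) \<le> (\<integral>\<^sup>+w. ennreal ((R w + v (V w))\<^sup>2) \<partial>M)"
    using i1 by (subst nn_integral_eq_integral) (auto intro: ennreal_leI)
  then show ?thesis unfolding a_def[symmetric] V_def[symmetric] decomp .
qed

text \<open>
  The reduction of variance achieved by one normalised functional \<open>U\<close> is the sum of \<open>q\<^sub>j\<close> times
  the squared covariance of \<open>X\<^sub>j\<close> and \<open>U\<close>, at most \<open>\<delta>\<close> by Bessel's inequality for the scaled
  variables. The weights allow large variances to be cut down to a common level \<open>\<delta>\<close>.
\<close>

lemma weighted_estimates_lower_bound:
  fixes N :: "nat \<Rightarrow> 'a \<Rightarrow> real" and X :: "'j \<Rightarrow> 'a \<Rightarrow> real" and q l :: "'j \<Rightarrow> real"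
  assumes J: "finite J" and X: "\<And>j. j \<in> J \<Longrightarrow> X j \<in> G" and N: "\<And>i. i < n \<Longrightarrow> N i \<in> G"
    and orth: "\<And>i j. i \<in> J \<Longrightarrow> j \<in> J \<Longrightarrow> (LINT w|M. X i w * X j w) = (if i = j then l i else 0)"
    and q: "\<And>j. j \<in> J \<Longrightarrow> 0 \<le> q j" "\<And>j. j \<in> J \<Longrightarrow> q j * l j \<le> \<delta>" and \<delta>: "0 < \<delta>"
    and psi: "\<And>j. j \<in> J \<Longrightarrow> \<psi> j \<in> borel_measurable (PiM {..<n} (\<lambda>_. borel))"
  shows "ennreal ((\<Sum>j\<in>J. q j * l j) - real n * \<delta>)
    \<le> (\<integral>\<^sup>+w. ennreal (\<Sum>j\<in>J. q j * (X j w - \<psi> j (\<lambda>i\<in>{..<n}. N i w))\<^sup>2) \<partial>M)"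
proof -
  have Ns: "\<forall>i<n. N i \<in> G" using N by auto
  from gram_schmidt[OF Ns] obtain m U c where m: "m \<le> n" and gs: "\<forall>i<m. U i \<in> G"
      "\<forall>i<m. \<forall>j<m. (LINT w|M. U i w * U j w) = (if i = j then 1 else 0)"
      "\<forall>i<m. U i = (\<lambda>w. \<Sum>k<n. c i k * N k w)"
      "\<forall>Y\<in>G. (\<forall>i<m. (LINT w|M. Y w * U i w) = 0) \<longrightarrow> (\<forall>k<n. (LINT w|M. Y w * N k w) = 0)"
    by (elim exE conjE) (rule that)
  note U = gs(1)[rule_format] and on = gs(2)[rule_format] and Uc = gs(3)[rule_format]
  have comp: "(LINT w|M. Y w * N k w) = 0"
    if "Y \<in> G" "\<And>i. i < m \<Longrightarrow> (LINT w|M. Y w * U i w) = 0" "k < n" for Y k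
    using gs(4) that by blast
  define a where "a j i = (LINT w|M. X j w * U i w)" for j i
  have bessel: "(\<Sum>j\<in>J. q j * (a j i)\<^sup>2) \<le> \<delta>" if i: "i < m" for i
  proof -
    define T where "T = (\<Sum>j\<in>J. q j * (a j i)\<^sup>2)"
    define Y where "Y w = (\<Sum>j\<in>J. (q j * a j i) * X j w)" for w
    have Y: "Y \<in> G" unfolding Y_def[abs_def] using X by (intro sum_mem)
    have YZ: "(LINT w|M. Y w * Z w) = (\<Sum>j\<in>J. q j * a j i * (LINT w|M. X j w * Z w))" if "Z \<in> G" for Z
    proof -
      have "(LINT w|M. Y w * Z w) = (LINT w|M. (\<Sum>j\<in>J. q j * a j i * (X j w * Z w)))"
        unfolding Y_def by (intro Bochner_Integration.integral_cong) (auto simp: sum_distrib_right mult.assoc)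
      also have "\<dots> = (\<Sum>j\<in>J. q j * a j i * (LINT w|M. X j w * Z w))"
        using X that by (subst Bochner_Integration.integral_sum) (auto simp: mult_integrable)
      finally show ?thesis .
    qed
    have YU: "(LINT w|M. Y w * U i w) = T"
      using U[OF i] by (simp add: YZ a_def[symmetric] T_def power2_eq_square mult.assoc)
    have XY: "(LINT w|M. X j w * Y w) = q j * a j i * l j" if "j \<in> J" for j
    proof -
      have "(LINT w|M. X j w * Y w) = (LINT w|M. Y w * X j w)" by (simp add: mult.commute)
      also have "\<dots> = (\<Sum>k\<in>J. q k * a k i * (if k = j then l k else 0))"
        using X[OF that] that by (subst YZ) (auto simp: orth)
      also have "\<dots> = (\<Sum>k\<in>J. if k = j then q k * a k i * l k else 0)"
        by (intro sum.cong) auto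
      also have "\<dots> = q j * a j i * l j" using that J by simp
      finally show ?thesis .
    qed
    have "(LINT w|M. Y w * Y w) = (\<Sum>j\<in>J. q j * a j i * (q j * a j i * l j))"
      by (subst YZ[OF Y]) (simp add: XY)
    also have "\<dots> = (\<Sum>j\<in>J. (q j * l j) * (q j * (a j i)\<^sup>2))"
      by (simp add: power2_eq_square mult_ac)
    also have "\<dots> \<le> (\<Sum>j\<in>J. \<delta> * (q j * (a j i)\<^sup>2))"
      using q by (intro sum_mono mult_right_mono) auto
    also have "\<dots> = \<delta> * T" by (simp add: T_def sum_distrib_left)
    finally have YY: "(LINT w|M. Y w * Y w) \<le> \<delta> * T" .
    (* expanding the square bounds it by \<delta> (\<delta> - T), hence T \<le> \<delta> *)
    have "0 \<le> (LINT w|M. (Y w - \<delta> * U i w)\<^sup>2)" by simp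
    also have "\<dots> = (LINT w|M. Y w * Y w - (2 * \<delta> * (Y w * U i w) - \<delta>\<^sup>2 * (U i w * U i w)))"
      by (intro Bochner_Integration.integral_cong) (auto simp: power2_eq_square algebra_simps)
    also have "\<dots> = (LINT w|M. Y w * Y w) - (2 * \<delta> * T - \<delta>\<^sup>2 * 1)"
      using Y U[OF i] on[OF i i] by (simp add: mult_integrable YU)
    also have "\<dots> \<le> \<delta> * (\<delta> - T)" using YY by (simp add: power2_eq_square algebra_simps)
    finally show ?thesis using \<delta> by (simp add: T_def zero_le_mult_iff)
  qed
  have "(\<Sum>j\<in>J. q j * l j) - real n * \<delta> \<le> (\<Sum>j\<in>J. q j * l j) - (\<Sum>i<m. \<Sum>j\<in>J. q j * (a j i)\<^sup>2)"
  proof -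
    have "(\<Sum>i<m. \<Sum>j\<in>J. q j * (a j i)\<^sup>2) \<le> (\<Sum>i<m. \<delta>)" using bessel by (intro sum_mono) auto
    also have "\<dots> \<le> real n * \<delta>" using m \<delta> by simp
    finally show ?thesis by simp
  qed
  also have "\<dots> = (\<Sum>j\<in>J. q j * (l j - (\<Sum>i<m. (a j i)\<^sup>2)))"
    by (subst sum.swap) (simp add: right_diff_distrib sum_subtractf sum_distrib_left)
  finally have "ennreal ((\<Sum>j\<in>J. q j * l j) - real n * \<delta>) \<le> ennreal (\<Sum>j\<in>J. q j * (l j - (\<Sum>i<m. (a j i)\<^sup>2)))"
    by (rule ennreal_leI)
  also have "\<dots> \<le> (\<Sum>j\<in>J. ennreal (q j) * ennreal (l j - (\<Sum>i<m. (a j i)\<^sup>2)))"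
  proof -
    have "(\<Sum>j\<in>J. q j * (l j - (\<Sum>i<m. (a j i)\<^sup>2))) \<le> (\<Sum>j\<in>J. q j * max 0 (l j - (\<Sum>i<m. (a j i)\<^sup>2)))"
      using q by (intro sum_mono mult_left_mono) auto
    then have "ennreal (\<Sum>j\<in>J. q j * (l j - (\<Sum>i<m. (a j i)\<^sup>2))) \<le> (\<Sum>j\<in>J. ennreal (q j * max 0 (l j - (\<Sum>i<m. (a j i)\<^sup>2))))"
      by (subst sum_ennreal) (use q in simp, rule ennreal_leI)
    also have "\<dots> = (\<Sum>j\<in>J. ennreal (q j) * ennreal (l j - (\<Sum>i<m. (a j i)\<^sup>2)))"
    proof (intro sum.cong refl)
      have m0: "ennreal (max 0 y) = ennreal y" for y
        by (cases "0 \<le> y") (simp_all add: ennreal_neg max_def)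
      fix j assume "j \<in> J"
      then have "ennreal (q j * max 0 y) = ennreal (q j) * ennreal (max 0 y)" for y
        using q(1) by (intro ennreal_mult) simp_all
      then show "ennreal (q j * max 0 (l j - (\<Sum>i<m. (a j i)\<^sup>2))) = ennreal (q j) * ennreal (l j - (\<Sum>i<m. (a j i)\<^sup>2))"
        by (simp only: m0)
    qed
    finally show ?thesis .
  qed
  also have "\<dots> \<le> (\<Sum>j\<in>J. ennreal (q j) * (\<integral>\<^sup>+w. ennreal ((X j w - \<psi> j (\<lambda>i\<in>{..<n}. N i w))\<^sup>2) \<partial>M))"
  proof (intro sum_mono mult_left_mono)
    fix j assume j: "j \<in> J"
    have "(LINT w|M. (X j w)\<^sup>2) = l j" using orth[OF j j] by (simp add: power2_eq_square)
    moreover have "ennreal ((LINT w|M. (X j w)\<^sup>2) - (\<Sum>i<m. (a j i)\<^sup>2)) \<le> (\<integral>\<^sup>+w. ennreal ((X j w - \<psi> j (\<lambda>i\<in>{..<n}. N i w))\<^sup>2) \<partial>M)"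
      unfolding a_def by (rule estimate_lower_bound[OF X[OF j] N U on Uc comp psi[OF j]])
    ultimately show "ennreal (l j - (\<Sum>i<m. (a j i)\<^sup>2)) \<le> (\<integral>\<^sup>+w. ennreal ((X j w - \<psi> j (\<lambda>i\<in>{..<n}. N i w))\<^sup>2) \<partial>M)"
      by (simp only:)
  qed simp
  also have "\<dots> = (\<integral>\<^sup>+w. (\<Sum>j\<in>J. ennreal (q j) * ennreal ((X j w - \<psi> j (\<lambda>i\<in>{..<n}. N i w))\<^sup>2)) \<partial>M)"
  proof -
    have V: "(\<lambda>w. \<lambda>i\<in>{..<n}. N i w) \<in> measurable M (PiM {..<n} (\<lambda>_. borel))"
      by (intro measurable_restrict) (use N meas in auto)
    have m2: "(\<lambda>w. ennreal ((X j w - \<psi> j (\<lambda>i\<in>{..<n}. N i w))\<^sup>2)) \<in> borel_measurable M" if "j \<in> J" for j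
    proof -
      have [measurable]: "(\<lambda>w. \<psi> j (\<lambda>i\<in>{..<n}. N i w)) \<in> borel_measurable M" "X j \<in> borel_measurable M"
        using measurable_compose[OF V psi[OF that]] meas[OF X[OF that]] by auto
      show ?thesis by measurable
    qed
    have "(\<integral>\<^sup>+w. (\<Sum>j\<in>J. ennreal (q j) * ennreal ((X j w - \<psi> j (\<lambda>i\<in>{..<n}. N i w))\<^sup>2)) \<partial>M) =
      (\<Sum>j\<in>J. (\<integral>\<^sup>+w. ennreal (q j) * ennreal ((X j w - \<psi> j (\<lambda>i\<in>{..<n}. N i w))\<^sup>2) \<partial>M))"
      by (rule nn_integral_sum) (intro borel_measurable_times_ennreal m2 borel_measurable_const)
    also have "\<dots> = (\<Sum>j\<in>J. ennreal (q j) * (\<integral>\<^sup>+w. ennreal ((X j w - \<psi> j (\<lambda>i\<in>{..<n}. N i w))\<^sup>2) \<partial>M))"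
      by (intro sum.cong refl nn_integral_cmult m2)
    finally show ?thesis by (rule sym)
  qed
  also have "\<dots> = (\<integral>\<^sup>+w. ennreal (\<Sum>j\<in>J. q j * (X j w - \<psi> j (\<lambda>i\<in>{..<n}. N i w))\<^sup>2) \<partial>M)"
  proof (intro nn_integral_cong)
    fix w
    have "ennreal (\<Sum>j\<in>J. q j * (X j w - \<psi> j (\<lambda>i\<in>{..<n}. N i w))\<^sup>2) = (\<Sum>j\<in>J. ennreal (q j * (X j w - \<psi> j (\<lambda>i\<in>{..<n}. N i w))\<^sup>2))"
      using q(1) by (intro sum_ennreal[symmetric]) simp
    also have "\<dots> = (\<Sum>j\<in>J. ennreal (q j) * ennreal ((X j w - \<psi> j (\<lambda>i\<in>{..<n}. N i w))\<^sup>2))"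
      using q(1) by (intro sum.cong refl ennreal_mult) auto
    finally show "(\<Sum>j\<in>J. ennreal (q j) * ennreal ((X j w - \<psi> j (\<lambda>i\<in>{..<n}. N i w))\<^sup>2)) =
      ennreal (\<Sum>j\<in>J. q j * (X j w - \<psi> j (\<lambda>i\<in>{..<n}. N i w))\<^sup>2)" by (rule sym)
  qed
  finally show ?thesis .
qed

end

section \<open>The Hartley system on the torus\<close>

abbreviation lattice :: "nat \<Rightarrow> (nat \<Rightarrow> int) set" where
  "lattice d \<equiv> {..<d} \<rightarrow>\<^sub>E (UNIV :: int set)"

definition phase :: "nat \<Rightarrow> (nat \<Rightarrow> int) \<Rightarrow> (nat \<Rightarrow> real) \<Rightarrow> real" where
  "phase d k x = (\<Sum>j<d. real_of_int (k j) * x j)"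

text \<open>
  The kernel of the Hartley transform. Indexed by all of \<open>\<int>\<^sup>d\<close>, these functions form a real
  orthonormal system, with no case distinction between sines and cosines and no choice of one of
  \<open>k\<close> and \<open>- k\<close>.
\<close>

definition hartley :: "nat \<Rightarrow> (nat \<Rightarrow> int) \<Rightarrow> (nat \<Rightarrow> real) \<Rightarrow> real" where
  "hartley d k x = cos (phase d k x) + sin (phase d k x)"

lemma hartley_bound: "\<bar>hartley d k x\<bar> \<le> 2"
  unfolding hartley_def using abs_cos_le_one[of "phase d k x"] abs_sin_le_one[of "phase d k x"] by linarith

abbreviation unif :: "real measure" where
  "unif \<equiv> uniform_measure lborel {0..2 * pi}"

lemma prob_space_unif: "prob_space unif"
  by (rule prob_space_uniform_measure) auto

lemma prob_space_torus_measure: "prob_space (torus_measure d)"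
  unfolding torus_measure_def by (intro prob_space_PiM prob_space_unif)

lemma sets_torus_measure: "sets (torus_measure d) = sets (PiM {..<d} (\<lambda>_. borel))"
  unfolding torus_measure_def by (intro sets_PiM_cong) auto

lemma space_torus_measure: "space (torus_measure d) = {..<d} \<rightarrow>\<^sub>E UNIV"
  unfolding torus_measure_def by (simp add: space_PiM)

lemma measurable_torus_component[measurable]:
  "j < d \<Longrightarrow> (\<lambda>x. x j) \<in> borel_measurable (torus_measure d)"
  using measurable_component_singleton[of j "{..<d}" "\<lambda>_. borel"]
  by (simp add: measurable_cong_sets[OF sets_torus_measure refl])

lemma measurable_phase[measurable]: "phase d k \<in> borel_measurable (torus_measure d)"
  unfolding phase_def[abs_def] by (intro borel_measurable_sum borel_measurable_times) auto

lemma measurable_hartley[measurable]: "hartley d k \<in> borel_measurable (torus_measure d)"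
  unfolding hartley_def[abs_def] by measurable

lemma AE_torus: "AE x in torus_measure d. x \<in> torus d"
proof -
  have "AE x in torus_measure d. \<forall>j\<in>{..<d}. x j \<in> {0..2 * pi}"
  proof (rule AE_finite_allI)
    fix j assume "j \<in> {..<d}"
    then show "AE x in torus_measure d. x j \<in> {0..2 * pi}"
      unfolding torus_measure_def
      by (intro AE_PiM_component prob_space_unif AE_uniform_measureI) auto
  qed simp
  then show ?thesis using AE_space
    by eventually_elim (auto simp: torus_def space_torus_measure PiE_iff)
qed

lemma unif_iexp_integral:
  fixes m :: int
  shows "(CLINT x|unif. iexp (real_of_int m * x)) = (if m = 0 then 1 else 0)"
proof (cases "m = 0")
  case True
  interpret prob_space unif by (rule prob_space_unif)
  show ?thesis using True prob_space by simp
next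
  case False
  have "(CLINT x|unif. iexp (real_of_int m * x)) =
     (CLINT x|lborel. (indicator {0..2 * pi} x / (2 * pi)) *\<^sub>R iexp (real_of_int m * x))"
  proof -
    have "unif = density lborel (\<lambda>x. ennreal (indicator {0..2 * pi} x / (2 * pi)))"
      unfolding uniform_measure_def
      by (intro density_cong) (auto simp: divide_ennreal indicator_def simp flip: ennreal_1)
    then show ?thesis by (simp only:) (rule integral_density; auto)
  qed
  also have "\<dots> = (CLINT x|lborel. (1 / (2 * pi)) *\<^sub>R (indicator {0..2 * pi} x *\<^sub>R iexp (real_of_int m * x)))"
    by (intro Bochner_Integration.integral_cong) auto
  also have "\<dots> = (1 / (2 * pi)) *\<^sub>R (CLINT x|lborel. indicator {0..2 * pi} x *\<^sub>R iexp (real_of_int m * x))"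
    by (rule integral_scaleR_right)
  also have "(CLINT x|lborel. indicator {0..2 * pi} x *\<^sub>R iexp (real_of_int m * x)) =
     iexp (real_of_int m * (2 * pi)) / (\<i> * m) - iexp (real_of_int m * 0) / (\<i> * m)"
  proof (rule integral_FTC_atLeastAtMost)
    show "((\<lambda>x. iexp (real_of_int m * x) / (\<i> * m)) has_vector_derivative iexp (real_of_int m * x)) (at x within {0..2 * pi})" for x
    proof -
      have "((\<lambda>z. exp (\<i> * m * z) / (\<i> * m)) has_field_derivative exp (\<i> * m * complex_of_real x)) (at (complex_of_real x))"
        using False by (auto intro!: derivative_eq_intros)
      from has_vector_derivative_real_field[OF this] show ?thesis by (simp add: mult.assoc)
    qed
  qed (auto intro!: continuous_intros)
  also have "\<dots> = 0"
  proof -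
    have "iexp (real_of_int m * (2 * pi)) = 1"
      using exp_integer_2pi[of "of_int m"] by (simp add: mult_ac)
    then show ?thesis by simp
  qed
  finally show ?thesis using False by simp
qed

lemma torus_iexp_integral:
  fixes m :: "nat \<Rightarrow> int"
  shows "(CLINT x|torus_measure d. iexp (phase d m x)) = (if \<forall>j<d. m j = 0 then 1 else 0)"
proof -
  interpret u: prob_space unif by (rule prob_space_unif)
  interpret product_sigma_finite "\<lambda>_. unif" by unfold_locales
  have "(CLINT x|torus_measure d. iexp (phase d m x)) = (CLINT x|PiM {..<d} (\<lambda>_. unif). \<Prod>j<d. iexp (real_of_int (m j) * x j))"
    unfolding torus_measure_def phase_def
    by (intro Bochner_Integration.integral_cong) (auto simp: exp_sum sum_distrib_left)
  also have "\<dots> = (\<Prod>j<d. CLINT x|unif. iexp (real_of_int (m j) * x))"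
  proof (rule product_integral_prod)
    fix j
    show "integrable unif (\<lambda>x. iexp (real_of_int (m j) * x))"
    proof (rule u.integrable_iexp)
      have eq: "borel_measurable unif = (borel_measurable borel :: (real \<Rightarrow> complex) set)"
        by (rule measurable_cong_sets) auto
      show "(\<lambda>x. complex_of_real (real_of_int (m j) * x)) \<in> borel_measurable unif"
        unfolding eq by measurable
    qed simp
  qed simp
  also have "\<dots> = (if \<forall>j<d. m j = 0 then 1 else 0)"
    unfolding unif_iexp_integral by (auto simp: prod_zero_iff)
  finally show ?thesis .
qed

lemma torus_cos_sin_integral:
  "(LINT x|torus_measure d. cos (phase d m x)) = (if \<forall>j<d. m j = 0 then 1 else 0)"
  "(LINT x|torus_measure d. sin (phase d m x)) = 0"
proof -
  interpret prob_space "torus_measure d" by (rule prob_space_torus_measure)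
  have i: "integrable (torus_measure d) (\<lambda>x. iexp (phase d m x))" by (intro integrable_iexp) auto
  have "(LINT x|torus_measure d. cos (phase d m x)) = Re (CLINT x|torus_measure d. iexp (phase d m x))"
    by (subst integral_Re[symmetric, OF i]) (simp add: Re_exp)
  then show "(LINT x|torus_measure d. cos (phase d m x)) = (if \<forall>j<d. m j = 0 then 1 else 0)"
    by (simp add: torus_iexp_integral)
  have "(LINT x|torus_measure d. sin (phase d m x)) = Im (CLINT x|torus_measure d. iexp (phase d m x))"
    by (subst integral_Im[symmetric, OF i]) (simp add: Im_exp)
  then show "(LINT x|torus_measure d. sin (phase d m x)) = 0"
    by (simp add: torus_iexp_integral)
qed

text \<open>
  The mixed products add up to a sine of the sum of the phases, whose mean over the torus vanishes;
  this is why the system is orthonormal.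
\<close>

lemma hartley_mult: "hartley d k x * hartley d l x = cos (phase d (\<lambda>j. k j - l j) x) + sin (phase d (\<lambda>j. k j + l j) x)"
proof -
  have "phase d (\<lambda>j. k j - l j) x = phase d k x - phase d l x" "phase d (\<lambda>j. k j + l j) x = phase d k x + phase d l x"
    unfolding phase_def by (simp_all add: sum_subtractf sum.distrib algebra_simps)
  then show ?thesis unfolding hartley_def by (simp only: cos_diff sin_add) (simp add: algebra_simps)
qed

lemma hartley_orthonormal:
  assumes "k \<in> lattice d" "l \<in> lattice d"
  shows "(LINT x|torus_measure d. hartley d k x * hartley d l x) = (if k = l then 1 else 0)"
proof -
  interpret prob_space "torus_measure d" by (rule prob_space_torus_measure)
  have "(\<forall>j<d. k j - l j = 0) \<longleftrightarrow> k = l"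
    using assms by (auto intro: PiE_ext)
  moreover have "(LINT x|torus_measure d. hartley d k x * hartley d l x) =
    (LINT x|torus_measure d. cos (phase d (\<lambda>j. k j - l j) x)) + (LINT x|torus_measure d. sin (phase d (\<lambda>j. k j + l j) x))"
    unfolding hartley_mult
    by (intro Bochner_Integration.integral_add integrable_const_bound[of _ 1]) auto
  ultimately show ?thesis by (simp add: torus_cos_sin_integral)
qed

lemma eval_diff_le: "\<bar>apply_bcontfun f x - apply_bcontfun g x\<bar> \<le> dist f g"
  for f g :: cfun
  using dist_bounded[of f x g] by (simp add: dist_real_def)

lemma eval_bound: "\<bar>apply_bcontfun f x\<bar> \<le> norm f"
  for f :: cfun
  using norm_bounded[of f x] by simp

lemma tendsto_coordinatewise_fun:
  fixes f :: "nat \<Rightarrow> nat \<Rightarrow> real"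
  assumes "\<And>j. (\<lambda>n. f n j) \<longlonglongrightarrow> l j"
  shows "f \<longlonglongrightarrow> l"
proof -
  have "limitin (product_topology (\<lambda>_. euclidean) UNIV) f l sequentially"
    unfolding limitin_componentwise using assms by simp
  then show ?thesis by (simp add: euclidean_product_topology)
qed

text \<open>
  Points with coordinates in \<open>(1 / (n + 1)) \<int>\<close>. The value \<open>undefined\<close> beyond \<open>d\<close> matches the
  extensional functions that make up the product space.
\<close>

definition grid :: "nat \<Rightarrow> nat \<Rightarrow> (nat \<Rightarrow> int) \<Rightarrow> nat \<Rightarrow> real" where
  "grid d n z = (\<lambda>j. if j < d then real_of_int (z j) / real (Suc n) else undefined)"

lemma grid_tendsto:
  assumes "x \<in> space (torus_measure d)"
  shows "(\<lambda>n. grid d n (\<lambda>j\<in>{..<d}. \<lfloor>x j * real (Suc n)\<rfloor>)) \<longlonglongrightarrow> x"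
proof (rule tendsto_coordinatewise_fun)
  fix j
  show "(\<lambda>n. grid d n (\<lambda>j\<in>{..<d}. \<lfloor>x j * real (Suc n)\<rfloor>) j) \<longlonglongrightarrow> x j"
  proof (cases "j < d")
    case False
    then have "x j = undefined" using assms by (auto simp: space_torus_measure PiE_def extensional_def)
    then show ?thesis using False by (simp add: grid_def)
  next
    case True
    have b: "x j - 1 / real (Suc n) \<le> of_int \<lfloor>x j * real (Suc n)\<rfloor> / real (Suc n)"
      "of_int \<lfloor>x j * real (Suc n)\<rfloor> / real (Suc n) \<le> x j" for n
    proof -
      have "x j * real (Suc n) - 1 \<le> of_int \<lfloor>x j * real (Suc n)\<rfloor>" by linarith
      then have "(x j * real (Suc n) - 1) / real (Suc n) \<le> of_int \<lfloor>x j * real (Suc n)\<rfloor> / real (Suc n)"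
        by (rule divide_right_mono) simp
      then show "x j - 1 / real (Suc n) \<le> of_int \<lfloor>x j * real (Suc n)\<rfloor> / real (Suc n)"
        by (simp add: diff_divide_distrib)
      have "of_int \<lfloor>x j * real (Suc n)\<rfloor> \<le> x j * real (Suc n)" by linarith
      then show "of_int \<lfloor>x j * real (Suc n)\<rfloor> / real (Suc n) \<le> x j"
        by (simp add: pos_divide_le_eq)
    qed
    have lim: "(\<lambda>n. x j - 1 / real (Suc n)) \<longlonglongrightarrow> x j - 0"
      by (rule tendsto_diff[OF tendsto_const LIMSEQ_Suc[OF lim_1_over_n]])
    have "(\<lambda>n. real_of_int \<lfloor>x j * real (Suc n)\<rfloor> / real (Suc n)) \<longlonglongrightarrow> x j"
    proof (rule tendsto_sandwich)
      show "\<forall>\<^sub>F n in sequentially. x j - 1 / real (Suc n) \<le> real_of_int \<lfloor>x j * real (Suc n)\<rfloor> / real (Suc n)"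
        by (rule always_eventually[OF allI]) (rule b(1))
      show "\<forall>\<^sub>F n in sequentially. real_of_int \<lfloor>x j * real (Suc n)\<rfloor> / real (Suc n) \<le> x j"
        by (rule always_eventually[OF allI]) (rule b(2))
      show "(\<lambda>n. x j - 1 / real (Suc n)) \<longlonglongrightarrow> x j" using lim by (simp only: diff_zero)
      show "(\<lambda>n. x j) \<longlonglongrightarrow> x j" by (rule tendsto_const)
    qed
    then show ?thesis using True by (simp add: grid_def)
  qed
qed

lemma measurable_eval_point:
  fixes M :: "cfun measure"
  assumes "sets M = sets (restrict_space borel (C_torus d))"
  shows "(\<lambda>f. apply_bcontfun f x) \<in> borel_measurable M"
proof -
  have "continuous_on UNIV (\<lambda>f::cfun. apply_bcontfun f x)"
  proof (unfold continuous_on_iff, intro ballI allI impI)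
    fix f :: cfun and e :: real assume "0 < e"
    then show "\<exists>d>0. \<forall>g\<in>UNIV. dist g f < d \<longrightarrow> dist (apply_bcontfun g x) (apply_bcontfun f x) < e"
      using dist_bounded by (metis le_less_trans)
  qed
  then have "(\<lambda>f::cfun. apply_bcontfun f x) \<in> borel_measurable borel"
    by (rule borel_measurable_continuous_onI)
  then have "(\<lambda>f::cfun. apply_bcontfun f x) \<in> borel_measurable (restrict_space borel (C_torus d))"
    by (rule measurable_restrict_space1)
  then show ?thesis by (simp add: measurable_cong_sets[OF assms refl])
qed

text \<open>
  The ambient space of bounded continuous functions is not second countable, so joint measurability
  is not an immediate consequence of joint continuity. Rounding \<open>x\<close> to a
  countable grid makes the evaluation a countable gluing of measurable functions of \<open>f\<close>, and these
  converge by continuity of \<open>f\<close>.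
\<close>

lemma measurable_eval_pair:
  fixes M :: "cfun measure"
  assumes M: "sets M = sets (restrict_space borel (C_torus d))"
  shows "(\<lambda>z. apply_bcontfun (fst z) (snd z)) \<in> borel_measurable (M \<Otimes>\<^sub>M torus_measure d)"
proof (rule borel_measurable_LIMSEQ_real)
  fix z assume "z \<in> space (M \<Otimes>\<^sub>M torus_measure d)"
  then have "snd z \<in> space (torus_measure d)" by (auto simp: space_pair_measure)
  from continuous_on_tendsto_compose[OF continuous_on_apply_bcontfun[of UNIV "fst z"] grid_tendsto[OF this]]
  show "(\<lambda>n. apply_bcontfun (fst z) (grid d n (\<lambda>j\<in>{..<d}. \<lfloor>snd z j * real (Suc n)\<rfloor>))) \<longlonglongrightarrow> apply_bcontfun (fst z) (snd z)"
    by simp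
next
  fix n
  have c: "countable (lattice d)" by (intro countable_PiE) auto
  have "PiM {..<d} (\<lambda>_. count_space (UNIV :: int set)) = count_space (lattice d)"
    by (rule count_space_PiM_finite) auto
  moreover have "(\<lambda>x. \<lambda>j\<in>{..<d}. \<lfloor>x j * real (Suc n)\<rfloor>) \<in> measurable (torus_measure d) (PiM {..<d} (\<lambda>_. count_space UNIV))"
  proof (rule measurable_restrict)
    fix j assume "j \<in> {..<d}"
    then have [measurable]: "(\<lambda>x. x j) \<in> borel_measurable (torus_measure d)" by auto
    show "(\<lambda>x. \<lfloor>x j * real (Suc n)\<rfloor>) \<in> measurable (torus_measure d) (count_space UNIV)" by measurable
  qed
  ultimately have "(\<lambda>x. \<lambda>j\<in>{..<d}. \<lfloor>x j * real (Suc n)\<rfloor>) \<in> measurable (torus_measure d) (count_space (lattice d))"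
    by simp
  then have g: "(\<lambda>z. \<lambda>j\<in>{..<d}. \<lfloor>snd z j * real (Suc n)\<rfloor>) \<in> measurable (M \<Otimes>\<^sub>M torus_measure d) (count_space (lattice d))"
    by (rule measurable_compose[OF measurable_snd])
  show "(\<lambda>z. apply_bcontfun (fst z) (grid d n (\<lambda>j\<in>{..<d}. \<lfloor>snd z j * real (Suc n)\<rfloor>))) \<in> borel_measurable (M \<Otimes>\<^sub>M torus_measure d)"
    by (rule measurable_compose_countable'[where f="\<lambda>i z. apply_bcontfun (fst z) (grid d n i)" and I="lattice d"])
       (intro measurable_compose[OF measurable_fst measurable_eval_point[OF M]] g c)+
qed

section \<open>Functionals on continuous functions and coefficients in \<open>L\<^sub>2\<close>\<close>

lemma dual_add:
  assumes "L \<in> C_torus_dual d" "L' \<in> C_torus_dual d"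
  shows "(\<lambda>f. L f + L' f) \<in> C_torus_dual d"
  using assms unfolding C_torus_dual_def by (auto simp: algebra_simps intro!: continuous_intros)

lemma dual_scale: "L \<in> C_torus_dual d \<Longrightarrow> (\<lambda>f. c * L f) \<in> C_torus_dual d"
  unfolding C_torus_dual_def by (auto simp: algebra_simps intro!: continuous_intros)

lemma dual_zero: "(\<lambda>f. 0) \<in> C_torus_dual d"
  unfolding C_torus_dual_def by auto

lemma dual_eval: "(\<lambda>f. apply_bcontfun f x) \<in> C_torus_dual d"
proof -
  have "continuous_on (C_torus d) (\<lambda>f. apply_bcontfun f x)"
    unfolding continuous_on_iff by (metis dist_bounded le_less_trans)
  then show ?thesis
    unfolding C_torus_dual_def by (simp add: plus_bcontfun.rep_eq scaleR_bcontfun.rep_eq)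
qed

lemma measurable_apply[measurable]: "apply_bcontfun f \<in> borel_measurable (torus_measure d)" for f :: cfun
proof -
  have "(\<lambda>x. x) \<in> measurable (torus_measure d) (PiM UNIV (\<lambda>_. borel))"
  proof (rule measurable_PiM_single')
    fix i :: nat
    show "(\<lambda>x. x i) \<in> borel_measurable (torus_measure d)"
    proof (cases "i < d")
      case False
      then have "x i = undefined" if "x \<in> space (torus_measure d)" for x
        using that by (auto simp: space_torus_measure PiE_def extensional_def)
      then show ?thesis by (subst measurable_cong[where g="\<lambda>_. undefined"]) auto
    qed simp
  qed simp
  then have "(\<lambda>x. x) \<in> measurable (torus_measure d) borel"
    by (simp add: measurable_cong_sets[OF refl sets_PiM_equal_borel])
  then show ?thesis
    by (rule measurable_compose[OF _ borel_measurable_continuous_onI[OF continuous_on_apply_bcontfun]])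
qed

lemma integrable_apply_times:
  fixes f :: cfun
  assumes [measurable]: "h \<in> borel_measurable (torus_measure d)" and h: "\<And>x. \<bar>h x\<bar> \<le> B"
  shows "integrable (torus_measure d) (\<lambda>x. apply_bcontfun f x * h x)"
proof -
  interpret prob_space "torus_measure d" by (rule prob_space_torus_measure)
  show ?thesis
    by (rule integrable_const_bound[of _ "norm f * B"])
       (auto simp: abs_mult intro!: mult_mono eval_bound h)
qed

lemma dual_integral:
  assumes [measurable]: "h \<in> borel_measurable (torus_measure d)" and h: "\<And>x. \<bar>h x\<bar> \<le> B" and B: "0 < B"
  shows "(\<lambda>f. LINT x|torus_measure d. apply_bcontfun f x * h x) \<in> C_torus_dual d"
proof -
  interpret prob_space "torus_measure d" by (rule prob_space_torus_measure)
  note i = integrable_apply_times[OF assms(1,2)]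
  have "\<bar>(LINT x|torus_measure d. apply_bcontfun f x * h x) - (LINT x|torus_measure d. apply_bcontfun g x * h x)\<bar> \<le> dist f g * B"
    for f g :: cfun
  proof -
    have "(LINT x|torus_measure d. apply_bcontfun f x * h x) - (LINT x|torus_measure d. apply_bcontfun g x * h x)
      = (LINT x|torus_measure d. (apply_bcontfun f x - apply_bcontfun g x) * h x)"
      using i by (simp add: left_diff_distrib)
    also have "\<bar>\<dots>\<bar> \<le> (LINT x|torus_measure d. dist f g * B)"
    proof (rule integral_abs_bound[THEN order_trans], rule integral_mono)
      show "integrable (torus_measure d) (\<lambda>x. \<bar>(apply_bcontfun f x - apply_bcontfun g x) * h x\<bar>)"
        using i by (simp add: left_diff_distrib)
      show "\<bar>(apply_bcontfun f x - apply_bcontfun g x) * h x\<bar> \<le> dist f g * B" for x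
        unfolding abs_mult by (intro mult_mono eval_diff_le h) auto
    qed simp
    finally show ?thesis using prob_space by simp
  qed
  then have lip: "dist (LINT x|torus_measure d. apply_bcontfun f x * h x) (LINT x|torus_measure d. apply_bcontfun g x * h x) \<le> dist f g * B"
    for f g :: cfun by (simp add: dist_real_def)
  have "continuous_on (C_torus d) (\<lambda>f. LINT x|torus_measure d. apply_bcontfun f x * h x)"
    unfolding continuous_on_iff
  proof (intro ballI allI impI)
    fix f :: cfun and e :: real assume "0 < e"
    then show "\<exists>\<delta>>0. \<forall>g\<in>C_torus d. dist g f < \<delta> \<longrightarrow>
        dist (LINT x|torus_measure d. apply_bcontfun g x * h x) (LINT x|torus_measure d. apply_bcontfun f x * h x) < e"
      using B by (intro exI[of _ "e / B"]) (auto intro: le_less_trans[OF lip] simp: pos_less_divide_eq)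
  qed
  then show ?thesis
    using i unfolding C_torus_dual_def
    by (auto simp: plus_bcontfun.rep_eq scaleR_bcontfun.rep_eq ring_distribs mult.assoc)
qed

definition coef :: "nat \<Rightarrow> (nat \<Rightarrow> int) \<Rightarrow> cfun \<Rightarrow> real" where
  "coef d k f = (LINT x|torus_measure d. apply_bcontfun f x * hartley d k x)"

lemma dual_coef: "coef d k \<in> C_torus_dual d"
  unfolding coef_def[abs_def] by (rule dual_integral[of _ _ 2]) (auto intro: hartley_bound)

text \<open>
  The one-dimensional marginals give the hypotheses of \<^locale>\<open>gaussian_space\<close>; a degenerate marginal
  is concentrated at its mean, which is zero.
\<close>

lemma gaussian_functional:
  assumes g: "gaussian_measure d M" and z: "zero_mean d M" and L: "L \<in> C_torus_dual d"
  shows "L \<in> borel_measurable M" (is ?A) "integrable M (\<lambda>f. (L f)\<^sup>2)" (is ?B)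
    "(CLINT f|M. iexp (L f)) = complex_of_real (exp (- (LINT f|M. (L f)\<^sup>2) / 2))" (is ?C)
proof -
  interpret prob_space M using g by (simp add: gaussian_measure_def)
  have sets: "sets M = sets (restrict_space borel (C_torus d))" using g by (simp add: gaussian_measure_def)
  have "L \<in> borel_measurable (restrict_space borel (C_torus d))"
    using L by (intro borel_measurable_continuous_on_restrict) (simp add: C_torus_dual_def)
  then show A[measurable]: ?A by (simp add: measurable_cong_sets[OF sets refl])
  have mean: "(LINT f|M. L f) = 0" using z L by (simp add: zero_mean_def)
  obtain m s where s: "0 \<le> s" and D: "distr M borel L = (if s = 0 then return borel m else density lborel (\<lambda>t. ennreal (normal_density m s t)))"
    using g L unfolding gaussian_measure_def by blast
  have "?B \<and> ?C"
  proof (cases "s = 0")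
    case True
    have int: "(LINT f|M. h (L f)) = h m" if [measurable]: "h \<in> borel_measurable borel" for h :: "real \<Rightarrow> real"
      using integral_distr[of L M borel h] D True by (simp add: integral_return)
    have "m = 0" using int[of "\<lambda>x. x"] mean by simp
    have "AE f in M. L f = 0"
    proof -
      have "distr M borel L = return borel 0" using D True \<open>m = 0\<close> by simp
      moreover have "AE t in return borel (0::real). t = 0" by (subst AE_return) auto
      ultimately have "AE t in distr M borel L. t = 0" by (simp only:)
      then show ?thesis by (simp add: AE_distr_iff)
    qed
    then have z2: "AE f in M. (L f)\<^sup>2 = 0" and z3: "AE f in M. iexp (L f) = 1" by auto
    have "integrable M (\<lambda>f. (L f)\<^sup>2)"
      using integrable_cong_AE[of "\<lambda>f. (L f)\<^sup>2" M "\<lambda>_. 0"] z2 by simp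
    moreover have "(LINT f|M. (L f)\<^sup>2) = 0" using z2 by (intro integral_eq_zero_AE)
    moreover have "(CLINT f|M. iexp (L f)) = (CLINT f|M. 1)" using z3 by (intro integral_cong_AE) auto
    ultimately show ?thesis using prob_space by simp
  next
    case False
    then have s: "0 < s" using s by simp
    have dist: "distributed M lborel L (normal_density m s)"
      unfolding distributed_def using False D by (auto simp: distr_cong[of M M lborel borel L L])
    have m: "m = 0" using normal_distributed_expectation[OF s dist] mean by simp
    have B: ?B using distributed_integrable[OF dist, of "\<lambda>x. x\<^sup>2"] integrable_normal_moment[OF s, of 0 2] m by simp
    have V: "(LINT f|M. (L f)\<^sup>2) = s\<^sup>2"
      using normal_distributed_variance[OF s dist] mean by simp
    have "distributed M lborel (\<lambda>f. (L f - m) / s) std_normal_density"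
      using normal_standard_normal_convert[OF s, of L m] dist by simp
    then have std: "distr M borel (\<lambda>f. L f / s) = std_normal_distribution"
      unfolding distributed_def using m by (auto simp: distr_cong[of M M lborel borel])
    have "complex_of_real (exp (- (s\<^sup>2) / 2)) = char std_normal_distribution s"
      by (simp add: char_std_normal_distribution)
    also have "\<dots> = (CLINT f|M. iexp (s * (L f / s)))"
      unfolding std[symmetric] char_def by (subst integral_distr) auto
    also have "\<dots> = (CLINT f|M. iexp (L f))" using s by simp
    finally have ?C by (simp add: V)
    with B show ?thesis by blast
  qed
  then show ?B ?C by auto
qed

lemma integrable_square_times_bounded:
  assumes [measurable]: "g \<in> borel_measurable (torus_measure d)" and "integrable (torus_measure d) (\<lambda>x. (g x)\<^sup>2)"
  shows "integrable (torus_measure d) (\<lambda>x. g x * hartley d k x)"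
proof -
  interpret prob_space "torus_measure d" by (rule prob_space_torus_measure)
  show ?thesis
  proof (rule Bochner_Integration.integrable_bound)
    show "integrable (torus_measure d) (\<lambda>x. 2 * (1 + (g x)\<^sup>2))" using assms by auto
    have "\<bar>a\<bar> \<le> 1 + a\<^sup>2" for a :: real
    proof -
      have "0 \<le> (1 - \<bar>a\<bar>)\<^sup>2 + \<bar>a\<bar>" by simp
      then show ?thesis by (simp add: power2_diff)
    qed
    then have "\<bar>g x\<bar> * \<bar>hartley d k x\<bar> \<le> (1 + (g x)\<^sup>2) * 2" for x
      by (intro mult_mono hartley_bound) auto
    then show "AE x in torus_measure d. norm (g x * hartley d k x) \<le> norm (2 * (1 + (g x)\<^sup>2))"
      by (intro AE_I2) (simp add: abs_mult mult.commute)
  qed measurable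
qed

lemma integrable_hartley_mult: "integrable (torus_measure d) (\<lambda>x. hartley d k x * hartley d l x)"
proof -
  interpret prob_space "torus_measure d" by (rule prob_space_torus_measure)
  have "norm (hartley d k x * hartley d l x) \<le> 2 * 2" for x
    unfolding real_norm_def abs_mult by (intro mult_mono hartley_bound) auto
  then show ?thesis by (intro integrable_const_bound[of _ "2 * 2"]) auto
qed

lemma hartley_residual:
  fixes g :: "(nat \<Rightarrow> real) \<Rightarrow> real"
  assumes [measurable]: "g \<in> borel_measurable (torus_measure d)" and g2: "integrable (torus_measure d) (\<lambda>x. (g x)\<^sup>2)"
    and S: "finite S" "S \<subseteq> lattice d"
  defines "c \<equiv> \<lambda>k. LINT x|torus_measure d. g x * hartley d k x"
  shows "(LINT x|torus_measure d. (g x - (\<Sum>k\<in>S. c k * hartley d k x))\<^sup>2) =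
     (LINT x|torus_measure d. (g x)\<^sup>2) - (\<Sum>k\<in>S. (c k)\<^sup>2)"
proof -
  note gi = integrable_square_times_bounded[OF assms(1) g2]
  note hi = integrable_hartley_mult[of d]
  have "(LINT x|torus_measure d. (g x - (\<Sum>k\<in>S. c k * hartley d k x))\<^sup>2) =
    (LINT x|torus_measure d. (g x)\<^sup>2 - ((\<Sum>k\<in>S. 2 * c k * (g x * hartley d k x)) -
       (\<Sum>k\<in>S. \<Sum>l\<in>S. c k * c l * (hartley d k x * hartley d l x))))"
  proof (intro Bochner_Integration.integral_cong refl)
    fix x
    define s where "s = (\<Sum>k\<in>S. c k * hartley d k x)"
    have ss: "(\<Sum>k\<in>S. \<Sum>l\<in>S. c k * c l * (hartley d k x * hartley d l x)) = s * s"
      unfolding s_def sum_product by (intro sum.cong refl) (simp add: mult_ac)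
    have gs: "(\<Sum>k\<in>S. 2 * c k * (g x * hartley d k x)) = 2 * g x * s"
      unfolding s_def sum_distrib_left by (intro sum.cong refl) (simp add: mult_ac)
    show "(g x - (\<Sum>k\<in>S. c k * hartley d k x))\<^sup>2 = (g x)\<^sup>2 - ((\<Sum>k\<in>S. 2 * c k * (g x * hartley d k x)) -
       (\<Sum>k\<in>S. \<Sum>l\<in>S. c k * c l * (hartley d k x * hartley d l x)))"
      unfolding ss gs s_def[symmetric] by (simp add: power2_eq_square algebra_simps)
  qed
  also have "\<dots> = (LINT x|torus_measure d. (g x)\<^sup>2) - (LINT x|torus_measure d. (\<Sum>k\<in>S. 2 * c k * (g x * hartley d k x)) -
       (\<Sum>k\<in>S. \<Sum>l\<in>S. c k * c l * (hartley d k x * hartley d l x)))"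
    using g2 gi hi by (intro Bochner_Integration.integral_diff Bochner_Integration.integrable_diff Bochner_Integration.integrable_sum) auto
  also have "(LINT x|torus_measure d. (\<Sum>k\<in>S. 2 * c k * (g x * hartley d k x)) -
       (\<Sum>k\<in>S. \<Sum>l\<in>S. c k * c l * (hartley d k x * hartley d l x))) =
     (LINT x|torus_measure d. (\<Sum>k\<in>S. 2 * c k * (g x * hartley d k x))) -
     (LINT x|torus_measure d. (\<Sum>k\<in>S. \<Sum>l\<in>S. c k * c l * (hartley d k x * hartley d l x)))"
    using gi hi by (intro Bochner_Integration.integral_diff Bochner_Integration.integrable_sum) auto
  also have "(LINT x|torus_measure d. (\<Sum>k\<in>S. 2 * c k * (g x * hartley d k x))) = (\<Sum>k\<in>S. 2 * (c k)\<^sup>2)"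
    using gi by (subst Bochner_Integration.integral_sum) (auto simp: c_def power2_eq_square mult.assoc)
  also have "(LINT x|torus_measure d. (\<Sum>k\<in>S. \<Sum>l\<in>S. c k * c l * (hartley d k x * hartley d l x))) =
      (\<Sum>k\<in>S. \<Sum>l\<in>S. c k * c l * (LINT x|torus_measure d. hartley d k x * hartley d l x))"
    using hi by (subst Bochner_Integration.integral_sum) (auto intro!: Bochner_Integration.integrable_sum sum.cong simp: Bochner_Integration.integral_sum)
  also have "\<dots> = (\<Sum>k\<in>S. \<Sum>l\<in>S. if k = l then c k * c l else 0)"
    using S by (intro sum.cong refl, subst hartley_orthonormal) auto
  also have "\<dots> = (\<Sum>k\<in>S. (c k)\<^sup>2)" using S by (simp add: power2_eq_square)
  finally show ?thesis by (simp add: sum_distrib_left[symmetric])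
qed

lemma hartley_bessel:
  assumes "g \<in> borel_measurable (torus_measure d)" "integrable (torus_measure d) (\<lambda>x. (g x)\<^sup>2)"
    "finite S" "S \<subseteq> lattice d"
  shows "(\<Sum>k\<in>S. (LINT x|torus_measure d. g x * hartley d k x)\<^sup>2) \<le> (LINT x|torus_measure d. (g x)\<^sup>2)"
proof -
  have "0 \<le> (LINT x|torus_measure d. (g x - (\<Sum>k\<in>S. (LINT x|torus_measure d. g x * hartley d k x) * hartley d k x))\<^sup>2)"
    by simp
  then show ?thesis unfolding hartley_residual[OF assms] by simp
qed

lemma hartley_combination_norm:
  assumes S: "finite S" "S \<subseteq> lattice d"
  shows "(LINT x|torus_measure d. (\<Sum>k\<in>S. a k * hartley d k x)\<^sup>2) = (\<Sum>k\<in>S. (a k)\<^sup>2)"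
proof -
  note hi = integrable_hartley_mult[of d]
  have "(LINT x|torus_measure d. (\<Sum>k\<in>S. a k * hartley d k x)\<^sup>2) =
     (LINT x|torus_measure d. (\<Sum>k\<in>S. \<Sum>l\<in>S. a k * a l * (hartley d k x * hartley d l x)))"
  proof (intro Bochner_Integration.integral_cong refl)
    fix x
    show "(\<Sum>k\<in>S. a k * hartley d k x)\<^sup>2 = (\<Sum>k\<in>S. \<Sum>l\<in>S. a k * a l * (hartley d k x * hartley d l x))"
      unfolding power2_eq_square sum_product by (intro sum.cong refl) (simp add: mult_ac)
  qed
  also have "\<dots> = (\<Sum>k\<in>S. \<Sum>l\<in>S. a k * a l * (LINT x|torus_measure d. hartley d k x * hartley d l x))"
    using hi by (subst Bochner_Integration.integral_sum) (auto intro!: Bochner_Integration.integrable_sum sum.cong simp: Bochner_Integration.integral_sum)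
  also have "\<dots> = (\<Sum>k\<in>S. \<Sum>l\<in>S. if k = l then a k * a l else 0)"
    using S by (intro sum.cong refl, subst hartley_orthonormal) auto
  also have "\<dots> = (\<Sum>k\<in>S. (a k)\<^sup>2)" using S by (simp add: power2_eq_square)
  finally show ?thesis .
qed

lemma square_integrable_diff:
  fixes f g :: "'a \<Rightarrow> real"
  assumes [measurable]: "f \<in> borel_measurable M" "g \<in> borel_measurable M"
    and "integrable M (\<lambda>x. (f x)\<^sup>2)" "integrable M (\<lambda>x. (g x)\<^sup>2)"
  shows "integrable M (\<lambda>x. (f x - g x)\<^sup>2)"
proof (rule Bochner_Integration.integrable_bound)
  show "integrable M (\<lambda>x. 2 * (f x)\<^sup>2 + 2 * (g x)\<^sup>2)" using assms by simp
  have "(a - b)\<^sup>2 \<le> 2 * a\<^sup>2 + 2 * b\<^sup>2" for a b :: real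
    using sum_squares_bound[of a "-b"] zero_le_power2[of "a + b"] by (simp add: power2_sum power2_diff)
  then show "AE x in M. norm ((f x - g x)\<^sup>2) \<le> norm (2 * (f x)\<^sup>2 + 2 * (g x)\<^sup>2)" by auto
qed measurable

lemma L2_space_diff:
  assumes "f \<in> L2_space d" "g \<in> L2_space d"
  shows "(\<lambda>x. f x - g x) \<in> L2_space d"
  using assms square_integrable_diff[of f "torus_measure d" g] by (auto simp: L2_space_def)

lemma cfun_L2: "apply_bcontfun f \<in> L2_space d" for f :: cfun
proof -
  interpret prob_space "torus_measure d" by (rule prob_space_torus_measure)
  have "integrable (torus_measure d) (\<lambda>x. (apply_bcontfun f x)\<^sup>2)"
    by (rule integrable_const_bound[of _ "(norm f)\<^sup>2"])
       (auto simp: abs_le_square_iff[symmetric] eval_bound)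
  then show ?thesis by (simp add: L2_space_def)
qed

lemma L2_norm_sq: "(L2_norm d g)\<^sup>2 = (LINT x|torus_measure d. (g x)\<^sup>2)"
  unfolding L2_norm_def by simp

lemma space_L2_borel: "space (L2_borel d) = L2_space d"
  unfolding L2_borel_def by (rule space_measure_of) (auto simp: L2_open_def)

lemma L2_open_sets: "L2_open d U \<Longrightarrow> U \<in> sets (L2_borel d)"
  unfolding L2_borel_def by (subst sets_measure_of) (auto simp: L2_open_def)

text \<open>
  Continuity in the seminorm, by Bessel's inequality for a single function.
\<close>

lemma measurable_L2_coef:
  assumes k: "k \<in> lattice d"
  shows "(\<lambda>g. LINT x|torus_measure d. g x * hartley d k x) \<in> borel_measurable (L2_borel d)"
proof (rule borel_measurableI)
  fix S :: "real set" assume S: "open S"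
  let ?I = "\<lambda>g. LINT x|torus_measure d. g x * hartley d k x"
  show "?I -` S \<inter> space (L2_borel d) \<in> sets (L2_borel d)"
    unfolding space_L2_borel
  proof (rule L2_open_sets, unfold L2_open_def, intro conjI ballI)
    fix g assume "g \<in> ?I -` S \<inter> L2_space d"
    then have g: "?I g \<in> S" "g \<in> L2_space d" by auto
    from S g(1) obtain e where e: "0 < e" "\<And>y. dist y (?I g) < e \<Longrightarrow> y \<in> S"
      unfolding open_dist by blast
    have "h \<in> ?I -` S \<inter> L2_space d" if h: "h \<in> L2_space d" "L2_norm d (\<lambda>x. h x - g x) < e" for h
    proof -
      have hg: "(\<lambda>x. h x - g x) \<in> L2_space d" by (rule L2_space_diff[OF h(1) g(2)])
      have "?I h - ?I g = ?I (\<lambda>x. h x - g x)"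
        using h(1) g(2) by (simp add: L2_space_def left_diff_distrib integrable_square_times_bounded)
      also have "(\<dots>)\<^sup>2 \<le> (L2_norm d (\<lambda>x. h x - g x))\<^sup>2"
        using hartley_bessel[of "\<lambda>x. h x - g x" d "{k}"] hg k by (simp add: L2_space_def L2_norm_sq)
      finally have "\<bar>?I h - ?I g\<bar> \<le> L2_norm d (\<lambda>x. h x - g x)"
        by (rule abs_le_square_iff[THEN iffD2, THEN order_trans]) (simp add: L2_norm_def)
      with h e(2)[of "?I h"] show ?thesis by (auto simp: dist_real_def)
    qed
    then show "\<exists>e>0. \<forall>h\<in>L2_space d. L2_norm d (\<lambda>x. h x - g x) < e \<longrightarrow> h \<in> ?I -` S \<inter> L2_space d"
      using e(1) by blast
  qed auto
qed

text \<open>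
  The reconstruction map depends continuously on the data, because its seminorm is the Euclidean norm
  of the coefficients. Openness of preimages is shown in the product topology on all sequences, where
  open sets are measurable.
\<close>

lemma measurable_hartley_combination:
  fixes e :: "nat \<Rightarrow> nat \<Rightarrow> int"
  assumes e: "inj_on e {..<m}" "\<And>i. i < m \<Longrightarrow> e i \<in> lattice d" and mn: "m \<le> n"
  shows "(\<lambda>z x. \<Sum>i<m. z i * hartley d (e i) x) \<in> measurable (PiM {..<n} (\<lambda>_. borel :: real measure)) (L2_borel d)"
proof -
  interpret prob_space "torus_measure d" by (rule prob_space_torus_measure)
  define \<phi> where "\<phi> z x = (\<Sum>i<m. z i * hartley d (e i) x)" for z :: "nat \<Rightarrow> real" and x
  have norm: "(L2_norm d (\<phi> a))\<^sup>2 = (\<Sum>i<m. (a i)\<^sup>2)" for a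
  proof -
    define b where "b k = a (inv_into {..<m} e k)" for k
    have "\<phi> a x = (\<Sum>k\<in>e ` {..<m}. b k * hartley d k x)" for x
      unfolding \<phi>_def b_def using e(1) by (subst sum.reindex) (auto intro!: sum.cong)
    then have "(L2_norm d (\<phi> a))\<^sup>2 = (\<Sum>k\<in>e ` {..<m}. (b k)\<^sup>2)"
      unfolding L2_norm_sq using e(2) by (simp only:) (subst hartley_combination_norm; auto)
    also have "\<dots> = (\<Sum>i<m. (a i)\<^sup>2)"
      unfolding b_def using e(1) by (subst sum.reindex) (auto intro!: sum.cong)
    finally show ?thesis .
  qed
  have L2: "\<phi> z \<in> L2_space d" for z
  proof -
    have [measurable]: "\<phi> z \<in> borel_measurable (torus_measure d)" unfolding \<phi>_def[abs_def] by measurable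
    have "\<bar>\<phi> z x\<bar> \<le> (\<Sum>i<m. \<bar>z i\<bar> * 2)" for x
      unfolding \<phi>_def by (rule order_trans[OF sum_abs]) (auto simp: abs_mult intro!: sum_mono mult_mono hartley_bound)
    then have "norm ((\<phi> z x)\<^sup>2) \<le> (\<Sum>i<m. \<bar>z i\<bar> * 2)\<^sup>2" for x
      using abs_le_square_iff[of "\<phi> z x" "\<Sum>i<m. \<bar>z i\<bar> * 2"] by (simp add: sum_nonneg)
    then have "integrable (torus_measure d) (\<lambda>x. (\<phi> z x)\<^sup>2)"
      by (intro integrable_const_bound[of _ "(\<Sum>i<m. \<bar>z i\<bar> * 2)\<^sup>2"]) auto
    then show ?thesis by (simp add: L2_space_def)
  qed
  have id: "(\<lambda>z. z) \<in> measurable (PiM {..<n} (\<lambda>_. borel :: real measure)) borel"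
  proof -
    have "(\<lambda>z. z) \<in> measurable (PiM {..<n} (\<lambda>_. borel :: real measure)) (PiM UNIV (\<lambda>_. borel))"
    proof (rule measurable_PiM_single')
      fix i :: nat
      show "(\<lambda>x. x i) \<in> borel_measurable (PiM {..<n} (\<lambda>_. borel :: real measure))"
      proof (cases "i < n")
        case False
        then have "x i = undefined" if "x \<in> space (PiM {..<n} (\<lambda>_. borel :: real measure))" for x
          using that by (auto simp: space_PiM PiE_def extensional_def)
        then show ?thesis by (subst measurable_cong[where g="\<lambda>_. undefined"]) auto
      qed simp
    qed simp
    then show ?thesis by (simp add: measurable_cong_sets[OF refl sets_PiM_equal_borel])
  qed
  have "\<phi> \<in> measurable (PiM {..<n} (\<lambda>_. borel :: real measure)) (L2_borel d)"
    unfolding L2_borel_def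
  proof (rule measurable_measure_of)
    fix U assume "U \<in> {U. L2_open d U}"
    then have U: "\<And>g. g \<in> U \<Longrightarrow> \<exists>e>0. \<forall>h\<in>L2_space d. L2_norm d (\<lambda>x. h x - g x) < e \<longrightarrow> h \<in> U"
      by (auto simp: L2_open_def)
    have "open (\<phi> -` U)"
    proof (subst open_subopen, intro ballI)
      fix z assume "z \<in> \<phi> -` U"
      with U obtain r where r: "0 < r" "\<And>h. h \<in> L2_space d \<Longrightarrow> L2_norm d (\<lambda>x. h x - \<phi> z x) < r \<Longrightarrow> h \<in> U"
        by blast
      define T where "T = {y. (\<Sum>i<m. (y i - z i)\<^sup>2) < r\<^sup>2}"
      have "open T" unfolding T_def
        by (intro open_Collect_less continuous_intros continuous_on_product_coordinates)
      moreover have "z \<in> T" using r by (simp add: T_def)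
      moreover have "T \<subseteq> \<phi> -` U"
      proof
        fix y assume y: "y \<in> T"
        have "(\<lambda>x. \<phi> y x - \<phi> z x) = \<phi> (\<lambda>i. y i - z i)"
          by (auto simp: \<phi>_def sum_subtractf algebra_simps)
        then have "(L2_norm d (\<lambda>x. \<phi> y x - \<phi> z x))\<^sup>2 < r\<^sup>2" using y norm[of "\<lambda>i. y i - z i"] by (simp add: T_def)
        then have "L2_norm d (\<lambda>x. \<phi> y x - \<phi> z x) < r" using r(1) by (simp add: power2_less_imp_less)
        then show "y \<in> \<phi> -` U" using r(2)[OF L2] by simp
      qed
      ultimately show "\<exists>T. open T \<and> z \<in> T \<and> T \<subseteq> \<phi> -` U" by blast
    qed
    then have "\<phi> -` U \<in> sets borel" by simp
    from measurable_sets[OF id this] show "\<phi> -` U \<inter> space (PiM {..<n} (\<lambda>_. borel :: real measure)) \<in> sets (PiM {..<n} (\<lambda>_. borel))"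
      by simp
  qed (auto simp: L2_open_def L2)
  then show ?thesis unfolding \<phi>_def[abs_def] .
qed

section \<open>Random functions with a diagonal covariance kernel\<close>

text \<open>
  The relevant structure of the random function: a covariance kernel with summable, symmetric
  Fourier coefficients.
\<close>

locale torus_field =
  fixes d :: nat and M :: "cfun measure" and lam :: "(nat \<Rightarrow> int) \<Rightarrow> real"
  assumes gaussian: "gaussian_measure d M" and mean: "zero_mean d M"
    and covariance: "has_covariance_kernel d M (\<lambda>x y. \<Sum>\<^sub>\<infinity>k\<in>lattice d.
        complex_of_real (lam k) * exp (\<i> * complex_of_real (\<Sum>j<d. real_of_int (k j) * (x j - y j))))"
    and lam_nonneg: "\<And>k. 0 \<le> lam k"
    and lam_even: "\<And>k. k \<in> lattice d \<Longrightarrow> lam (\<lambda>j\<in>{..<d}. - k j) = lam k"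
    and lam_summable: "lam summable_on lattice d"
begin

abbreviation T where "T \<equiv> torus_measure d"

text \<open>
  The trace of the covariance operator, which is the expectation of the squared norm.
\<close>

definition trace :: real where "trace = (\<Sum>\<^sub>\<infinity>k\<in>lattice d. lam k)"

sublocale T: prob_space T by (rule prob_space_torus_measure)

sublocale G: gaussian_space M "C_torus_dual d"
proof -
  have "prob_space M" using gaussian by (simp add: gaussian_measure_def)
  moreover have "gaussian_space_axioms M (C_torus_dual d)"
    by (rule gaussian_space_axioms.intro)
       (fact gaussian_functional[OF gaussian mean] dual_zero dual_add dual_scale)+
  ultimately show "gaussian_space M (C_torus_dual d)"
    by (rule gaussian_space.intro)
qed

sublocale P: pair_prob_space M T ..

lemma sets_M: "sets M = sets (restrict_space borel (C_torus d))"
  using gaussian by (simp add: gaussian_measure_def)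

lemma eval_measurable[measurable]: "(\<lambda>z. apply_bcontfun (fst z) (snd z)) \<in> borel_measurable (M \<Otimes>\<^sub>M T)"
  by (rule measurable_eval_pair[OF sets_M])

lemma eval_measurable'[measurable]: "(\<lambda>(f, x). apply_bcontfun f x) \<in> borel_measurable (M \<Otimes>\<^sub>M T)"
  using eval_measurable by (simp add: case_prod_unfold)

definition kern :: "(nat \<Rightarrow> real) \<Rightarrow> (nat \<Rightarrow> real) \<Rightarrow> real" where
  "kern x y = (LINT f|M. apply_bcontfun f x * apply_bcontfun f y)"

lemma kern_diag:
  assumes "x \<in> torus d"
  shows "kern x x = trace"
proof -
  have "complex_of_real (kern x x) = (\<Sum>\<^sub>\<infinity>k\<in>lattice d. complex_of_real (lam k))"
    using covariance assms unfolding has_covariance_kernel_def kern_def by simp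
  also have "\<dots> = complex_of_real trace"
    unfolding trace_def by (intro infsumI has_sum_of_real has_sum_infsum lam_summable)
  finally show ?thesis unfolding of_real_eq_iff .
qed

text \<open>
  Taking real parts turns the complex series into one with \<open>cos (k x - k y)\<close>. The series with
  \<open>sin (k x + k y)\<close> vanishes by the symmetry \<open>k \<mapsto> - k\<close>, and adding it produces the product of
  two Hartley functions.
\<close>

lemma kern_has_sum:
  assumes x: "x \<in> torus d" and y: "y \<in> torus d"
  shows "((\<lambda>k. lam k * (hartley d k x * hartley d k y)) has_sum kern x y) (lattice d)"
proof -
  define e where "e k = complex_of_real (lam k) * exp (\<i> * complex_of_real (\<Sum>j<d. real_of_int (k j) * (x j - y j)))" for k
  have ne: "norm (e k) = lam k" for k
    unfolding e_def using lam_nonneg[of k] by (simp add: norm_mult norm_exp_i_times del: of_real_sum)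
  have sm: "e summable_on lattice d"
    by (rule abs_summable_summable) (simp add: ne lam_summable)
  have "complex_of_real (kern x y) = infsum e (lattice d)"
    using covariance x y unfolding has_covariance_kernel_def kern_def e_def[abs_def] by blast
  then have "(e has_sum complex_of_real (kern x y)) (lattice d)"
    using has_sum_infsum[OF sm] by (simp only:)
  from has_sum_Re[OF this] have "((\<lambda>k. Re (e k)) has_sum kern x y) (lattice d)" by simp
  moreover have "Re (e k) = lam k * cos (phase d k x - phase d k y)" for k
    unfolding e_def phase_def sum_subtractf[symmetric] right_diff_distrib
    by (simp add: Re_exp del: of_real_sum)
  ultimately have c: "((\<lambda>k. lam k * cos (phase d k x - phase d k y)) has_sum kern x y) (lattice d)"
    by simp
  define s where "s k = lam k * sin (phase d k x + phase d k y)" for k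
  define neg :: "(nat \<Rightarrow> int) \<Rightarrow> nat \<Rightarrow> int" where "neg k = (\<lambda>j\<in>{..<d}. - k j)" for k
  have sneg: "s (neg k) = - s k" if "k \<in> lattice d" for k
  proof -
    have "phase d (neg k) z = - phase d k z" for z
      unfolding phase_def neg_def by (simp add: sum_negf[symmetric])
    then have "phase d (neg k) x + phase d (neg k) y = - (phase d k x + phase d k y)" by simp
    then show ?thesis using lam_even[OF that] unfolding s_def by (simp only: sin_minus) (simp add: neg_def)
  qed
  have ss: "s summable_on lattice d"
  proof (rule abs_summable_summable, rule Infinite_Sum.abs_summable_on_comparison_test'[OF lam_summable])
    show "norm (s k) \<le> lam k" for k
      unfolding s_def using lam_nonneg[of k] abs_sin_le_one[of "phase d k x + phase d k y"]
      by (simp add: abs_mult mult_left_le)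
  qed
  have nn: "neg (neg k) = k" if "k \<in> lattice d" for k
  proof (rule ext)
    fix j
    show "neg (neg k) j = k j"
      using PiE_arb[OF that, of j] by (cases "j < d") (simp_all add: neg_def)
  qed
  have nm: "neg k \<in> lattice d" for k by (simp add: neg_def)
  have "infsum s (lattice d) = infsum (\<lambda>k. - s k) (lattice d)"
    by (rule infsum_reindex_bij_witness[where i=neg and j=neg])
       (simp_all only: sneg nn nm)
  then have "infsum s (lattice d) = 0" by (simp add: infsum_uminus)
  then have "(s has_sum 0) (lattice d)" using ss by (metis has_sum_infsum)
  from has_sum_add[OF c this]
  have "((\<lambda>k. lam k * cos (phase d k x - phase d k y) + s k) has_sum kern x y) (lattice d)" by simp
  moreover have "lam k * cos (phase d k x - phase d k y) + s k = lam k * (hartley d k x * hartley d k y)" for k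
    unfolding s_def hartley_def by (simp add: cos_diff sin_add algebra_simps)
  ultimately show ?thesis by simp
qed

lemma sum_le_trace: "finite S \<Longrightarrow> S \<subseteq> lattice d \<Longrightarrow> sum lam S \<le> trace"
  unfolding trace_def by (rule finite_sum_le_infsum) (use lam_summable lam_nonneg in auto)

lemma kern_approx:
  assumes x: "x \<in> torus d" and y: "y \<in> torus d" and S: "finite S" "S \<subseteq> lattice d"
  shows "\<bar>kern x y - (\<Sum>k\<in>S. lam k * (hartley d k x * hartley d k y))\<bar> \<le> 4 * (trace - sum lam S)"
proof -
  have "((\<lambda>k. lam k * (hartley d k x * hartley d k y)) has_sum
      (kern x y - (\<Sum>k\<in>S. lam k * (hartley d k x * hartley d k y)))) (lattice d - S)"
    using S by (intro has_sum_Diff kern_has_sum x y has_sum_finite)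
  moreover have "((\<lambda>k. 4 * lam k) has_sum 4 * (trace - sum lam S)) (lattice d - S)"
    using S unfolding trace_def
    by (intro has_sum_cmult_right has_sum_Diff has_sum_infsum lam_summable has_sum_finite)
  moreover have "norm (lam k * (hartley d k x * hartley d k y)) \<le> 4 * lam k" for k
  proof -
    have "\<bar>hartley d k x\<bar> * \<bar>hartley d k y\<bar> \<le> 2 * 2" by (intro mult_mono hartley_bound) auto
    then have "lam k * (\<bar>hartley d k x\<bar> * \<bar>hartley d k y\<bar>) \<le> lam k * 4"
      using lam_nonneg[of k] by (intro mult_left_mono) auto
    then show ?thesis using lam_nonneg[of k] by (simp add: abs_mult)
  qed
  ultimately show ?thesis
    using norm_infsum_le[where f="\<lambda>k. lam k * (hartley d k x * hartley d k y)" and X="lattice d - S" and g="\<lambda>k. 4 * lam k"]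
    by fastforce
qed

lemma trace_approx:
  assumes "0 < e"
  obtains S where "finite S" "S \<subseteq> lattice d" "trace - sum lam S < e"
proof -
  from has_sum_finite_approximation[OF has_sum_infsum[OF lam_summable], of "e / 2"] assms
  obtain F where F: "finite F" "F \<subseteq> lattice d" "dist (sum lam F) trace \<le> e / 2"
    unfolding trace_def by auto
  then have "trace - sum lam F < e" using assms unfolding dist_real_def by linarith
  with F that show ?thesis by blast
qed

text \<open>
  Square integrability on the product space is what makes all the later applications of Fubini's
  theorem legitimate.
\<close>

lemma eval_square_integrable_pair: "integrable (M \<Otimes>\<^sub>M T) (\<lambda>(f, x). (apply_bcontfun f x)\<^sup>2)"
proof -
  have "(\<integral>\<^sup>+z. ennreal (norm ((apply_bcontfun (fst z) (snd z))\<^sup>2)) \<partial>(M \<Otimes>\<^sub>M T)) =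
      (\<integral>\<^sup>+x. (\<integral>\<^sup>+f. ennreal ((apply_bcontfun f x)\<^sup>2) \<partial>M) \<partial>T)"
    by (subst P.nn_integral_snd[symmetric]) auto
  also have "\<dots> = (\<integral>\<^sup>+x. ennreal trace \<partial>T)"
  proof (rule nn_integral_cong_AE)
    show "AE x in T. (\<integral>\<^sup>+f. ennreal ((apply_bcontfun f x)\<^sup>2) \<partial>M) = ennreal trace"
      using AE_torus
    proof eventually_elim
      case (elim x)
      have "(\<integral>\<^sup>+f. ennreal ((apply_bcontfun f x)\<^sup>2) \<partial>M) = ennreal (LINT f|M. (apply_bcontfun f x)\<^sup>2)"
        by (rule nn_integral_eq_integral) (use G.sq_integrable[OF dual_eval] in auto)
      then show ?case using kern_diag[OF elim] by (simp add: kern_def power2_eq_square)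
    qed
  qed
  also have "\<dots> < \<infinity>" by (simp add: T.emeasure_space_1)
  finally show ?thesis
    unfolding integrable_iff_bounded by (auto simp: case_prod_unfold)
qed

lemma expectation_eval_square: "(LINT f|M. (LINT x|T. (apply_bcontfun f x)\<^sup>2)) = trace"
  and integrable_eval_square: "integrable M (\<lambda>f. LINT x|T. (apply_bcontfun f x)\<^sup>2)"
proof -
  have "(LINT f|M. (LINT x|T. (apply_bcontfun f x)\<^sup>2)) = (LINT x|T. (LINT f|M. (apply_bcontfun f x)\<^sup>2))"
    using P.Fubini_integral[OF eval_square_integrable_pair] by simp
  also have "\<dots> = (LINT x|T. trace)"
  proof (rule integral_cong_AE)
    show "AE x in T. (LINT f|M. (apply_bcontfun f x)\<^sup>2) = trace"
      using AE_torus by eventually_elim (simp add: kern_diag[symmetric] kern_def power2_eq_square)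
  qed measurable
  finally show "(LINT f|M. (LINT x|T. (apply_bcontfun f x)\<^sup>2)) = trace" by (simp add: T.prob_space)
  show "integrable M (\<lambda>f. LINT x|T. (apply_bcontfun f x)\<^sup>2)"
    using P.integrable_fst[OF eval_square_integrable_pair] by simp
qed

lemma expectation_times_coef:
  assumes [measurable]: "Y \<in> borel_measurable M" and Y: "integrable M (\<lambda>f. (Y f)\<^sup>2)"
  shows "(LINT f|M. Y f * coef d k f) = (LINT x|T. hartley d k x * (LINT f|M. Y f * apply_bcontfun f x))"
proof -
  have "integrable (M \<Otimes>\<^sub>M T) (\<lambda>(f, x). Y f * (apply_bcontfun f x * hartley d k x))"
  proof (rule Bochner_Integration.integrable_bound)
    have "integrable (M \<Otimes>\<^sub>M T) (\<lambda>z. (Y (fst z))\<^sup>2)"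
      using Y by (intro P.Fubini_integrable) (auto simp: T.prob_space)
    then show "integrable (M \<Otimes>\<^sub>M T) (\<lambda>z. 2 * ((Y (fst z))\<^sup>2 + (apply_bcontfun (fst z) (snd z))\<^sup>2))"
      using eval_square_integrable_pair by (auto simp: case_prod_unfold)
    have "\<bar>a\<bar> * (\<bar>b\<bar> * \<bar>h\<bar>) \<le> 2 * (a\<^sup>2 + b\<^sup>2)" if "\<bar>h\<bar> \<le> 2" for a b h :: real
    proof -
      have "\<bar>a\<bar> * (\<bar>b\<bar> * \<bar>h\<bar>) \<le> (\<bar>a\<bar> * \<bar>b\<bar>) * 2" using that by (simp add: mult.assoc[symmetric] mult_left_mono)
      also have "\<dots> = 2 * \<bar>a\<bar> * \<bar>b\<bar>" by simp
      also have "\<dots> \<le> a\<^sup>2 + b\<^sup>2"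
        using sum_squares_bound[of "\<bar>a\<bar>" "\<bar>b\<bar>"] by simp
      also have "\<dots> \<le> 2 * (a\<^sup>2 + b\<^sup>2)" by simp
      finally show ?thesis .
    qed
    then show "AE z in M \<Otimes>\<^sub>M T. norm (case z of (f, x) \<Rightarrow> Y f * (apply_bcontfun f x * hartley d k x)) \<le>
        norm (2 * ((Y (fst z))\<^sup>2 + (apply_bcontfun (fst z) (snd z))\<^sup>2))"
      using hartley_bound[of d k] by (auto simp: abs_mult)
  qed measurable
  from P.Fubini_integral[OF this]
  have "(LINT f|M. (LINT x|T. Y f * (apply_bcontfun f x * hartley d k x))) =
      (LINT x|T. (LINT f|M. Y f * (apply_bcontfun f x * hartley d k x)))" by simp
  also have "(LINT f|M. (LINT x|T. Y f * (apply_bcontfun f x * hartley d k x))) = (LINT f|M. Y f * coef d k f)"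
    by (simp add: coef_def)
  also have "(LINT x|T. (LINT f|M. Y f * (apply_bcontfun f x * hartley d k x))) =
      (LINT x|T. hartley d k x * (LINT f|M. Y f * apply_bcontfun f x))"
  proof (intro Bochner_Integration.integral_cong refl)
    fix x
    have "(LINT f|M. Y f * (apply_bcontfun f x * hartley d k x)) = (LINT f|M. hartley d k x * (Y f * apply_bcontfun f x))"
      by (simp only: mult_ac)
    then show "(LINT f|M. Y f * (apply_bcontfun f x * hartley d k x)) = hartley d k x * (LINT f|M. Y f * apply_bcontfun f x)"
      by simp
  qed
  finally show ?thesis .
qed

lemma kern_measurable[measurable]: "kern x \<in> borel_measurable T"
proof -
  have [measurable]: "(\<lambda>f. apply_bcontfun f x) \<in> borel_measurable M" using G.meas[OF dual_eval] .
  show ?thesis unfolding kern_def[abs_def] by measurable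
qed

text \<open>
  The kernel is uniformly close to its finite partial sums, for which the identity is
  orthonormality; so the two sides differ by less than any positive number.
\<close>

lemma kern_eigenfunction:
  assumes x: "x \<in> torus d" and k: "k \<in> lattice d"
  shows "(LINT y|T. hartley d k y * kern x y) = lam k * hartley d k x"
proof -
  define D where "D = (LINT y|T. hartley d k y * kern x y) - lam k * hartley d k x"
  have AEb: "AE y in T. norm (kern x y) \<le> 4 * trace"
    using AE_torus by eventually_elim (use kern_approx[OF x, of _ "{}"] in simp)
  have ik: "integrable T (\<lambda>y. hartley d k y * kern x y)"
  proof (rule T.integrable_const_bound)
    show "AE y in T. norm (hartley d k y * kern x y) \<le> 2 * (4 * trace)"
      using AEb
    proof eventually_elim
      case (elim y)
      then show ?case unfolding norm_mult by (intro mult_mono) (auto intro: hartley_bound)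
    qed
  qed measurable
  have "\<bar>D\<bar> \<le> 0 + e" if e: "0 < e" for e
  proof -
    from trace_approx[of "e / 8"] e obtain S0 where S0: "finite S0" "S0 \<subseteq> lattice d" "trace - sum lam S0 < e / 8" by auto
    (* the index k has to occur in the partial sum, since orthonormality picks out its term *)
    define S where "S = insert k S0"
    have S: "finite S" "S \<subseteq> lattice d" "k \<in> S" using S0 k by (auto simp: S_def)
    have "sum lam S0 \<le> sum lam S" using S S0 lam_nonneg by (intro sum_mono2) (auto simp: S_def)
    then have Se: "trace - sum lam S < e / 8" using S0 by simp
    let ?A = "\<lambda>y. \<Sum>l\<in>S. lam l * (hartley d l x * hartley d l y)"
    have iA: "integrable T (\<lambda>y. hartley d k y * ?A y)"
    proof -
      have "(\<lambda>y. hartley d k y * ?A y) = (\<lambda>y. \<Sum>l\<in>S. (lam l * hartley d l x) * (hartley d k y * hartley d l y))"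
        by (auto simp: sum_distrib_left mult_ac intro!: sum.cong)
      then show ?thesis by (simp add: integrable_hartley_mult)
    qed
    have "(LINT y|T. hartley d k y * ?A y) = (LINT y|T. (\<Sum>l\<in>S. (lam l * hartley d l x) * (hartley d k y * hartley d l y)))"
      by (intro Bochner_Integration.integral_cong refl) (auto simp: sum_distrib_left mult_ac intro!: sum.cong)
    also have "\<dots> = (\<Sum>l\<in>S. (lam l * hartley d l x) * (LINT y|T. hartley d k y * hartley d l y))"
      by (subst Bochner_Integration.integral_sum) (auto simp: integrable_hartley_mult)
    also have "\<dots> = (\<Sum>l\<in>S. if k = l then lam l * hartley d l x else 0)"
      using S k by (intro sum.cong refl, subst hartley_orthonormal) auto
    also have "\<dots> = lam k * hartley d k x" using S by simp
    finally have "D = (LINT y|T. hartley d k y * kern x y) - (LINT y|T. hartley d k y * ?A y)"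
      by (simp add: D_def)
    also have "\<dots> = (LINT y|T. hartley d k y * (kern x y - ?A y))"
      using ik iA by (simp add: right_diff_distrib)
    also have "\<bar>\<dots>\<bar> \<le> (LINT y|T. 2 * (4 * (e / 8)))"
    proof (rule integral_abs_bound[THEN order_trans], rule integral_mono_AE)
      show "integrable T (\<lambda>y. \<bar>hartley d k y * (kern x y - ?A y)\<bar>)"
        using ik iA by (simp add: right_diff_distrib)
      show "AE y in T. \<bar>hartley d k y * (kern x y - ?A y)\<bar> \<le> 2 * (4 * (e / 8))"
        using AE_torus
      proof eventually_elim
        case (elim y)
        have "\<bar>kern x y - ?A y\<bar> \<le> 4 * (e / 8)"
          by (rule order_trans[OF kern_approx[OF x elim S(1,2)]]) (use Se in simp)
        then show ?case unfolding abs_mult by (intro mult_mono hartley_bound) auto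
      qed
    qed simp
    finally show ?thesis by (simp add: T.prob_space)
  qed
  then have "\<bar>D\<bar> \<le> 0" by (rule field_le_epsilon)
  then show ?thesis by (simp add: D_def)
qed

text \<open>
  Two applications of Fubini's theorem move the expectation inside, where the covariance kernel acts
  on its eigenfunction.
\<close>

lemma coef_covariance:
  assumes k: "k \<in> lattice d" and l: "l \<in> lattice d"
  shows "(LINT f|M. coef d k f * coef d l f) = (if k = l then lam k else 0)"
proof -
  have [measurable]: "coef d k \<in> borel_measurable M" using G.meas[OF dual_coef] .
  have "(LINT f|M. coef d k f * coef d l f) = (LINT x|T. hartley d l x * (LINT f|M. coef d k f * apply_bcontfun f x))"
    by (rule expectation_times_coef) (rule G.meas[OF dual_coef] G.sq_integrable[OF dual_coef])+
  also have "\<dots> = (LINT x|T. hartley d l x * (lam k * hartley d k x))"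
  proof (rule integral_cong_AE)
    show "AE x in T. hartley d l x * (LINT f|M. coef d k f * apply_bcontfun f x) = hartley d l x * (lam k * hartley d k x)"
      using AE_torus
    proof eventually_elim
      case (elim x)
      have "(LINT f|M. coef d k f * apply_bcontfun f x) = (LINT f|M. apply_bcontfun f x * coef d k f)"
        by (simp only: mult.commute)
      also have "\<dots> = (LINT y|T. hartley d k y * kern x y)"
        unfolding kern_def by (rule expectation_times_coef) (rule G.meas[OF dual_eval] G.sq_integrable[OF dual_eval])+
      also have "\<dots> = lam k * hartley d k x" by (rule kern_eigenfunction[OF elim k])
      finally show ?case by simp
    qed
  qed measurable
  also have "\<dots> = lam k * (LINT x|T. hartley d k x * hartley d l x)"
    by (simp add: mult_ac)
  finally show ?thesis using hartley_orthonormal[OF k l] by simp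
qed

lemma ennreal_sqrt_ennreal: "ennreal_sqrt (ennreal r) = ennreal (sqrt r)"
  by (cases "0 \<le> r") (auto simp: ennreal_sqrt_def ennreal_neg)

lemma ennreal_sqrt_ge: "ennreal r \<le> z \<Longrightarrow> ennreal (sqrt r) \<le> ennreal_sqrt z"
proof (cases z)
  case (real s)
  assume "ennreal r \<le> z"
  then have "r \<le> s" using real ennreal_le_iff[of s r] by simp
  then show ?thesis using real by (auto simp: ennreal_sqrt_ennreal intro!: ennreal_leI)
qed (simp add: ennreal_sqrt_def)

text \<open>
  By Pythagoras' theorem the squared error is the squared norm minus the squares of the coefficients
  used, and expectations are taken termwise.
\<close>

lemma projection_error:
  assumes S: "finite S" "S \<subseteq> lattice d"
  shows "alg_error d M (\<lambda>f x. \<Sum>k\<in>S. coef d k f * hartley d k x) = ennreal (sqrt (trace - sum lam S))"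
proof -
  have "(\<integral>\<^sup>+f. ennreal ((L2_norm d (\<lambda>x. apply_bcontfun f x - (\<Sum>k\<in>S. coef d k f * hartley d k x)))\<^sup>2) \<partial>M) =
     (\<integral>\<^sup>+f. ennreal ((LINT x|T. (apply_bcontfun f x)\<^sup>2) - (\<Sum>k\<in>S. coef d k f * coef d k f)) \<partial>M)"
  proof (intro nn_integral_cong)
    fix f
    have "(LINT x|T. (apply_bcontfun f x - (\<Sum>k\<in>S. coef d k f * hartley d k x))\<^sup>2) =
       (LINT x|T. (apply_bcontfun f x)\<^sup>2) - (\<Sum>k\<in>S. (coef d k f)\<^sup>2)"
      unfolding coef_def using cfun_L2[of f d] by (intro hartley_residual S) (auto simp: L2_space_def)
    then show "ennreal ((L2_norm d (\<lambda>x. apply_bcontfun f x - (\<Sum>k\<in>S. coef d k f * hartley d k x)))\<^sup>2) =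
       ennreal ((LINT x|T. (apply_bcontfun f x)\<^sup>2) - (\<Sum>k\<in>S. coef d k f * coef d k f))"
      unfolding L2_norm_sq by (simp only: power2_eq_square)
  qed
  also have "\<dots> = ennreal (LINT f|M. (LINT x|T. (apply_bcontfun f x)\<^sup>2) - (\<Sum>k\<in>S. coef d k f * coef d k f))"
  proof (rule nn_integral_eq_integral)
    show "integrable M (\<lambda>f. (LINT x|T. (apply_bcontfun f x)\<^sup>2) - (\<Sum>k\<in>S. coef d k f * coef d k f))"
      using integrable_eval_square G.mult_integrable[OF dual_coef dual_coef] by auto
    show "AE f in M. 0 \<le> (LINT x|T. (apply_bcontfun f x)\<^sup>2) - (\<Sum>k\<in>S. coef d k f * coef d k f)"
    proof (intro AE_I2)
      fix f
      have "(\<Sum>k\<in>S. (coef d k f)\<^sup>2) \<le> (LINT x|T. (apply_bcontfun f x)\<^sup>2)"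
        unfolding coef_def using cfun_L2[of f d] by (intro hartley_bessel S) (auto simp: L2_space_def)
      then show "0 \<le> (LINT x|T. (apply_bcontfun f x)\<^sup>2) - (\<Sum>k\<in>S. coef d k f * coef d k f)"
        by (simp only: power2_eq_square diff_ge_0_iff_ge)
    qed
  qed
  also have "(LINT f|M. (LINT x|T. (apply_bcontfun f x)\<^sup>2) - (\<Sum>k\<in>S. coef d k f * coef d k f)) =
      (LINT f|M. (LINT x|T. (apply_bcontfun f x)\<^sup>2)) - (LINT f|M. (\<Sum>k\<in>S. coef d k f * coef d k f))"
    using integrable_eval_square G.mult_integrable[OF dual_coef dual_coef]
    by (intro Bochner_Integration.integral_diff Bochner_Integration.integrable_sum) auto
  also have "(LINT f|M. (\<Sum>k\<in>S. coef d k f * coef d k f)) = sum lam S"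
  proof -
    have "(LINT f|M. (\<Sum>k\<in>S. coef d k f * coef d k f)) = (\<Sum>k\<in>S. LINT f|M. coef d k f * coef d k f)"
      by (rule Bochner_Integration.integral_sum) (rule G.mult_integrable[OF dual_coef dual_coef])
    also have "\<dots> = sum lam S"
      using S by (intro sum.cong refl, subst coef_covariance) auto
    finally show ?thesis .
  qed
  finally show ?thesis
    unfolding alg_error_def by (simp add: expectation_eval_square ennreal_sqrt_ennreal)
qed

lemma projection_algorithm:
  assumes S: "finite S" "S \<subseteq> lattice d" and n: "card S \<le> n"
  shows "(\<lambda>f x. \<Sum>k\<in>S. coef d k f * hartley d k x) \<in> algorithms n d"
proof (cases "n = 0")
  case True
  then show ?thesis using S n by (simp add: algorithms_def)
next
  case False
  obtain e where e: "bij_betw e {..<card S} S"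
    using ex_bij_betw_nat_finite[OF S(1)] by (auto simp: lessThan_atLeast0)
  define L where "L i = (if i < card S then coef d (e i) else (\<lambda>f. 0))" for i
  define \<phi> where "\<phi> = (\<lambda>z x. \<Sum>i<card S. z i * hartley d (e i) x)"
  have "\<phi> \<in> measurable (PiM {..<n} (\<lambda>_. borel)) (L2_borel d)"
    unfolding \<phi>_def using e S n
    by (intro measurable_hartley_combination) (auto simp: bij_betw_def)
  moreover have "\<forall>i<n. L i \<in> C_torus_dual d" by (simp add: L_def dual_coef dual_zero)
  moreover have "(\<lambda>f x. \<Sum>k\<in>S. coef d k f * hartley d k x) = (\<lambda>f. \<phi> (\<lambda>i\<in>{..<n}. L i f))"
  proof (intro ext)
    fix f x
    have "(\<Sum>k\<in>S. coef d k f * hartley d k x) = (\<Sum>i<card S. coef d (e i) f * hartley d (e i) x)"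
      by (rule sum.reindex_bij_betw[OF e, symmetric])
    also have "\<dots> = \<phi> (\<lambda>i\<in>{..<n}. L i f) x"
      unfolding \<phi>_def L_def using n by (intro sum.cong) auto
    finally show "(\<Sum>k\<in>S. coef d k f * hartley d k x) = \<phi> (\<lambda>i\<in>{..<n}. L i f) x" .
  qed
  ultimately have "(\<lambda>f x. \<Sum>k\<in>S. coef d k f * hartley d k x) \<in>
      {\<lambda>f. \<phi> (\<lambda>i\<in>{..<n}. L i f) | \<phi> L. (\<forall>i<n. L i \<in> C_torus_dual d) \<and>
              \<phi> \<in> measurable (PiM {..<n} (\<lambda>_. borel)) (L2_borel d)}"
    by (intro CollectI exI conjI)
  then show ?thesis using False unfolding algorithms_def by (simp only: if_False)
qed

text \<open>
  By Bessel's inequality only the coefficients in \<open>J\<close> need to be estimated, and each coefficient of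
  the output of the algorithm is a measurable function of the data.
\<close>

lemma algorithm_lower_bound:
  assumes A: "A \<in> algorithms n d" and J: "finite J" "J \<subseteq> lattice d"
    and q: "\<And>k. k \<in> J \<Longrightarrow> 0 \<le> q k" "\<And>k. k \<in> J \<Longrightarrow> q k \<le> 1" "\<And>k. k \<in> J \<Longrightarrow> q k * lam k \<le> \<delta>"
    and \<delta>: "0 < \<delta>"
  shows "ennreal (sqrt ((\<Sum>k\<in>J. q k * lam k) - real n * \<delta>)) \<le> alg_error d M A"
proof (cases "n = 0")
  case True
  then have "A = (\<lambda>f x. \<Sum>k\<in>{}. coef d k f * hartley d k x)" using A by (simp add: algorithms_def)
  then have "alg_error d M A = ennreal (sqrt trace)" using projection_error[of "{}"] by simp
  moreover have "(\<Sum>k\<in>J. q k * lam k) \<le> trace"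
    using q lam_nonneg by (intro order_trans[OF _ sum_le_trace[OF J]] sum_mono mult_left_le_one_le) auto
  ultimately show ?thesis using True by (auto intro!: ennreal_leI)
next
  case False
  then obtain \<phi> L where A_eq: "A = (\<lambda>f. \<phi> (\<lambda>i\<in>{..<n}. L i f))" and L: "\<And>i. i < n \<Longrightarrow> L i \<in> C_torus_dual d"
    and \<phi>: "\<phi> \<in> measurable (PiM {..<n} (\<lambda>_. borel)) (L2_borel d)"
    using A by (auto simp: algorithms_def)
  define \<psi> where "\<psi> k z = (LINT x|T. \<phi> z x * hartley d k x)" for k z
  have "\<psi> k \<in> borel_measurable (PiM {..<n} (\<lambda>_. borel))" if "k \<in> J" for k
    unfolding \<psi>_def[abs_def] using J that by (intro measurable_compose[OF \<phi>] measurable_L2_coef) auto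
  then have "ennreal ((\<Sum>k\<in>J. q k * lam k) - real n * \<delta>) \<le>
      (\<integral>\<^sup>+f. ennreal (\<Sum>k\<in>J. q k * (coef d k f - \<psi> k (\<lambda>i\<in>{..<n}. L i f))\<^sup>2) \<partial>M)"
    using J q \<delta> by (intro G.weighted_estimates_lower_bound dual_coef L coef_covariance) auto
  also have "\<dots> \<le> (\<integral>\<^sup>+f. ennreal ((L2_norm d (\<lambda>x. apply_bcontfun f x - A f x))\<^sup>2) \<partial>M)"
  proof (intro nn_integral_mono ennreal_leI)
    fix f
    define z where "z = (\<lambda>i\<in>{..<n}. L i f)"
    have "z \<in> space (PiM {..<n} (\<lambda>_. borel))" by (simp add: z_def space_PiM)
    then have \<phi>z: "\<phi> z \<in> L2_space d" using measurable_space[OF \<phi>] by (simp add: space_L2_borel)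
    define g where "g x = apply_bcontfun f x - \<phi> z x" for x
    have g: "g \<in> L2_space d" unfolding g_def[abs_def] by (rule L2_space_diff[OF cfun_L2 \<phi>z])
    have c: "coef d k f - \<psi> k z = (LINT x|T. g x * hartley d k x)" for k
      unfolding coef_def \<psi>_def g_def using \<phi>z cfun_L2[of f d]
      by (simp add: left_diff_distrib L2_space_def integrable_square_times_bounded)
    have "(\<Sum>k\<in>J. q k * (coef d k f - \<psi> k z)\<^sup>2) \<le> (\<Sum>k\<in>J. (coef d k f - \<psi> k z)\<^sup>2)"
      using q by (intro sum_mono mult_left_le_one_le) auto
    also have "\<dots> \<le> (LINT x|T. (g x)\<^sup>2)"
      unfolding c using g J by (intro hartley_bessel) (auto simp: L2_space_def)
    also have "\<dots> = (L2_norm d (\<lambda>x. apply_bcontfun f x - A f x))\<^sup>2"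
      unfolding L2_norm_sq g_def A_eq z_def ..
    finally show "(\<Sum>k\<in>J. q k * (coef d k f - \<psi> k (\<lambda>i\<in>{..<n}. L i f))\<^sup>2) \<le> (L2_norm d (\<lambda>x. apply_bcontfun f x - A f x))\<^sup>2"
      unfolding z_def .
  qed
  finally show ?thesis unfolding alg_error_def by (rule ennreal_sqrt_ge)
qed

end

section \<open>Lattice sums\<close>

lemma exp_minus_le_powr:
  fixes y M :: real
  assumes "0 < y" "0 < M"
  shows "exp (- y) \<le> (M / y) powr M"
proof -
  have "y / M \<le> exp (y / M)" using exp_ge_add_one_self[of "y / M"] by linarith
  then have "(y / M) powr M \<le> exp (y / M) powr M" using assms by (intro powr_mono2) auto
  also have "\<dots> = exp y" using assms by (simp add: powr_def)
  finally have "(y / M) powr M \<le> exp y" .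
  then have "inverse (exp y) \<le> inverse ((y / M) powr M)" using assms by (intro le_imp_inverse_le) auto
  also have "\<dots> = (M / y) powr M" using assms by (simp add: powr_divide)
  finally show ?thesis by (simp add: exp_minus)
qed

lemma sum_inverse_squares_int:
  assumes "finite F" "0 \<notin> F"
  shows "(\<Sum>i\<in>F. 1 / (real_of_int i)\<^sup>2) \<le> 4"
proof -
  have nat_bound: "(\<Sum>n\<in>{1..N}. 1 / (real n)\<^sup>2) \<le> 2" for N :: nat
  proof -
    have "(\<Sum>n\<in>{1..Suc N}. 1 / (real n)\<^sup>2) \<le> 2 - 1 / real (Suc N)" for N
    proof (induction N)
      case (Suc N)
      have "1 / (real (Suc (Suc N)))\<^sup>2 \<le> 1 / real (Suc N) - 1 / real (Suc (Suc N))"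
      proof -
        have "1 / (real (Suc (Suc N)))\<^sup>2 \<le> 1 / (real (Suc N) * real (Suc (Suc N)))"
          unfolding power2_eq_square by (intro divide_left_mono mult_right_mono) auto
        also have "\<dots> = 1 / real (Suc N) - 1 / real (Suc (Suc N))" by (simp add: field_simps)
        finally show ?thesis .
      qed
      then show ?case using Suc by simp
    qed simp
    note this[of N]
    moreover have "(\<Sum>n\<in>{1..N}. 1 / (real n)\<^sup>2) \<le> (\<Sum>n\<in>{1..Suc N}. 1 / (real n)\<^sup>2)"
      by (intro sum_mono2) auto
    moreover have "0 \<le> 1 / real (Suc N)" by simp
    ultimately show ?thesis by linarith
  qed
  define N where "N = Max (insert 0 ((nat \<circ> abs) ` F))"
  have N: "nat \<bar>i\<bar> \<le> N" if "i \<in> F" for i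
    unfolding N_def using assms that by (intro Max_ge) auto
  have "F \<subseteq> int ` {1..N} \<union> (\<lambda>n. - int n) ` {1..N}"
  proof
    fix i assume i: "i \<in> F"
    then have "i \<noteq> 0" using assms by auto
    then show "i \<in> int ` {1..N} \<union> (\<lambda>n. - int n) ` {1..N}"
      using N[OF i] by (cases "0 < i") (auto intro!: image_eqI[of _ _ "nat \<bar>i\<bar>"])
  qed
  then have "(\<Sum>i\<in>F. 1 / (real_of_int i)\<^sup>2) \<le> (\<Sum>i\<in>int ` {1..N} \<union> (\<lambda>n. - int n) ` {1..N}. 1 / (real_of_int i)\<^sup>2)"
    by (intro sum_mono2) auto
  also have "\<dots> \<le> (\<Sum>i\<in>int ` {1..N}. 1 / (real_of_int i)\<^sup>2) + (\<Sum>i\<in>(\<lambda>n. - int n) ` {1..N}. 1 / (real_of_int i)\<^sup>2)"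
    by (subst sum_Un) (auto intro!: sum_nonneg)
  also have "\<dots> = (\<Sum>n\<in>{1..N}. 1 / (real n)\<^sup>2) + (\<Sum>n\<in>{1..N}. 1 / (real n)\<^sup>2)"
    by (subst (1 2) sum.reindex) (auto simp: inj_on_def)
  also have "\<dots> \<le> 4" using nat_bound[of N] by linarith
  finally show ?thesis .
qed

text \<open>
  The bound \<open>exp (- y) \<le> (M / y)\<^sup>M\<close> with \<open>M = 2 / q\<close> turns the summand into a multiple of
  \<open>1 / i\<^sup>2\<close>, and makes the dependence on \<open>c\<close> explicit.
\<close>

lemma sum_exp_powr_int:
  assumes q: "0 < q" and c: "0 < c" and F: "finite F"
  shows "(\<Sum>i\<in>F. exp (- (c * \<bar>real_of_int i\<bar> powr q))) \<le> 1 + 4 * (2 / (c * q)) powr (2 / q)"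
proof -
  have "exp (- (c * \<bar>real_of_int i\<bar> powr q)) \<le> (2 / (c * q)) powr (2 / q) * (1 / (real_of_int i)\<^sup>2)" if "i \<noteq> 0" for i
  proof -
    have i: "0 < \<bar>real_of_int i\<bar>" using that by simp
    have "exp (- (c * \<bar>real_of_int i\<bar> powr q)) \<le> ((2 / q) / (c * \<bar>real_of_int i\<bar> powr q)) powr (2 / q)"
      using q c i by (intro exp_minus_le_powr) auto
    also have "(2 / q) / (c * \<bar>real_of_int i\<bar> powr q) = (2 / (c * q)) / (\<bar>real_of_int i\<bar> powr q)"
      by (simp add: field_simps)
    also have "((2 / (c * q)) / (\<bar>real_of_int i\<bar> powr q)) powr (2 / q) =
        (2 / (c * q)) powr (2 / q) / (\<bar>real_of_int i\<bar> powr q) powr (2 / q)"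
      by (rule powr_divide)
    also have "(\<bar>real_of_int i\<bar> powr q) powr (2 / q) = (real_of_int i)\<^sup>2"
      using q i by (simp add: powr_powr)
    finally show ?thesis by simp
  qed
  then have "(\<Sum>i\<in>F - {0}. exp (- (c * \<bar>real_of_int i\<bar> powr q))) \<le>
      (\<Sum>i\<in>F - {0}. (2 / (c * q)) powr (2 / q) * (1 / (real_of_int i)\<^sup>2))"
    by (intro sum_mono) auto
  also have "\<dots> = (2 / (c * q)) powr (2 / q) * (\<Sum>i\<in>F - {0}. 1 / (real_of_int i)\<^sup>2)"
    by (simp add: sum_distrib_left)
  also have "\<dots> \<le> (2 / (c * q)) powr (2 / q) * 4"
    using F by (intro mult_left_mono sum_inverse_squares_int) auto
  finally have a: "(\<Sum>i\<in>F - {0}. exp (- (c * \<bar>real_of_int i\<bar> powr q))) \<le> (2 / (c * q)) powr (2 / q) * 4" .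
  have "(\<Sum>i\<in>F. exp (- (c * \<bar>real_of_int i\<bar> powr q))) \<le> (\<Sum>i\<in>insert 0 (F - {0}). exp (- (c * \<bar>real_of_int i\<bar> powr q)))"
    using F by (intro sum_mono2) auto
  also have "\<dots> = 1 + (\<Sum>i\<in>F - {0}. exp (- (c * \<bar>real_of_int i\<bar> powr q)))"
    using F by (subst sum.insert) auto
  finally show ?thesis using a by simp
qed

text \<open>
  Half of the exponent is spent on the factor \<open>exp (- c / 2)\<close>, which is available because
  nonzero integers have modulus at least one.
\<close>

lemma sum_exp_powr_int_decay:
  assumes q: "0 < q" and c: "0 < c" and F: "finite F"
  shows "(\<Sum>i\<in>F. exp (- (c * \<bar>real_of_int i\<bar> powr q))) \<le> 1 + exp (- (c / 2)) * (1 + 4 * (4 / (c * q)) powr (2 / q))"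
proof -
  have "exp (- (c * \<bar>real_of_int i\<bar> powr q)) \<le> exp (- (c / 2)) * exp (- ((c / 2) * \<bar>real_of_int i\<bar> powr q))" if "i \<noteq> 0" for i
  proof -
    have "1 \<le> \<bar>real_of_int i\<bar> powr q" using that q by (intro ge_one_powr_ge_zero) auto
    then have "c / 2 * 1 \<le> c / 2 * \<bar>real_of_int i\<bar> powr q" using c by (intro mult_left_mono) auto
    then show ?thesis by (simp add: exp_add[symmetric])
  qed
  then have "(\<Sum>i\<in>F - {0}. exp (- (c * \<bar>real_of_int i\<bar> powr q))) \<le>
      (\<Sum>i\<in>F - {0}. exp (- (c / 2)) * exp (- ((c / 2) * \<bar>real_of_int i\<bar> powr q)))"
    by (intro sum_mono) auto
  also have "\<dots> = exp (- (c / 2)) * (\<Sum>i\<in>F - {0}. exp (- ((c / 2) * \<bar>real_of_int i\<bar> powr q)))"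
    by (simp add: sum_distrib_left)
  also have "\<dots> \<le> exp (- (c / 2)) * (1 + 4 * (2 / ((c / 2) * q)) powr (2 / q))"
    using F c q by (intro mult_left_mono sum_exp_powr_int) auto
  finally have a: "(\<Sum>i\<in>F - {0}. exp (- (c * \<bar>real_of_int i\<bar> powr q))) \<le> exp (- (c / 2)) * (1 + 4 * (4 / (c * q)) powr (2 / q))"
    by simp
  have "(\<Sum>i\<in>F. exp (- (c * \<bar>real_of_int i\<bar> powr q))) \<le> (\<Sum>i\<in>insert 0 (F - {0}). exp (- (c * \<bar>real_of_int i\<bar> powr q)))"
    using F by (intro sum_mono2) auto
  also have "\<dots> = 1 + (\<Sum>i\<in>F - {0}. exp (- (c * \<bar>real_of_int i\<bar> powr q)))"
    using F by (subst sum.insert) auto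
  finally show ?thesis using a by simp
qed

lemma sum_prod_lattice_le:
  fixes g :: "int \<Rightarrow> real"
  assumes F: "finite F" "F \<subseteq> lattice d" and g: "\<And>i. 0 \<le> g i"
    and B: "\<And>G. finite G \<Longrightarrow> sum g G \<le> B"
  shows "(\<Sum>k\<in>F. \<Prod>j<d. g (k j)) \<le> B ^ d"
proof -
  define G where "G = (\<Union>k\<in>F. k ` {..<d})"
  have G: "finite G" unfolding G_def using F by auto
  have "F \<subseteq> {..<d} \<rightarrow>\<^sub>E G"
    using F(2) by (auto simp: G_def PiE_iff)
  then have "(\<Sum>k\<in>F. \<Prod>j<d. g (k j)) \<le> (\<Sum>k\<in>{..<d} \<rightarrow>\<^sub>E G. \<Prod>j<d. g (k j))"
    using G g by (intro sum_mono2 finite_PiE prod_nonneg) auto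
  also have "\<dots> = (\<Prod>j<d. sum g G)"
    using prod_sum_PiE[of "{..<d}" "\<lambda>_. G" "\<lambda>_. g"] G by simp
  also have "\<dots> = sum g G ^ d" by simp
  also have "\<dots> \<le> B ^ d" using G g B by (intro power_mono sum_nonneg) auto
  finally show ?thesis .
qed

definition weight :: "real \<Rightarrow> nat \<Rightarrow> (nat \<Rightarrow> int) \<Rightarrow> real" where
  "weight p d k = (\<Sum>j<d. \<bar>real_of_int (k j)\<bar> powr p)"

text \<open>
  With \<open>\<gamma> = \<alpha> / p\<close> and \<open>b = 2 \<beta>\<close> these are the eigenvalues of the Gevrey kernel. Smaller values of
  \<open>b\<close> occur when part of the exponent is split off.
\<close>

definition eigval :: "real \<Rightarrow> real \<Rightarrow> real \<Rightarrow> nat \<Rightarrow> (nat \<Rightarrow> int) \<Rightarrow> real" where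
  "eigval b p \<gamma> d k = exp (- (b * weight p d k powr \<gamma>))"

lemma weight_nonneg: "0 \<le> weight p d k"
  unfolding weight_def by (intro sum_nonneg) auto

lemma ev_pos: "0 < eigval b p \<gamma> d k"
  unfolding eigval_def by simp

lemma gevrey_eigenvalue:
  assumes "0 < p"
  shows "exp (- 2 * \<beta> * lp_norm d p k powr \<alpha>) = eigval (2 * \<beta>) p (\<alpha> / p) d k"
  unfolding eigval_def lp_norm_def weight_def using assms by (simp add: powr_powr)

lemma component_le_weight:
  assumes "j < d"
  shows "\<bar>real_of_int (k j)\<bar> powr p \<le> weight p d k"
  unfolding weight_def using assms by (intro member_le_sum) auto

text \<open>
  The power \<open>m(k)\<^sup>\<gamma>\<close> dominates each \<open>|k\<^sub>j|\<^bsup>p \<gamma>\<^esup>\<close>, hence their average over \<open>j\<close>, and the average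
  factorises after exponentiation.
\<close>

lemma sum_ev_le_product:
  assumes p: "0 < p" and \<gamma>: "0 < \<gamma>" and b: "0 < b" and d: "1 \<le> d" and F: "finite F" "F \<subseteq> lattice d"
  shows "sum (eigval b p \<gamma> d) F \<le> (1 + 4 * (2 / (b / d * (p * \<gamma>))) powr (2 / (p * \<gamma>))) ^ d"
proof -
  have "sum (eigval b p \<gamma> d) F \<le> (\<Sum>k\<in>F. \<Prod>j<d. exp (- ((b / d) * \<bar>real_of_int (k j)\<bar> powr (p * \<gamma>))))"
  proof (rule sum_mono)
    fix k
    have "\<bar>real_of_int (k j)\<bar> powr (p * \<gamma>) \<le> weight p d k powr \<gamma>" if "j < d" for j
      using component_le_weight[OF that, of k p] \<gamma> by (auto simp: powr_powr[symmetric] intro!: powr_mono2)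
    then have "(\<Sum>j<d. \<bar>real_of_int (k j)\<bar> powr (p * \<gamma>)) \<le> (\<Sum>j<d. weight p d k powr \<gamma>)"
      by (intro sum_mono) auto
    then have "(b / d) * (\<Sum>j<d. \<bar>real_of_int (k j)\<bar> powr (p * \<gamma>)) \<le> (b / d) * (d * weight p d k powr \<gamma>)"
      using b by (intro mult_left_mono) auto
    also have "\<dots> = b * weight p d k powr \<gamma>" using d by simp
    finally show "eigval b p \<gamma> d k \<le> (\<Prod>j<d. exp (- ((b / d) * \<bar>real_of_int (k j)\<bar> powr (p * \<gamma>))))"
      unfolding eigval_def exp_sum[OF finite_lessThan, symmetric] by (simp add: sum_negf sum_distrib_left)
  qed
  also have "\<dots> \<le> (1 + 4 * (2 / (b / d * (p * \<gamma>))) powr (2 / (p * \<gamma>))) ^ d"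
    using p \<gamma> b d by (intro sum_prod_lattice_le F sum_exp_powr_int) auto
  finally show ?thesis .
qed

lemma sum_ev_le_exp:
  assumes p: "0 < p" and \<gamma>: "0 < \<gamma>" and b: "0 < b"
  shows "\<exists>C>0. \<forall>d\<ge>1. \<forall>F. finite F \<longrightarrow> F \<subseteq> lattice d \<longrightarrow> sum (eigval b p \<gamma> d) F \<le> exp (C * (d * (1 + ln d)))"
proof -
  define s where "s = 2 / (p * \<gamma>)"
  define K where "K = 1 + 4 * (2 / (b * (p * \<gamma>))) powr s"
  have s: "0 < s" using p \<gamma> by (simp add: s_def)
  have K: "1 \<le> K" by (simp add: K_def)
  have "sum (eigval b p \<gamma> d) F \<le> exp ((ln K + s) * (d * (1 + ln d)))"
    if d: "1 \<le> d" and F: "finite F" "F \<subseteq> lattice d" for d :: nat and F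
  proof -
    have "(2 / (b / d * (p * \<gamma>))) powr s = (2 / (b * (p * \<gamma>))) powr s * real d powr s"
    proof -
      have "2 / (b / d * (p * \<gamma>)) = (2 / (b * (p * \<gamma>))) * real d" by simp
      then show ?thesis using p \<gamma> b by (simp only: powr_mult)
    qed
    moreover have "1 \<le> real d powr s" using d s by (intro ge_one_powr_ge_zero) auto
    ultimately have "1 + 4 * (2 / (b / d * (p * \<gamma>))) powr s \<le> K * real d powr s"
      by (simp add: K_def ring_distribs)
    moreover have "K * real d powr s = exp (ln K + s * ln d)" using K d by (simp add: exp_add powr_def)
    ultimately have "(1 + 4 * (2 / (b / d * (p * \<gamma>))) powr s) ^ d \<le> exp (ln K + s * ln d) ^ d"
      by (intro power_mono) (auto intro: add_nonneg_nonneg)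
    also have "\<dots> = exp (d * (ln K + s * ln d))" by (rule exp_of_nat_mult[symmetric])
    also have "\<dots> \<le> exp ((ln K + s) * (d * (1 + ln d)))"
    proof -
      have "ln K + s * ln d \<le> (ln K + s) * (1 + ln d)"
        using K s d by (simp add: ring_distribs)
      then have "real d * (ln K + s * ln d) \<le> real d * ((ln K + s) * (1 + ln d))"
        by (intro mult_left_mono) auto
      then show ?thesis by (simp add: mult_ac)
    qed
    finally show ?thesis using sum_ev_le_product[OF p \<gamma> b d F] unfolding s_def[symmetric] by linarith
  qed
  moreover have "0 < ln K + s" using K s by (simp add: add_nonneg_pos)
  ultimately show ?thesis by blast
qed

lemma exp_weight_prod: "exp (- (c * weight p d k)) = (\<Prod>j<d. exp (- (c * \<bar>real_of_int (k j)\<bar> powr p)))"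
  unfolding weight_def exp_sum[OF finite_lessThan, symmetric] by (simp add: sum_negf sum_distrib_left)

text \<open>
  When \<open>c\<close> is at least \<open>2 ln d\<close>, each one-dimensional factor is \<open>1 + O(1 / d)\<close>, so that the
  product stays bounded uniformly in \<open>d\<close>.
\<close>

lemma sum_exp_weight_le:
  assumes p: "0 < p"  and c0: "0 < c0"
  shows "\<exists>K>0. \<forall>d\<ge>1. \<forall>c\<ge>2 * ln (real d) + c0. \<forall>F. finite F \<longrightarrow> F \<subseteq> lattice d \<longrightarrow>
           (\<Sum>k\<in>F. exp (- (c * weight p d k))) \<le> exp K"
proof -
  define K where "K = 1 + 4 * (4 / (c0 * p)) powr (2 / p)"
  have K: "0 < K" unfolding K_def by (intro add_pos_nonneg) auto
  have "(\<Sum>k\<in>F. exp (- (c * weight p d k))) \<le> exp K"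
    if d: "1 \<le> d" and c: "2 * ln (real d) + c0 \<le> c" and F: "finite F" "F \<subseteq> lattice d" for d :: nat and c F
  proof -
    have ld: "0 \<le> ln (real d)" using d by simp
    have cc: "c0 \<le> c" using c ld by linarith
    have cp: "0 < c" using cc c0 by simp
    (* c / 2 \<ge> ln d gives the factor 1 / d *)
    have "exp (- (c / 2)) \<le> exp (- ln (real d))" using c c0 by simp
    also have "\<dots> = 1 / d" using d by (simp add: exp_minus inverse_eq_divide)
    finally have e1: "exp (- (c / 2)) \<le> 1 / d" .
    have e2: "1 + 4 * (4 / (c * p)) powr (2 / p) \<le> K"
      unfolding K_def using p c0 cc by (auto intro!: powr_mono2 divide_left_mono mult_right_mono)
    have "(\<Sum>k\<in>F. exp (- (c * weight p d k))) \<le> (1 + exp (- (c / 2)) * (1 + 4 * (4 / (c * p)) powr (2 / p))) ^ d"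
      unfolding exp_weight_prod
      using p cp by (intro sum_prod_lattice_le F sum_exp_powr_int_decay) auto
    also have "\<dots> \<le> (1 + 1 / d * K) ^ d"
      using e1 e2 by (intro power_mono add_mono mult_mono) (auto intro!: add_nonneg_nonneg mult_nonneg_nonneg)
    also have "\<dots> \<le> exp (K / d) ^ d"
      using K by (intro power_mono) (auto intro!: add_nonneg_nonneg simp: exp_ge_add_one_self)
    also have "\<dots> = exp K" using d by (simp add: exp_of_nat_mult[symmetric])
    finally show ?thesis .
  qed
  with K show ?thesis by blast
qed

text \<open>
  For \<open>\<gamma> > 1\<close> the power \<open>m\<^sup>\<gamma>\<close> lies above the line \<open>c m - c\<^sup>a\<close> with \<open>a = \<gamma> / (\<gamma> - 1)\<close>. The
  linear term factorises; choosing \<open>c\<close> of order \<open>ln d\<close> makes the product bounded, at the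
  cost of the factor \<open>exp (b c\<^sup>a)\<close>.
\<close>

lemma sum_ev_le_polylog:
  assumes p: "0 < p" and \<gamma>: "1 < \<gamma>" and b: "0 < b"
  shows "\<exists>C>0. \<exists>a>0. \<forall>d\<ge>1. \<forall>F. finite F \<longrightarrow> F \<subseteq> lattice d \<longrightarrow> sum (eigval b p \<gamma> d) F \<le> exp (C * (1 + ln d) powr a)"
proof -
  from sum_exp_weight_le[OF p b] obtain K where K: "0 < K"
    and KF: "\<forall>d\<ge>1. \<forall>c\<ge>2 * ln (real d) + b. \<forall>F. finite F \<longrightarrow> F \<subseteq> lattice d \<longrightarrow>
           (\<Sum>k\<in>F. exp (- (c * weight p d k))) \<le> exp K"
    by (elim exE conjE) (rule that)
  define a where "a = \<gamma> / (\<gamma> - 1)"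
  define C1 where "C1 = 2 / b + 1"
  have a: "0 < a" using \<gamma> by (simp add: a_def)
  have C1: "0 < C1" using b by (simp add: C1_def add_pos_pos)
  have lower: "c * m - c powr a \<le> m powr \<gamma>" if c: "0 < c" and m: "0 \<le> m" for c m :: real
  proof (cases "c \<le> m powr (\<gamma> - 1)")
    case True
    show ?thesis
    proof (cases "m = 0")
      case False
      then have "c * m \<le> m powr (\<gamma> - 1) * m powr 1" using True m by (simp add: mult_right_mono)
      also have "\<dots> = m powr \<gamma>" unfolding powr_add[symmetric] by simp
      finally show ?thesis using powr_ge_zero[of c a] by linarith
    qed simp
  next
    case False
    then have "(m powr (\<gamma> - 1)) powr (1 / (\<gamma> - 1)) \<le> c powr (1 / (\<gamma> - 1))"
      using \<gamma> by (intro powr_mono2) auto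
    then have "m \<le> c powr (1 / (\<gamma> - 1))" using \<gamma> m by (simp add: powr_powr)
    then have "c * m \<le> c powr 1 * c powr (1 / (\<gamma> - 1))" using c by (simp add: mult_left_mono)
    also have "\<dots> = c powr a" unfolding powr_add[symmetric] a_def using \<gamma> by (simp add: field_simps)
    finally show ?thesis using powr_ge_zero[of m \<gamma>] by linarith
  qed
  have "sum (eigval b p \<gamma> d) F \<le> exp ((b * C1 powr a + K) * (1 + ln d) powr a)"
    if d: "1 \<le> d" and F: "finite F" "F \<subseteq> lattice d" for d :: nat and F
  proof -
    (* b c = 2 ln d + b is large enough for the product over the coordinates to stay bounded *)
    define c where "c = (2 * ln (real d) + b) / b"
    have ld: "0 \<le> ln (real d)" using d by simp
    have c: "0 < c" unfolding c_def using b ld by (intro divide_pos_pos) linarith+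
    have bc: "b * c = 2 * ln (real d) + b" using b by (simp add: c_def)
    have "c = (2 / b) * ln d + 1" using b by (simp add: c_def field_simps)
    also have "\<dots> \<le> C1 * (1 + ln d)" using b ld by (simp add: C1_def ring_distribs)
    finally have cle: "c \<le> C1 * (1 + ln d)" .
    have "sum (eigval b p \<gamma> d) F \<le> (\<Sum>k\<in>F. exp (b * c powr a) * exp (- ((b * c) * weight p d k)))"
    proof (rule sum_mono)
      fix k
      have "b * (c * weight p d k - c powr a) \<le> b * weight p d k powr \<gamma>"
        using b by (intro mult_left_mono lower c weight_nonneg) auto
      then show "eigval b p \<gamma> d k \<le> exp (b * c powr a) * exp (- ((b * c) * weight p d k))"
        unfolding eigval_def exp_add[symmetric] by (simp add: algebra_simps)
    qed
    also have "\<dots> = exp (b * c powr a) * (\<Sum>k\<in>F. exp (- ((b * c) * weight p d k)))"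
      by (simp add: sum_distrib_left)
    also have "\<dots> \<le> exp (b * c powr a) * exp K"
      using d F bc by (intro mult_left_mono KF[rule_format]) auto
    also have "\<dots> = exp (b * c powr a + K)" by (simp add: exp_add)
    also have "\<dots> \<le> exp ((b * C1 powr a + K) * (1 + ln d) powr a)"
    proof -
      have "c powr a \<le> (C1 * (1 + ln d)) powr a" using c cle a by (intro powr_mono2) auto
      also have "\<dots> = C1 powr a * (1 + ln d) powr a" using C1 ld by (simp add: powr_mult)
      finally have "b * c powr a \<le> b * (C1 powr a * (1 + ln d) powr a)" using b by (intro mult_left_mono) auto
      moreover have "K * 1 \<le> K * (1 + ln d) powr a"
        using K a ld by (intro mult_left_mono ge_one_powr_ge_zero) auto
      ultimately show ?thesis by (simp add: ring_distribs)
    qed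
    finally show ?thesis .
  qed
  moreover have "0 < b * C1 powr a + K" using b K by (intro add_nonneg_pos) auto
  ultimately show ?thesis using a by blast
qed

text \<open>
  Exponential Chebyshev (Rankin) bound with the parameter \<open>c = 2 ln d + 1\<close>.
\<close>

lemma card_weight_le:
  assumes p: "0 < p"
  shows "\<exists>K>0. \<forall>d\<ge>1. \<forall>R F. finite F \<longrightarrow> F \<subseteq> lattice d \<longrightarrow> (\<forall>k\<in>F. weight p d k \<le> R) \<longrightarrow>
           real (card F) \<le> exp ((2 * ln (real d) + 1) * R + K)"
proof -
  from sum_exp_weight_le[OF p zero_less_one] obtain K where K: "0 < K"
    and KF: "\<forall>d\<ge>1. \<forall>c\<ge>2 * ln (real d) + 1. \<forall>F. finite F \<longrightarrow> F \<subseteq> lattice d \<longrightarrow>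
           (\<Sum>k\<in>F. exp (- (c * weight p d k))) \<le> exp K"
    by (elim exE conjE) (rule that)
  have "real (card F) \<le> exp ((2 * ln (real d) + 1) * R + K)"
    if d: "1 \<le> d" and F: "finite F" "F \<subseteq> lattice d" and R: "\<And>k. k \<in> F \<Longrightarrow> weight p d k \<le> R" for d :: nat and R F
  proof -
    define c where "c = 2 * ln (real d) + 1"
    have c: "0 \<le> c" using d by (simp add: c_def)
    have "real (card F) * exp (- (c * R)) = (\<Sum>k\<in>F. exp (- (c * R)))" by simp
    also have "\<dots> \<le> (\<Sum>k\<in>F. exp (- (c * weight p d k)))"
      using R c by (intro sum_mono) (auto intro!: mult_left_mono)
    also have "\<dots> \<le> exp K" using d F by (intro KF[rule_format]) (auto simp: c_def)
    finally have "real (card F) * exp (- (c * R)) * exp (c * R) \<le> exp K * exp (c * R)"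
      by (intro mult_right_mono) auto
    then show ?thesis unfolding c_def[symmetric] by (simp add: mult.assoc exp_add[symmetric] add.commute)
  qed
  with K show ?thesis by (intro exI[of _ K] conjI allI impI) simp_all
qed

lemma ev_summable:
  assumes "0 < p" "0 < \<gamma>" "0 < b" "1 \<le> d"
  shows "eigval b p \<gamma> d summable_on lattice d"
proof (rule nonneg_bdd_above_summable_on)
  show "bdd_above (sum (eigval b p \<gamma> d) ` {F. F \<subseteq> lattice d \<and> finite F})"
    using sum_ev_le_product[OF assms]
    by (intro bdd_aboveI[of _ "(1 + 4 * (2 / (b / d * (p * \<gamma>))) powr (2 / (p * \<gamma>))) ^ d"]) auto
qed (simp add: ev_pos less_imp_le)

definition ev_total :: "real \<Rightarrow> real \<Rightarrow> real \<Rightarrow> nat \<Rightarrow> real" where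
  "ev_total b p \<gamma> d = (\<Sum>\<^sub>\<infinity>k\<in>lattice d. eigval b p \<gamma> d k)"

lemma ev_total_le:
  assumes "0 < p" "0 < \<gamma>" "0 < b" "1 \<le> d"
    and "\<And>F. finite F \<Longrightarrow> F \<subseteq> lattice d \<Longrightarrow> sum (eigval b p \<gamma> d) F \<le> B"
  shows "ev_total b p \<gamma> d \<le> B"
  unfolding ev_total_def using assms by (intro infsum_le_finite_sums ev_summable) auto

lemma sum_le_ev_total:
  assumes "0 < p" "0 < \<gamma>" "0 < b" "1 \<le> d" "finite F" "F \<subseteq> lattice d"
  shows "sum (eigval b p \<gamma> d) F \<le> ev_total b p \<gamma> d"
  unfolding ev_total_def using assms by (intro finite_sum_le_infsum ev_summable) (auto simp: ev_pos less_imp_le)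

lemma one_le_ev_total:
  assumes "0 < p" "0 < \<gamma>" "0 < b" "1 \<le> d"
  shows "1 \<le> ev_total b p \<gamma> d"
proof -
  have "sum (eigval b p \<gamma> d) {\<lambda>j\<in>{..<d}. 0} \<le> ev_total b p \<gamma> d" by (rule sum_le_ev_total) (use assms in auto)
  then show ?thesis using assms by (simp add: eigval_def weight_def)
qed

text \<open>
  Half of the exponent provides the decay, and the other half keeps the series summable.
\<close>

lemma ev_tail_le:
  assumes p: "0 < p" and \<gamma>: "0 < \<gamma>" and b: "0 < b" and d: "1 \<le> d" and S: "finite S" "S \<subseteq> lattice d"
    and Q: "\<And>k. k \<in> lattice d - S \<Longrightarrow> Q \<le> weight p d k powr \<gamma>"
  shows "ev_total (2 * b) p \<gamma> d - sum (eigval (2 * b) p \<gamma> d) S \<le> exp (- (b * Q)) * ev_total b p \<gamma> d"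
proof -
  have b2: "0 < 2 * b" using b by simp
  note sm = ev_summable[OF p \<gamma> b d] and sm2 = ev_summable[OF p \<gamma> b2 d]
  have "(eigval (2 * b) p \<gamma> d has_sum (ev_total (2 * b) p \<gamma> d - sum (eigval (2 * b) p \<gamma> d) S)) (lattice d - S)"
    unfolding ev_total_def using S by (intro has_sum_Diff has_sum_infsum sm2 has_sum_finite)
  moreover have "((\<lambda>k. exp (- (b * Q)) * eigval b p \<gamma> d k) has_sum
      exp (- (b * Q)) * (ev_total b p \<gamma> d - sum (eigval b p \<gamma> d) S)) (lattice d - S)"
    unfolding ev_total_def using S by (intro has_sum_cmult_right has_sum_Diff has_sum_infsum sm has_sum_finite)
  moreover have "eigval (2 * b) p \<gamma> d k \<le> exp (- (b * Q)) * eigval b p \<gamma> d k" if "k \<in> lattice d - S" for k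
  proof -
    have "b * Q \<le> b * weight p d k powr \<gamma>" using Q[OF that] b by (intro mult_left_mono) auto
    then show ?thesis unfolding eigval_def exp_add[symmetric] by simp
  qed
  ultimately have "ev_total (2 * b) p \<gamma> d - sum (eigval (2 * b) p \<gamma> d) S \<le> exp (- (b * Q)) * (ev_total b p \<gamma> d - sum (eigval b p \<gamma> d) S)"
    by (rule has_sum_mono)
  also have "\<dots> \<le> exp (- (b * Q)) * ev_total b p \<gamma> d"
    by (intro mult_left_mono) (auto intro!: sum_nonneg simp: ev_pos less_imp_le)
  finally show ?thesis .
qed

definition lattice_box :: "nat \<Rightarrow> nat \<Rightarrow> (nat \<Rightarrow> int) set" where
  "lattice_box r d = {..<d} \<rightarrow>\<^sub>E {- int r..int r}"

lemma lattice_box_simps: "finite (lattice_box r d)" "lattice_box r d \<subseteq> lattice d" "card (lattice_box r d) = (2 * r + 1) ^ d"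
  unfolding lattice_box_def by (auto intro!: finite_PiE simp: card_PiE nat_add_distrib nat_mult_distrib)

lemma weight_outside_box:
  assumes "k \<in> lattice d - lattice_box r d" and p: "0 < p" and \<gamma>: "0 < \<gamma>"
  shows "real (Suc r) powr (p * \<gamma>) \<le> weight p d k powr \<gamma>"
proof -
  obtain j where j: "j < d" "\<not> (- int r \<le> k j \<and> k j \<le> int r)"
    using assms(1) by (auto simp: lattice_box_def PiE_iff)
  then have "real (Suc r) \<le> \<bar>real_of_int (k j)\<bar>" by linarith
  then have "real (Suc r) powr p \<le> \<bar>real_of_int (k j)\<bar> powr p" using p by (intro powr_mono2) auto
  also have "\<dots> \<le> weight p d k" by (rule component_le_weight[OF j(1)])
  finally have "(real (Suc r) powr p) powr \<gamma> \<le> weight p d k powr \<gamma>" using \<gamma> by (intro powr_mono2) auto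
  then show ?thesis by (simp add: powr_powr)
qed

lemma weight_inside_box:
  assumes k: "k \<in> lattice_box r d" and p: "0 < p" and \<gamma>: "0 < \<gamma>"
  shows "weight p d k powr \<gamma> \<le> real d powr \<gamma> * real r powr (p * \<gamma>)"
proof -
  have "\<bar>real_of_int (k j)\<bar> powr p \<le> real r powr p" if "j < d" for j
  proof -
    have "k j \<in> {- int r..int r}"
      by (rule PiE_mem[OF k[unfolded lattice_box_def]]) (use that in simp)
    then have "\<bar>real_of_int (k j)\<bar> \<le> real r" unfolding atLeastAtMost_iff by linarith
    then show ?thesis using p by (intro powr_mono2) auto
  qed
  then have "weight p d k \<le> (\<Sum>j<d. real r powr p)" unfolding weight_def by (intro sum_mono) auto
  then have "weight p d k powr \<gamma> \<le> (real d * real r powr p) powr \<gamma>"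
    using \<gamma> weight_nonneg by (intro powr_mono2) auto
  then show ?thesis by (simp add: powr_mult powr_powr)
qed

text \<open>
  For \<open>\<gamma> \<le> 1\<close> one has \<open>m\<^sup>\<gamma> \<le> m\<close>, since \<open>m\<close> is zero or at least one on lattice points. The
  points of \<open>{-1,0,1}\<^sup>d\<close> then contribute a product.
\<close>

lemma ev_total_exponential:
  assumes p: "0 < p" and \<gamma>: "0 < \<gamma>" "\<gamma> \<le> 1" and b: "0 < b" and d: "1 \<le> d"
  shows "(1 + 2 * exp (- b)) ^ d \<le> ev_total b p \<gamma> d"
proof -
  have "{- int 1..int 1} = {-1, 0, 1}" by auto
  then have "1 + 2 * exp (- b) = (\<Sum>i\<in>{- int 1..int 1}. exp (- (b * \<bar>real_of_int i\<bar> powr p)))"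
    using p by simp
  then have "(1 + 2 * exp (- b)) ^ d = (\<Prod>j<d. \<Sum>i\<in>{- int 1..int 1}. exp (- (b * \<bar>real_of_int i\<bar> powr p)))"
    by simp
  also have "\<dots> = (\<Sum>k\<in>lattice_box 1 d. \<Prod>j<d. exp (- (b * \<bar>real_of_int (k j)\<bar> powr p)))"
    unfolding lattice_box_def by (rule prod_sum_PiE) auto
  also have "\<dots> \<le> sum (eigval b p \<gamma> d) (lattice_box 1 d)"
  proof (rule sum_mono)
    fix k
    have "weight p d k powr \<gamma> \<le> weight p d k"
    proof (cases "\<exists>j<d. k j \<noteq> 0")
      case True
      then obtain j where j: "j < d" "k j \<noteq> 0" by auto
      have "1 \<le> \<bar>real_of_int (k j)\<bar> powr p" using j p by (intro ge_one_powr_ge_zero) auto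
      also have "\<dots> \<le> weight p d k" by (rule component_le_weight[OF j(1)])
      finally show ?thesis using powr_mono[of \<gamma> 1 "weight p d k"] \<gamma> by simp
    next
      case False
      then show ?thesis using p \<gamma> by (simp add: weight_def)
    qed
    then have "b * weight p d k powr \<gamma> \<le> b * weight p d k" using b by (intro mult_left_mono) auto
    then show "(\<Prod>j<d. exp (- (b * \<bar>real_of_int (k j)\<bar> powr p))) \<le> eigval b p \<gamma> d k"
      unfolding exp_weight_prod[symmetric] eigval_def by simp
  qed
  also have "\<dots> \<le> ev_total b p \<gamma> d"
    by (rule sum_le_ev_total) (use assms lattice_box_simps in auto)
  finally show ?thesis .
qed

section \<open>Average case errors and information complexity\<close>

locale gevrey_problem =
  fixes \<alpha> \<beta> p :: real and \<mu> :: "nat \<Rightarrow> cfun measure"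
  assumes alpha: "0 < \<alpha>" and beta: "0 < \<beta>" and p: "0 < p"
    and gaussian: "\<And>d. 1 \<le> d \<Longrightarrow> gaussian_measure d (\<mu> d)"
    and mean: "\<And>d. 1 \<le> d \<Longrightarrow> zero_mean d (\<mu> d)"
    and covariance: "\<And>d. 1 \<le> d \<Longrightarrow> has_covariance_kernel d (\<mu> d) (gevrey_kernel d \<alpha> \<beta> p)"
begin

abbreviation \<gamma> where "\<gamma> \<equiv> \<alpha> / p"

abbreviation lam where "lam \<equiv> eigval (2 * \<beta>) p \<gamma>"

abbreviation total where "total \<equiv> ev_total (2 * \<beta>) p \<gamma>"

abbreviation total' where "total' \<equiv> ev_total \<beta> p \<gamma>"

lemma gamma: "0 < \<gamma>" using alpha p by simp

lemma p_gamma: "p * \<gamma> = \<alpha>" using p by simp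

lemma beta2: "0 < 2 * \<beta>" using beta by simp

lemma one_le_total: "1 \<le> d \<Longrightarrow> 1 \<le> total d"
  by (rule one_le_ev_total[OF p gamma beta2])

lemma one_le_total': "1 \<le> d \<Longrightarrow> 1 \<le> total' d"
  by (rule one_le_ev_total[OF p gamma beta])

lemma field:
  assumes d: "1 \<le> d"
  shows "torus_field d (\<mu> d) (lam d)"
proof
  show "gaussian_measure d (\<mu> d)" "zero_mean d (\<mu> d)" using gaussian mean d by auto
  show "has_covariance_kernel d (\<mu> d) (\<lambda>x y. \<Sum>\<^sub>\<infinity>k\<in>lattice d.
        complex_of_real (lam d k) * exp (\<i> * complex_of_real (\<Sum>j<d. real_of_int (k j) * (x j - y j))))"
    using covariance[OF d] unfolding gevrey_kernel_def[abs_def] gevrey_eigenvalue[OF p] .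
  show "0 \<le> lam d k" for k by (rule less_imp_le[OF ev_pos])
  show "lam d summable_on lattice d" by (rule ev_summable[OF p gamma beta2 d])
  show "lam d (\<lambda>j\<in>{..<d}. - k j) = lam d k" for k
    unfolding eigval_def weight_def by simp
qed

lemma trace_eq:
  assumes d: "1 \<le> d"
  shows "torus_field.trace d (lam d) = total d"
  unfolding torus_field.trace_def[OF field[OF d]] ev_total_def ..

lemma error_upper:
  assumes d: "1 \<le> d" and S: "finite S" "S \<subseteq> lattice d" "card S \<le> n"
  shows "avg_error \<mu> n d \<le> ennreal (sqrt (total d - sum (lam d) S))"
proof -
  interpret torus_field d "\<mu> d" "lam d" by (rule field[OF d])
  have "avg_error \<mu> n d \<le> alg_error d (\<mu> d) (\<lambda>f x. \<Sum>k\<in>S. coef d k f * hartley d k x)"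
    unfolding avg_error_def by (rule INF_lower) (rule projection_algorithm[OF S])
  then show ?thesis unfolding projection_error[OF S(1,2)] trace_eq[OF d] .
qed

lemma error_lower:
  assumes d: "1 \<le> d" and J: "finite J" "J \<subseteq> lattice d"
    and q: "\<And>k. k \<in> J \<Longrightarrow> 0 \<le> q k" "\<And>k. k \<in> J \<Longrightarrow> q k \<le> 1" "\<And>k. k \<in> J \<Longrightarrow> q k * lam d k \<le> \<delta>"
    and \<delta>: "0 < \<delta>"
  shows "ennreal (sqrt ((\<Sum>k\<in>J. q k * lam d k) - real n * \<delta>)) \<le> avg_error \<mu> n d"
proof -
  interpret torus_field d "\<mu> d" "lam d" by (rule field[OF d])
  show ?thesis unfolding avg_error_def
    by (rule INF_greatest) (rule algorithm_lower_bound[OF _ J q \<delta>])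
qed

lemma initial_error:
  assumes d: "1 \<le> d"
  shows "avg_error \<mu> 0 d = ennreal (sqrt (total d))"
proof -
  interpret torus_field d "\<mu> d" "lam d" by (rule field[OF d])
  show ?thesis
    unfolding avg_error_def using projection_error[of "{}"] by (simp add: algorithms_def trace_eq[OF d])
qed

lemma error_upper_tail:
  assumes d: "1 \<le> d" and S: "finite S" "S \<subseteq> lattice d" "card S \<le> n"
    and Q: "\<And>k. k \<in> lattice d - S \<Longrightarrow> Q \<le> weight p d k powr \<gamma>"
  shows "avg_error \<mu> n d \<le> ennreal (sqrt (total' d) * exp (- (\<beta> * Q / 2)))"
proof -
  have "total d - sum (lam d) S \<le> exp (- (\<beta> * Q)) * total' d"
    by (rule ev_tail_le[OF p gamma beta d S(1,2) Q])
  then have "sqrt (total d - sum (lam d) S) \<le> sqrt (exp (- (\<beta> * Q)) * total' d)" by simp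
  also have "exp (- (\<beta> * Q)) = (exp (- (\<beta> * Q / 2)))\<^sup>2" by (simp add: power2_eq_square exp_add[symmetric])
  finally have "sqrt (total d - sum (lam d) S) \<le> sqrt (total' d) * exp (- (\<beta> * Q / 2))"
    by (simp add: real_sqrt_mult mult.commute)
  then show ?thesis by (intro order_trans[OF error_upper[OF d S]] ennreal_leI)
qed

text \<open>
  Every eigenvalue of the box is cut down to the common level \<open>\<delta>\<close>. If \<open>n\<close> is less than the number of
  points, at least one \<open>\<delta>\<close> remains.
\<close>

lemma error_lower_box:
  assumes d: "1 \<le> d" and n: "n < (2 * r + 1) ^ d"
  shows "ennreal (exp (- (\<beta> * (real d powr \<gamma> * real r powr \<alpha>)))) \<le> avg_error \<mu> n d"
proof -
  define y where "y = real d powr \<gamma> * real r powr \<alpha>"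
  define \<delta> where "\<delta> = exp (- (2 * \<beta> * y))"
  have \<delta>: "0 < \<delta>" by (simp add: \<delta>_def)
  (* hence the weights \<delta> / lam below are at most one *)
  have ge: "\<delta> \<le> lam d k" if "k \<in> lattice_box r d" for k
  proof -
    have "weight p d k powr \<gamma> \<le> y"
      using weight_inside_box[OF that p gamma] p_gamma by (simp add: y_def)
    then show ?thesis unfolding \<delta>_def eigval_def using beta by simp
  qed
  have "\<delta> = 1 * \<delta>" by simp
  also have "\<dots> \<le> (real ((2 * r + 1) ^ d) - real n) * \<delta>"
  proof (rule mult_right_mono)
    have "real (Suc n) \<le> real ((2 * r + 1) ^ d)" using n by (simp only: of_nat_le_iff Suc_le_eq)
    then show "1 \<le> real ((2 * r + 1) ^ d) - real n" by simp
  qed (use \<delta> in simp)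
  also have "\<dots> = (\<Sum>k\<in>lattice_box r d. \<delta> / lam d k * lam d k) - real n * \<delta>"
  proof -
    have "(\<Sum>k\<in>lattice_box r d. \<delta> / lam d k * lam d k) = (\<Sum>k\<in>lattice_box r d. \<delta>)"
      by (intro sum.cong refl) (simp add: ev_pos less_imp_neq[symmetric])
    then show ?thesis using lattice_box_simps(3)[of r d] by (simp only: sum_constant left_diff_distrib)
  qed
  finally have "sqrt \<delta> \<le> sqrt ((\<Sum>k\<in>lattice_box r d. \<delta> / lam d k * lam d k) - real n * \<delta>)" by simp
  moreover have "sqrt \<delta> = exp (- (\<beta> * y))"
    unfolding \<delta>_def by (rule real_sqrt_unique) (simp_all add: power2_eq_square exp_add[symmetric])
  moreover have "ennreal (sqrt ((\<Sum>k\<in>lattice_box r d. \<delta> / lam d k * lam d k) - real n * \<delta>)) \<le> avg_error \<mu> n d"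
  proof (rule error_lower[OF d lattice_box_simps(1,2) _ _ _ \<delta>])
    fix k assume k: "k \<in> lattice_box r d"
    have l: "0 < lam d k" by (rule ev_pos)
    show "0 \<le> \<delta> / lam d k" using l \<delta> by simp
    show "\<delta> / lam d k \<le> 1" using l ge[OF k] by simp
    show "\<delta> / lam d k * lam d k \<le> \<delta>" using l by simp
  qed
  ultimately show ?thesis
    unfolding y_def[symmetric] by (metis ennreal_leI order_trans)
qed

text \<open>
  All eigenvalues are at most one, so each functional removes at most one unit of the total variance.
  The finite partial sums exhaust the total only in the limit.
\<close>

lemma error_lower_total:
  assumes d: "1 \<le> d"
  shows "ennreal (sqrt (total d - real n)) \<le> avg_error \<mu> n d"
proof -
  interpret torus_field d "\<mu> d" "lam d" by (rule field[OF d])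
  have le1: "lam d k \<le> 1" for k unfolding eigval_def using beta by simp
  have bound: "ennreal (sqrt (total d - real n - e)) \<le> avg_error \<mu> n d" if e: "0 < e" for e
  proof -
    from trace_approx[OF e] obtain S where S: "finite S" "S \<subseteq> lattice d" "trace - sum (lam d) S < e" .
    have "ennreal (sqrt ((\<Sum>k\<in>S. 1 * lam d k) - real n * 1)) \<le> avg_error \<mu> n d"
      by (rule error_lower[OF d S(1,2)]) (simp_all add: le1)
    moreover have "total d - real n - e \<le> (\<Sum>k\<in>S. 1 * lam d k) - real n * 1"
      using S(3) by (simp add: trace_eq[OF d])
    ultimately show ?thesis
      by (meson ennreal_leI order_trans real_sqrt_le_mono)
  qed
  have "((\<lambda>i. ennreal (sqrt (total d - real n - 1 / real (Suc i)))) \<longlongrightarrow> ennreal (sqrt (total d - real n - 0))) sequentially"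
    by (intro tendsto_ennrealI tendsto_real_sqrt tendsto_diff tendsto_const LIMSEQ_Suc[OF lim_1_over_n])
  then have "ennreal (sqrt (total d - real n - 0)) \<le> avg_error \<mu> n d"
    by (rule LIMSEQ_le_const2) (auto intro!: bound)
  then show ?thesis by simp
qed

text \<open>
  These two inequalities reduce both error criteria to the extreme cases.
\<close>

lemma CRI_bounds:
  assumes d: "1 \<le> d"
  shows "1 \<le> CRI crit \<mu> d" "CRI crit \<mu> d \<le> ennreal (sqrt (total d))"
proof -
  have "1 \<le> ennreal (sqrt (total d))" using one_le_total[OF d] by simp
  then show "1 \<le> CRI crit \<mu> d" "CRI crit \<mu> d \<le> ennreal (sqrt (total d))"
    using initial_error[OF d] by (cases crit; simp)+
qed

lemma ln_le_of_le_exp: "0 < x \<Longrightarrow> x \<le> exp y \<Longrightarrow> ln x \<le> (y::real)"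
  using ln_le_cancel_iff[of x "exp y"] by simp

text \<open>
  The level \<open>Q\<close> is the one at which the bound on the tail equals \<open>\<epsilon>\<close>.
\<close>

lemma info_upper:
  assumes d: "1 \<le> d" and S: "finite S" "S \<subseteq> lattice d"
    and Q: "\<And>k. k \<in> lattice d - S \<Longrightarrow> Q \<le> weight p d k powr \<gamma>"
    and \<epsilon>: "0 < \<epsilon>" and QQ: "Q = (ln (total' d) + 2 * ln (1 / \<epsilon>)) / \<beta>"
  shows "info_complexity crit \<mu> \<epsilon> d \<le> enat (card S)"
proof -
  have t: "0 < total' d" using one_le_total'[OF d] by simp
  have "- (\<beta> * Q / 2) = - (ln (total' d) / 2) + ln \<epsilon>"
    using QQ beta \<epsilon> by (simp add: ln_div field_simps)
  then have "exp (- (\<beta> * Q / 2)) = exp (- (ln (total' d) / 2)) * exp (ln \<epsilon>)"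
    by (simp only: exp_add)
  also have "exp (- (ln (total' d) / 2)) = 1 / sqrt (total' d)"
    using t by (simp add: exp_minus ln_sqrt[symmetric] inverse_eq_divide)
  finally have "sqrt (total' d) * exp (- (\<beta> * Q / 2)) = \<epsilon>" using t \<epsilon> by simp
  then have "avg_error \<mu> (card S) d \<le> ennreal \<epsilon>"
    using error_upper_tail[OF d S order_refl Q] by simp
  also have "\<dots> \<le> ennreal \<epsilon> * CRI crit \<mu> d"
    using mult_left_mono[OF CRI_bounds(1)[OF d, of crit], of "ennreal \<epsilon>"] by simp
  finally show ?thesis unfolding info_complexity_def by (intro INF_lower) simp
qed

lemma info_attained:
  assumes d: "1 \<le> d" and \<epsilon>: "0 < \<epsilon>" and m: "info_complexity crit \<mu> \<epsilon> d = enat m"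
  shows "avg_error \<mu> m d \<le> ennreal (\<epsilon> * sqrt (total d))"
proof -
  let ?A = "{n. avg_error \<mu> n d \<le> ennreal \<epsilon> * CRI crit \<mu> d}"
  have "enat ` ?A \<noteq> {}"
  proof
    assume "enat ` ?A = {}"
    then have "info_complexity crit \<mu> \<epsilon> d = Inf {}" unfolding info_complexity_def by (simp only:)
    then show False using m by (simp add: top_enat_def)
  qed
  then obtain z where "z \<in> enat ` ?A" by blast
  then have "Inf (enat ` ?A) \<in> enat ` ?A" by (rule wellorder_InfI)
  then have "m \<in> ?A" using m unfolding info_complexity_def by auto
  then have "avg_error \<mu> m d \<le> ennreal \<epsilon> * CRI crit \<mu> d" by simp
  also have "\<dots> \<le> ennreal \<epsilon> * ennreal (sqrt (total d))"
    by (intro mult_left_mono CRI_bounds d) simp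
  also have "\<dots> = ennreal (\<epsilon> * sqrt (total d))"
    using \<epsilon> one_le_total[OF d] by (simp add: ennreal_mult)
  finally show ?thesis .
qed

lemma info_pos:
  assumes d: "1 \<le> d" and \<epsilon>: "0 < \<epsilon>" "\<epsilon> < 1" and m: "info_complexity crit \<mu> \<epsilon> d = enat m"
  shows "1 \<le> m"
proof (rule ccontr)
  assume "\<not> 1 \<le> m"
  then have "m = 0" by simp
  then have "ennreal (sqrt (total d)) \<le> ennreal (\<epsilon> * sqrt (total d))"
    using info_attained[OF d \<epsilon>(1) m] initial_error[OF d] by simp
  then have "sqrt (total d) \<le> \<epsilon> * sqrt (total d)"
    using \<epsilon> one_le_total[OF d] by (subst (asm) ennreal_le_iff) auto
  then show False using \<epsilon> one_le_total[OF d] by simp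
qed

text \<open>
  The complexity is bounded by the number of points of a box of radius about \<open>Q\<^bsup>1/\<alpha>\<^esup>\<close>, where
  \<open>Q\<close> is polynomial in \<open>d\<close> and \<open>ln (1/\<epsilon>)\<close>.
\<close>

lemma info_bound_general:
  "\<exists>C>0. \<forall>\<epsilon>\<in>{0<..<1}. \<forall>d\<ge>1. \<exists>m. info_complexity crit \<mu> \<epsilon> d = enat m \<and> 1 \<le> m \<and>
      ln (real m) \<le> C * (real d * (1 + ln (real d) + ln (1 + ln (1 / \<epsilon>))))"
proof -
  from sum_ev_le_exp[OF p gamma beta] obtain C where C: "0 < C"
    and CF: "\<forall>d\<ge>1. \<forall>F. finite F \<longrightarrow> F \<subseteq> lattice d \<longrightarrow> sum (eigval \<beta> p \<gamma> d) F \<le> exp (C * (d * (1 + ln d)))"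
    by (elim exE conjE) (rule that)
  define K where "K = max 1 ((C + 2) / \<beta>)"
  define A where "A = ln 5 + ln K / \<alpha> + 2 / \<alpha>"
  have K1: "1 \<le> K" by (simp add: K_def)
  have lnK: "0 \<le> ln K" using K1 by simp
  have A: "0 < A" unfolding A_def using alpha lnK by (intro add_pos_pos add_pos_nonneg) auto
  have "\<exists>m. info_complexity crit \<mu> \<epsilon> d = enat m \<and> 1 \<le> m \<and>
      ln (real m) \<le> A * (real d * (1 + ln (real d) + ln (1 + ln (1 / \<epsilon>))))"
    if \<epsilon>: "0 < \<epsilon>" "\<epsilon> < 1" and d: "1 \<le> d" for \<epsilon> :: real and d :: nat
  proof -
    define x where "x = 1 + ln (1 / \<epsilon>)"
    have x: "1 \<le> x" unfolding x_def using \<epsilon> by simp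
    define Q where "Q = (ln (total' d) + 2 * ln (1 / \<epsilon>)) / \<beta>"
    have t: "1 \<le> total' d" by (rule one_le_total'[OF d])
    have Q0: "0 \<le> Q" unfolding Q_def using t beta \<epsilon> by simp
    have ld: "0 \<le> ln (real d)" using d by simp
    have "1 + ln (real d) \<le> real d" using ln_le_minus_one[of "real d"] d by simp
    then have dd: "real d * (1 + ln (real d)) \<le> (real d)\<^sup>2"
      unfolding power2_eq_square by (intro mult_left_mono) auto
    have "total' d \<le> exp (C * (d * (1 + ln d)))"
      using CF d by (intro ev_total_le[OF p gamma beta d]) auto
    then have "ln (total' d) \<le> C * (d * (1 + ln d))" using t by (simp add: ln_le_of_le_exp)
    also have "\<dots> \<le> C * (real d)\<^sup>2" using C dd by (intro mult_left_mono) auto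
    also have "\<dots> \<le> C * ((real d)\<^sup>2 * x)" using C x by (intro mult_left_mono) (auto simp: mult_le_cancel_left1)
    finally have l1: "ln (total' d) \<le> C * ((real d)\<^sup>2 * x)" .
    have "ln (1 / \<epsilon>) \<le> x" by (simp add: x_def)
    also have "1 * x \<le> (real d)\<^sup>2 * x" using d x by (intro mult_right_mono) auto
    finally have l2: "ln (1 / \<epsilon>) \<le> (real d)\<^sup>2 * x" by simp
    have "Q \<le> (C + 2) / \<beta> * ((real d)\<^sup>2 * x)"
    proof -
      have "ln (total' d) + 2 * ln (1 / \<epsilon>) \<le> (C + 2) * ((real d)\<^sup>2 * x)"
        using l1 l2 by (simp add: ring_distribs)
      then show ?thesis unfolding Q_def using beta by (simp add: divide_right_mono)
    qed
    also have "\<dots> \<le> K * ((real d)\<^sup>2 * x)" using x by (intro mult_right_mono) (auto simp: K_def)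
    finally have QK: "Q \<le> K * ((real d)\<^sup>2 * x)" .
    (* W \<ge> 1 bounds Q, and then 2 r + 1 \<le> 2 Q powr (1/\<alpha>) + 3 \<le> 5 W powr (1/\<alpha>) *)
    define W where "W = K * ((real d)\<^sup>2 * x)"
    have W1: "1 \<le> W"
    proof -
      have "1 * (1 * 1) \<le> K * ((real d)\<^sup>2 * x)" using K1 d x by (intro mult_mono) auto
      then show ?thesis by (simp add: W_def)
    qed
    define r where "r = nat \<lceil>Q powr (1 / \<alpha>)\<rceil>"
    have r1: "Q powr (1 / \<alpha>) \<le> real (Suc r)" unfolding r_def by linarith
    have r2: "real r \<le> Q powr (1 / \<alpha>) + 1" unfolding r_def by (simp add: of_nat_nat)
    have out: "Q \<le> weight p d k powr \<gamma>" if "k \<in> lattice d - lattice_box r d" for k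
    proof -
      have "Q = (Q powr (1 / \<alpha>)) powr \<alpha>" using Q0 alpha by (simp add: powr_powr)
      also have "\<dots> \<le> real (Suc r) powr \<alpha>" using r1 alpha by (intro powr_mono2) auto
      also have "\<dots> \<le> weight p d k powr \<gamma>" using weight_outside_box[OF that p gamma] p_gamma by simp
      finally show ?thesis .
    qed
    have "info_complexity crit \<mu> \<epsilon> d \<le> enat (card (lattice_box r d))"
      by (rule info_upper[OF d lattice_box_simps(1,2) out \<epsilon>(1) Q_def])
    then obtain m where m: "info_complexity crit \<mu> \<epsilon> d = enat m" and mle: "m \<le> (2 * r + 1) ^ d"
      by (cases "info_complexity crit \<mu> \<epsilon> d") (auto simp: lattice_box_simps(3))
    have m1: "1 \<le> m" by (rule info_pos[OF d \<epsilon> m])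
    have "real m \<le> real ((2 * r + 1) ^ d)" using mle by (simp only: of_nat_le_iff)
    then have "ln (real m) \<le> ln (real (2 * r + 1) ^ d)" using m1 by (subst ln_le_cancel_iff) auto
    also have "\<dots> = real d * ln (real (2 * r + 1))" by (rule ln_realpow)
    also have "\<dots> \<le> real d * ln (5 * W powr (1 / \<alpha>))"
    proof (intro mult_left_mono)
      have "Q powr (1 / \<alpha>) \<le> W powr (1 / \<alpha>)" using Q0 QK alpha by (intro powr_mono2) (auto simp: W_def)
      moreover have "1 \<le> W powr (1 / \<alpha>)" using W1 alpha by (intro ge_one_powr_ge_zero) auto
      ultimately have "real (2 * r + 1) \<le> 5 * W powr (1 / \<alpha>)" using r2 by simp
      then show "ln (real (2 * r + 1)) \<le> ln (5 * W powr (1 / \<alpha>))" by (subst ln_le_cancel_iff) auto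
    qed simp
    also have "ln (5 * W powr (1 / \<alpha>)) = ln 5 + (ln K + (2 * ln (real d) + ln x)) / \<alpha>"
      using W1 K1 d x unfolding W_def by (simp add: ln_mult ln_powr ln_realpow)
    also have "\<dots> \<le> A * (1 + ln (real d) + ln x)"
    proof -
      have lx: "0 \<le> ln x" using x by simp
      define u where "u = 1 + ln (real d) + ln x"
      have u: "1 \<le> u" "2 * ln (real d) + ln x \<le> 2 * u" using ld lx by (auto simp: u_def)
      have "ln 5 \<le> ln 5 * u" using u by simp
      moreover have "ln K / \<alpha> \<le> ln K / \<alpha> * u" using mult_left_mono[OF u(1), of "ln K / \<alpha>"] lnK alpha by simp
      moreover have "(2 * ln (real d) + ln x) / \<alpha> \<le> 2 / \<alpha> * u"
        using u(2) alpha by (simp add: divide_right_mono)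
      moreover have "A * u = ln 5 * u + ln K / \<alpha> * u + 2 / \<alpha> * u" by (simp only: A_def ring_distribs)
      ultimately show ?thesis unfolding u_def[symmetric] add_divide_distrib[of "ln K"] by linarith
    qed
    finally have "ln (real m) \<le> real d * (A * (1 + ln (real d) + ln x))" by (simp add: mult_left_mono)
    then show ?thesis using m m1 unfolding x_def by (auto simp: mult_ac)
  qed
  then show ?thesis using A by (intro exI[of _ A]) auto
qed

text \<open>
  Instead of a box, the points with \<open>m(k)\<^sup>\<gamma> \<le> Q\<close> are used; for \<open>\<gamma> > 1\<close> the part of \<open>Q\<close> that does not
  depend on \<open>\<epsilon>\<close> is polylogarithmic in \<open>d\<close>.
\<close>

lemma info_bound_polylog:
  assumes g1: "1 < \<gamma>"
  shows "\<exists>C>0. \<exists>a>0. \<forall>\<epsilon>\<in>{0<..<1}. \<forall>d\<ge>1. \<forall>m. info_complexity crit \<mu> \<epsilon> d = enat m \<longrightarrow>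
      ln (real m) \<le> C * ((1 + ln (real d)) powr a + (1 + ln (real d)) * (1 + ln (1 / \<epsilon>)) powr (p / \<alpha>))"
proof -
  from sum_ev_le_polylog[OF p g1 beta] obtain C a where C: "0 < C" and a: "0 < a"
    and CF: "\<forall>d\<ge>1. \<forall>F. finite F \<longrightarrow> F \<subseteq> lattice d \<longrightarrow> sum (eigval \<beta> p \<gamma> d) F \<le> exp (C * (1 + ln d) powr a)"
    by (elim exE conjE) (rule that)
  from card_weight_le[OF p] obtain K where K: "0 < K"
    and KF: "\<forall>d\<ge>1. \<forall>R F. finite F \<longrightarrow> F \<subseteq> lattice d \<longrightarrow> (\<forall>k\<in>F. weight p d k \<le> R) \<longrightarrow>
           real (card F) \<le> exp ((2 * ln (real d) + 1) * R + K)"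
    by (elim exE conjE) (rule that)
  define \<theta> where "\<theta> = p / \<alpha>"
  have \<theta>: "0 < \<theta>" and \<theta>\<gamma>: "\<gamma> * \<theta> = 1" using alpha p by (auto simp: \<theta>_def)
  define D where "D = (2 * (C + 2) / \<beta>) powr \<theta>"
  have D: "0 \<le> D" by (simp add: D_def)
  have "ln (real m) \<le> (2 * D + K) * ((1 + ln (real d)) powr (1 + a * \<theta>) + (1 + ln (real d)) * (1 + ln (1 / \<epsilon>)) powr \<theta>)"
    if \<epsilon>: "0 < \<epsilon>" "\<epsilon> < 1" and d: "1 \<le> d" and m: "info_complexity crit \<mu> \<epsilon> d = enat m" for \<epsilon> :: real and d m :: nat
  proof -
    define x where "x = 1 + ln (1 / \<epsilon>)"
    have x: "1 \<le> x" unfolding x_def using \<epsilon> by simp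
    define l where "l = 1 + ln (real d)"
    have l: "1 \<le> l" using d by (simp add: l_def)
    define Q where "Q = (ln (total' d) + 2 * ln (1 / \<epsilon>)) / \<beta>"
    have t: "1 \<le> total' d" by (rule one_le_total'[OF d])
    have Q0: "0 \<le> Q" unfolding Q_def using t beta \<epsilon> by simp
    have "total' d \<le> exp (C * l powr a)"
      using CF d by (intro ev_total_le[OF p gamma beta d]) (auto simp: l_def)
    then have "ln (total' d) \<le> C * l powr a" using t by (simp add: ln_le_of_le_exp)
    moreover have "ln (1 / \<epsilon>) \<le> x" by (simp add: x_def)
    moreover have "0 \<le> C * x" "0 \<le> l powr a" using C x by auto
    ultimately have "ln (total' d) + 2 * ln (1 / \<epsilon>) \<le> (C + 2) * (l powr a + x)"
      unfolding ring_distribs by linarith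
    also have "\<dots> \<le> (C + 2) * (2 * max (l powr a) x)"
      using C by (intro mult_left_mono) auto
    finally have "Q \<le> (C + 2) * (2 * max (l powr a) x) / \<beta>"
      unfolding Q_def using beta by (intro divide_right_mono) auto
    also have "(C + 2) * (2 * max (l powr a) x) / \<beta> = 2 * (C + 2) / \<beta> * max (l powr a) x"
      using beta by (simp add: field_simps)
    finally have QM: "Q \<le> 2 * (C + 2) / \<beta> * max (l powr a) x" .
    have "Q powr \<theta> \<le> (2 * (C + 2) / \<beta> * max (l powr a) x) powr \<theta>"
      using Q0 QM \<theta> by (intro powr_mono2) auto
    also have "\<dots> = D * (max (l powr a) x) powr \<theta>"
      unfolding D_def by (rule powr_mult)
    also have "\<dots> \<le> D * (l powr (a * \<theta>) + x powr \<theta>)"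
      using D by (intro mult_left_mono) (auto simp: max_def powr_powr)
    finally have Q\<theta>: "Q powr \<theta> \<le> D * (l powr (a * \<theta>) + x powr \<theta>)" .
    define S where "S = {k \<in> lattice d. weight p d k powr \<gamma> \<le> Q}"
    have sub: "S \<subseteq> lattice d" by (auto simp: S_def)
    have fin: "finite S"
    proof (rule finite_subset)
      define r where "r = nat \<lceil>Q powr (1 / \<alpha>)\<rceil>"
      have r1: "Q powr (1 / \<alpha>) < real (Suc r)" unfolding r_def by linarith
      have "Q = (Q powr (1 / \<alpha>)) powr \<alpha>" using Q0 alpha by (simp add: powr_powr)
      also have "\<dots> < real (Suc r) powr \<alpha>" using r1 alpha by (intro powr_less_mono2) auto
      finally have "Q < real (Suc r) powr \<alpha>" .
      then have less: "Q < real (Suc r) powr (p * \<gamma>)" unfolding p_gamma .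
      show "S \<subseteq> lattice_box r d"
      proof
        fix k assume k: "k \<in> S"
        then have "weight p d k powr \<gamma> < real (Suc r) powr (p * \<gamma>)" using less by (simp add: S_def)
        then show "k \<in> lattice_box r d"
          using weight_outside_box[of k d r, OF _ p gamma] k sub by (meson DiffI not_less subsetD)
      qed
    qed (rule lattice_box_simps)
    have "info_complexity crit \<mu> \<epsilon> d \<le> enat (card S)"
    proof (rule info_upper[OF d fin sub _ \<epsilon>(1) Q_def])
      fix k assume "k \<in> lattice d - S"
      then have "\<not> weight p d k powr \<gamma> \<le> Q" unfolding S_def by blast
      then show "Q \<le> weight p d k powr \<gamma>" by simp
    qed
    then have mS: "m \<le> card S" using m by simp
    have wS: "weight p d k \<le> Q powr \<theta>" if "k \<in> S" for k
    proof -
      have "(weight p d k powr \<gamma>) powr \<theta> \<le> Q powr \<theta>" using that \<theta> by (intro powr_mono2) (auto simp: S_def)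
      then show ?thesis using weight_nonneg[of p d k] by (simp only: powr_powr \<theta>\<gamma>) simp
    qed
    have "real m \<le> real (card S)" using mS by simp
    also have "\<dots> \<le> exp ((2 * ln (real d) + 1) * Q powr \<theta> + K)"
      by (rule KF[rule_format, OF d fin sub wS])
    finally have "real m \<le> exp ((2 * ln (real d) + 1) * Q powr \<theta> + K)" .
    then have "ln (real m) \<le> (2 * ln (real d) + 1) * Q powr \<theta> + K"
      using info_pos[OF d \<epsilon> m] by (simp add: ln_le_of_le_exp)
    also have "\<dots> \<le> (2 * l) * (D * (l powr (a * \<theta>) + x powr \<theta>)) + K * (l powr (1 + a * \<theta>))"
    proof (intro add_mono mult_mono Q\<theta>)
      have "1 \<le> l powr (1 + a * \<theta>)" using l a \<theta> by (intro ge_one_powr_ge_zero) auto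
      then show "K \<le> K * l powr (1 + a * \<theta>)" using K by simp
    qed (use l in \<open>auto simp: l_def\<close>)
    also have "\<dots> \<le> (2 * D + K) * (l powr (1 + a * \<theta>) + l * x powr \<theta>)"
    proof -
      have "2 * l * (D * (l powr (a * \<theta>) + x powr \<theta>)) = 2 * D * (l * l powr (a * \<theta>)) + 2 * D * (l * x powr \<theta>)"
        by (simp add: algebra_simps)
      also have "l * l powr (a * \<theta>) = l powr (1 + a * \<theta>)" using l by (simp add: powr_add)
      finally have "2 * l * (D * (l powr (a * \<theta>) + x powr \<theta>)) = 2 * D * l powr (1 + a * \<theta>) + 2 * D * (l * x powr \<theta>)" .
      moreover have "0 \<le> K * (l * x powr \<theta>)" using K l by auto
      ultimately show ?thesis unfolding ring_distribs by linarith
    qed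
    finally show ?thesis unfolding l_def x_def .
  qed
  moreover have "0 < 2 * D + K" using D K by simp
  moreover have "0 < 1 + a * \<theta>" using a \<theta> by (simp add: add_pos_pos)
  ultimately show ?thesis unfolding \<theta>_def[symmetric]
    by (intro exI[of _ "2 * D + K"] exI[of _ "1 + a * \<theta>"]) auto
qed

text \<open>
  The constant \<open>B\<close> compensates the initial error, whose logarithm is \<open>O(d (1 + ln d))\<close> and hence
  \<open>O(d\<^sup>g)\<close> for every \<open>g > 1\<close>.
\<close>

lemma info_lower_exponential:
  assumes g: "1 < g" "\<gamma> \<le> g"
  shows "\<exists>B>0. \<forall>d\<ge>1. \<forall>m. info_complexity crit \<mu> (exp (- (B * real d powr g))) d = enat m \<longrightarrow> 3 ^ d \<le> m"
proof -
  from sum_ev_le_exp[OF p gamma beta2] obtain C where C: "0 < C"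
    and CF: "\<forall>d\<ge>1. \<forall>F. finite F \<longrightarrow> F \<subseteq> lattice d \<longrightarrow> sum (lam d) F \<le> exp (C * (d * (1 + ln d)))"
    by (elim exE conjE) (rule that)
  (* 1 + ln d \<le> K d powr (g - 1), because ln y \<le> y for y = d powr (g - 1) *)
  define K where "K = 1 + 1 / (g - 1)"
  have K: "0 < K" using g by (simp add: K_def add_pos_pos)
  (* the last summand makes the comparison with the eigenvalues of the box strict *)
  define B where "B = \<beta> + C * K / 2 + 1"
  have B: "0 < B" unfolding B_def using beta C K by (intro add_pos_pos) auto
  have "3 ^ d \<le> m" if d: "1 \<le> d" and m: "info_complexity crit \<mu> (exp (- (B * real d powr g))) d = enat m" for d m
  proof (rule ccontr)
    assume "\<not> 3 ^ d \<le> m"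
    then have "m < (2 * 1 + 1) ^ d" by simp
    from error_lower_box[OF d this]
    have "ennreal (exp (- (\<beta> * real d powr \<gamma>))) \<le> avg_error \<mu> m d" by simp
    also have "\<dots> \<le> ennreal (exp (- (B * real d powr g)) * sqrt (total d))"
      by (rule info_attained[OF d _ m]) simp
    finally have le: "exp (- (\<beta> * real d powr \<gamma>)) \<le> exp (- (B * real d powr g)) * sqrt (total d)"
      using one_le_total[OF d] by (subst (asm) ennreal_le_iff) auto
    have D1: "1 \<le> real d powr (g - 1)" using d g by (intro ge_one_powr_ge_zero) auto
    have "ln (real d powr (g - 1)) \<le> real d powr (g - 1)" using d by (intro ln_bound) simp
    then have "ln (real d) \<le> real d powr (g - 1) / (g - 1)" using g d by (simp add: ln_powr field_simps)
    then have "1 + ln (real d) \<le> K * real d powr (g - 1)" using D1 by (simp add: K_def ring_distribs)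
    then have "real d * (1 + ln (real d)) \<le> real d powr 1 * (K * real d powr (g - 1))"
      using d by (simp add: mult_left_mono)
    also have "\<dots> = K * real d powr g" using powr_add[of "real d" 1 "g - 1"] by simp
    finally have dK: "real d * (1 + ln (real d)) \<le> K * real d powr g" .
    have "total d \<le> exp (C * (d * (1 + ln d)))"
      using CF d by (intro ev_total_le[OF p gamma beta2 d]) auto
    also have "\<dots> \<le> exp (C * (K * real d powr g))" using C dK by (simp add: mult_left_mono)
    also have "\<dots> = (exp (C * K / 2 * real d powr g))\<^sup>2"
      by (simp add: power2_eq_square exp_add[symmetric])
    finally have "sqrt (total d) \<le> sqrt ((exp (C * K / 2 * real d powr g))\<^sup>2)" by (rule real_sqrt_le_mono)
    then have "sqrt (total d) \<le> exp (C * K / 2 * real d powr g)" by simp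
    then have "exp (- (B * real d powr g)) * sqrt (total d) \<le> exp (- (B * real d powr g)) * exp (C * K / 2 * real d powr g)"
      by (intro mult_left_mono) auto
    also have "\<dots> = exp (- ((\<beta> + 1) * real d powr g))"
      unfolding exp_add[symmetric] by (simp add: B_def algebra_simps)
    finally have "exp (- (\<beta> * real d powr \<gamma>)) \<le> exp (- ((\<beta> + 1) * real d powr g))"
      using le by linarith
    then have "(\<beta> + 1) * real d powr g \<le> \<beta> * real d powr \<gamma>" by simp
    also have "\<dots> \<le> \<beta> * real d powr g" using beta d g by (intro mult_left_mono powr_mono) auto
    finally have "real d powr g \<le> 0" by (simp add: ring_distribs)
    then show False using d by simp
  qed
  then show ?thesis using B by (intro exI[of _ B]) auto
qed

text \<open>
  At half of the initial error, three quarters of the total variance have to be removed.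
\<close>

lemma info_lower_fixed:
  assumes g: "\<gamma> \<le> 1" and d: "1 \<le> d" and m: "info_complexity crit \<mu> (1 / 2) d = enat m"
  shows "3 / 4 * (1 + 2 * exp (- (2 * \<beta>))) ^ d \<le> real m"
proof (rule ccontr)
  assume "\<not> ?thesis"
  moreover have "(1 + 2 * exp (- (2 * \<beta>))) ^ d \<le> total d"
    by (rule ev_total_exponential[OF p gamma g beta2 d])
  ultimately have m34: "real m < 3 / 4 * total d" by simp
  have "ennreal (sqrt (total d - real m)) \<le> avg_error \<mu> m d" by (rule error_lower_total[OF d])
  also have "\<dots> \<le> ennreal (1 / 2 * sqrt (total d))" by (rule info_attained[OF d _ m]) simp
  finally have "sqrt (total d - real m) \<le> 1 / 2 * sqrt (total d)"
    using one_le_total[OF d] by (subst (asm) ennreal_le_iff) auto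
  also have "\<dots> = sqrt (total d / 4)" by (simp add: real_sqrt_divide)
  finally show False using m34 by simp
qed

text \<open>
  For given \<open>n\<close> the largest box with at most \<open>n\<close> points is used; its radius \<open>r\<close> satisfies
  \<open>r + 1 \<ge> n\<^bsup>1/d\<^esup> / 3\<close>.
\<close>

lemma exp_rate_attained: "exp_rate (avg_error \<mu>) (\<lambda>d. \<alpha> / real d)"
proof -
  define q where "q = exp (- (\<beta> / 2 * (1 / 3) powr \<alpha>))"
  have q: "0 < q" "q < 1" using beta by (auto simp: q_def)
  have "avg_error \<mu> n d \<le> ennreal (sqrt (total' d) * q powr ((real n / 1) powr (\<alpha> / real d)))"
    if d: "1 \<le> d" for n d
  proof (cases "n = 0")
    case True
    have "avg_error \<mu> n d \<le> ennreal (sqrt (total' d) * exp (- (\<beta> * 0 / 2)))"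
      by (rule error_upper_tail[OF d, of "{}"]) auto
    then show ?thesis using True q by simp
  next
    case False
    define y where "y = real n powr (1 / real d)"
    have y: "1 \<le> y" unfolding y_def using False by (intro ge_one_powr_ge_zero) auto
    (* the largest r with (2 r + 1)^d \<le> n *)
    define r where "r = nat \<lfloor>(y - 1) / 2\<rfloor>"
    have "real r = real_of_int \<lfloor>(y - 1) / 2\<rfloor>" unfolding r_def using y by simp
    then have r1: "real r \<le> (y - 1) / 2" by linarith
    have r2: "(y - 1) / 2 < real (Suc r)" unfolding r_def using y by linarith
    have "real (2 * r + 1) ^ d \<le> y ^ d" using r1 by (intro power_mono) auto
    also have "y ^ d = real n" unfolding y_def using d False by (simp add: powr_realpow[symmetric] powr_powr)
    finally have "(2 * r + 1) ^ d \<le> n" by (simp only: of_nat_power[symmetric] of_nat_le_iff)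
    then have c: "card (lattice_box r d) \<le> n" by (simp only: lattice_box_simps)
    have "1 / 3 * y \<le> real (Suc r)" using r2 by simp
    then have "(1 / 3 * y) powr \<alpha> \<le> real (Suc r) powr \<alpha>" using y alpha by (intro powr_mono2) auto
    moreover have "(1 / 3 * y) powr \<alpha> = (1 / 3) powr \<alpha> * real n powr (\<alpha> / real d)"
      unfolding powr_mult y_def powr_powr by simp
    ultimately have Q: "(1 / 3) powr \<alpha> * real n powr (\<alpha> / real d) \<le> weight p d k powr \<gamma>"
      if "k \<in> lattice d - lattice_box r d" for k
      using weight_outside_box[OF that p gamma] p_gamma by simp
    have "avg_error \<mu> n d \<le> ennreal (sqrt (total' d) * exp (- (\<beta> * ((1 / 3) powr \<alpha> * real n powr (\<alpha> / real d)) / 2)))"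
      by (rule error_upper_tail[OF d lattice_box_simps(1,2) c Q])
    also have "exp (- (\<beta> * ((1 / 3) powr \<alpha> * real n powr (\<alpha> / real d)) / 2)) = q powr ((real n / 1) powr (\<alpha> / real d))"
      unfolding q_def by (simp add: powr_def)
    finally show ?thesis .
  qed
  then show ?thesis unfolding exp_rate_def using q alpha one_le_total'
    by (intro exI[of _ q] exI[of _ "\<lambda>d. sqrt (total' d)"] exI[of _ "\<lambda>d. 1"])
       (auto intro: less_le_trans[OF zero_less_one])
qed

text \<open>
  With \<open>n = (2 j)\<^sup>d\<close>, one point of the box of radius \<open>j\<close> is always missed; comparing exponents as \<open>j\<close>
  grows gives \<open>d r(d) \<le> \<alpha>\<close>.
\<close>

lemma exp_rate_bound:
  assumes r: "exp_rate (avg_error \<mu>) r" and d: "1 \<le> d"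
  shows "r d \<le> \<alpha> / real d"
proof (rule ccontr)
  assume "\<not> ?thesis"
  then have gap: "0 < real d * r d - \<alpha>" using d by (simp add: field_simps)
  from r obtain q C C1 where q: "0 < q" "q < 1" and rd: "0 < r d" "0 < C d" "0 < C1 d"
    and e: "\<And>n. avg_error \<mu> n d \<le> ennreal (C d * q powr ((real n / C1 d) powr r d))"
    using d unfolding exp_rate_def by blast
  define A where "A = ln (1 / q) * (2 ^ d / C1 d) powr r d"
  have A: "0 < A" unfolding A_def using q rd by simp
  have main: "A * real j powr (real d * r d - \<alpha>) \<le> \<bar>ln (C d)\<bar> + \<beta> * real d powr \<gamma>" if j: "1 \<le> j" for j :: nat
  proof -
    have "(2 * j) ^ d < (2 * j + 1) ^ d" using d by (intro power_strict_mono) auto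
    from order_trans[OF error_lower_box[OF d this] e[of "(2 * j) ^ d"]]
    have "exp (- (\<beta> * (real d powr \<gamma> * real j powr \<alpha>))) \<le> C d * q powr ((real ((2 * j) ^ d) / C1 d) powr r d)"
      by (subst (asm) ennreal_le_iff) (use rd in auto)
    then have "ln (exp (- (\<beta> * (real d powr \<gamma> * real j powr \<alpha>)))) \<le> ln (C d * q powr ((real ((2 * j) ^ d) / C1 d) powr r d))"
      using rd q by (subst ln_le_cancel_iff) auto
    also have "\<dots> = ln (C d) - ln (1 / q) * (real ((2 * j) ^ d) / C1 d) powr r d"
      using rd q by (simp add: ln_mult ln_powr ln_div)
    also have "(real ((2 * j) ^ d) / C1 d) powr r d = (2 ^ d / C1 d) powr r d * real j powr (real d * r d)"
    proof -
      have "real ((2 * j) ^ d) / C1 d = (2 ^ d / C1 d) * real j powr real d"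
        using j by (simp add: powr_realpow power_mult_distrib)
      then show ?thesis by (simp only: powr_mult powr_powr)
    qed
    finally have "A * real j powr (real d * r d) \<le> ln (C d) + \<beta> * (real d powr \<gamma> * real j powr \<alpha>)"
      by (simp add: A_def)
    also have "\<dots> \<le> (\<bar>ln (C d)\<bar> + \<beta> * real d powr \<gamma>) * real j powr \<alpha>"
    proof -
      have "1 \<le> real j powr \<alpha>" using j alpha by (intro ge_one_powr_ge_zero) auto
      then have "\<bar>ln (C d)\<bar> * 1 \<le> \<bar>ln (C d)\<bar> * real j powr \<alpha>" by (intro mult_left_mono) auto
      then show ?thesis by (simp add: ring_distribs)
    qed
    finally have "A * real j powr (real d * r d) / real j powr \<alpha> \<le> \<bar>ln (C d)\<bar> + \<beta> * real d powr \<gamma>"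
      using j by (simp add: pos_divide_le_eq)
    then show ?thesis by (simp add: powr_diff)
  qed
  define \<delta> where "\<delta> = real d * r d - \<alpha>"
  define X where "X = \<bar>ln (C d)\<bar> + \<beta> * real d powr \<gamma>"
  have X: "0 \<le> X" unfolding X_def using beta by simp
  (* a value of j that violates the bound above *)
  define j where "j = nat \<lceil>(X / A) powr (1 / \<delta>)\<rceil> + 1"
  have "(X / A) powr (1 / \<delta>) < real j" unfolding j_def by linarith
  then have "((X / A) powr (1 / \<delta>)) powr \<delta> < real j powr \<delta>"
    using gap by (intro powr_less_mono2) (auto simp: \<delta>_def)
  moreover have "((X / A) powr (1 / \<delta>)) powr \<delta> = X / A"
    using gap X A by (simp add: powr_powr \<delta>_def)
  ultimately have "X < A * real j powr \<delta>" using A by (simp add: pos_divide_less_eq mult.commute)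
  moreover have "1 \<le> j" by (simp add: j_def)
  ultimately show False using main[of j] unfolding X_def \<delta>_def by linarith
qed

end

section \<open>Criteria for the tractability notions\<close>

lemma eventually_eps_dim_filter:
  "eventually P eps_dim_filter \<longleftrightarrow>
     (\<exists>K. \<forall>\<epsilon>\<in>{0<..<1}. \<forall>d\<ge>1. K \<le> 1 / \<epsilon> + real d \<longrightarrow> P (\<epsilon>, d))"
  unfolding eps_dim_filter_def eventually_inf_principal eventually_filtercomap_at_top_linorder
  by (auto 0 4)

text \<open>
  Along the filter at least one of \<open>1 / \<epsilon>\<close> and \<open>d\<close> is large.
\<close>

lemma denominator_tends_to_infinity:
  assumes s: "0 < s" and t: "0 < t"
  shows "\<exists>K'. \<forall>\<epsilon>\<in>{0<..<1}. \<forall>d\<ge>1. K' \<le> 1 / \<epsilon> + real d \<longrightarrow>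
           K \<le> (1 + ln (1 / \<epsilon>)) powr s + real d powr t"
proof (intro exI ballI allI impI)
  define L where "L = max K 1"
  have L: "1 \<le> L" "K \<le> L" by (auto simp: L_def)
  fix \<epsilon> :: real and d :: nat
  assume \<epsilon>: "\<epsilon> \<in> {0<..<1}" and d: "1 \<le> d" and le: "exp (L powr (1 / s)) + L powr (1 / t) \<le> 1 / \<epsilon> + real d"
  have l0: "0 \<le> ln (1 / \<epsilon>)" using \<epsilon> by simp
  from le consider "exp (L powr (1 / s)) \<le> 1 / \<epsilon>" | "L powr (1 / t) \<le> real d" by linarith
  then show "K \<le> (1 + ln (1 / \<epsilon>)) powr s + real d powr t"
  proof cases
    case 1
    then have "L powr (1 / s) \<le> ln (1 / \<epsilon>)" using \<epsilon> by (subst ln_ge_iff) auto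
    then have "(L powr (1 / s)) powr s \<le> (1 + ln (1 / \<epsilon>)) powr s" using s by (intro powr_mono2) auto
    then have "L \<le> (1 + ln (1 / \<epsilon>)) powr s" using s L by (simp add: powr_powr)
    then show ?thesis using L powr_ge_zero[of "real d" t] by linarith
  next
    case 2
    then have "(L powr (1 / t)) powr t \<le> real d powr t" using t by (intro powr_mono2) auto
    then have "L \<le> real d powr t" using t L by (simp add: powr_powr)
    then show ?thesis using L powr_ge_zero[of "1 + ln (1 / \<epsilon>)" s] by linarith
  qed
qed

lemma denominator_pos:
  assumes "1 \<le> d"
  shows "0 < (1 + ln (1 / \<epsilon>)) powr s + real d powr t"
  using assms by (intro add_nonneg_pos) auto

lemma ln_enat_ratio:
  assumes "N = enat m" "1 \<le> m" "0 < D"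
  shows "ln_enat N / ereal D = ereal (ln (real m) / D)"
  using assms by simp

lemma EXP_st_WT_I:
  assumes s: "0 < s" and t: "0 < t"
    and fin: "\<And>\<epsilon> d. 0 < \<epsilon> \<Longrightarrow> \<epsilon> < 1 \<Longrightarrow> 1 \<le> d \<Longrightarrow> \<exists>m. N \<epsilon> d = enat m \<and> 1 \<le> m"
    and bound: "\<And>\<delta>. 0 < \<delta> \<Longrightarrow> \<exists>C. \<forall>\<epsilon> d m. 0 < \<epsilon> \<longrightarrow> \<epsilon> < 1 \<longrightarrow> 1 \<le> d \<longrightarrow> N \<epsilon> d = enat m \<longrightarrow>
        ln (real m) \<le> \<delta> * ((1 + ln (1 / \<epsilon>)) powr s + real d powr t) + C"
  shows "EXP_st_WT s t N"
proof -
  define D where "D = (\<lambda>(\<epsilon>, d). (1 + ln (1 / \<epsilon>)) powr s + real d powr t)"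
  define h where "h = (\<lambda>(\<epsilon>, d). ln (real (the_enat (N \<epsilon> d))))"
  have "((\<lambda>z. h z / D z) \<longlongrightarrow> 0) eps_dim_filter"
  proof (rule tendstoI)
    fix e :: real assume e: "0 < e"
    from bound[of "e / 2"] e obtain C where C: "\<forall>\<epsilon> d m. 0 < \<epsilon> \<longrightarrow> \<epsilon> < 1 \<longrightarrow> 1 \<le> d \<longrightarrow> N \<epsilon> d = enat m \<longrightarrow>
        ln (real m) \<le> (e / 2) * ((1 + ln (1 / \<epsilon>)) powr s + real d powr t) + C"
      by auto
    from denominator_tends_to_infinity[OF s t, of "2 * (\<bar>C\<bar> + 1) / e"] obtain K'
      where K': "\<forall>\<epsilon>\<in>{0<..<1}. \<forall>d\<ge>1. K' \<le> 1 / \<epsilon> + real d \<longrightarrow>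
           2 * (\<bar>C\<bar> + 1) / e \<le> (1 + ln (1 / \<epsilon>)) powr s + real d powr t"
      by (elim exE) (rule that)
    have "dist (h (\<epsilon>, d) / D (\<epsilon>, d)) 0 < e"
      if \<epsilon>: "0 < \<epsilon>" "\<epsilon> < 1" and d: "1 \<le> d" and K: "K' \<le> 1 / \<epsilon> + real d" for \<epsilon> d
    proof -
      from fin[OF \<epsilon> d] obtain m where m: "N \<epsilon> d = enat m" "1 \<le> m" by auto
      have Dp: "0 < D (\<epsilon>, d)" unfolding D_def using denominator_pos[OF d] by simp
      have "2 * (\<bar>C\<bar> + 1) / e \<le> D (\<epsilon>, d)"
        using K'[rule_format, of \<epsilon> d] \<epsilon> d K by (simp add: D_def)
      then have "\<bar>C\<bar> + 1 \<le> e / 2 * D (\<epsilon>, d)" using e by (simp add: field_simps)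
      moreover have "h (\<epsilon>, d) \<le> e / 2 * D (\<epsilon>, d) + C"
        using C[rule_format, OF \<epsilon> d m(1)] m by (simp add: h_def D_def)
      ultimately have "h (\<epsilon>, d) < e * D (\<epsilon>, d)" by linarith
      moreover have "0 \<le> h (\<epsilon>, d)" using m by (simp add: h_def)
      ultimately show ?thesis using Dp by (simp add: pos_divide_less_eq)
    qed
    then show "eventually (\<lambda>z. dist (h z / D z) 0 < e) eps_dim_filter"
      unfolding eventually_eps_dim_filter by (intro exI[of _ K']) simp
  qed
  then have "((\<lambda>z. ereal (h z / D z)) \<longlongrightarrow> ereal 0) eps_dim_filter"
    by (rule tendsto_ereal)
  moreover have "eventually (\<lambda>z. ereal (h z / D z) =
      (\<lambda>(\<epsilon>, d). ln_enat (N \<epsilon> d) / ereal ((1 + ln (1 / \<epsilon>)) powr s + real d powr t)) z) eps_dim_filter"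
    unfolding eventually_eps_dim_filter
  proof (intro exI ballI allI impI)
    fix \<epsilon> :: real and d :: nat assume \<epsilon>: "\<epsilon> \<in> {0<..<1}" and d: "1 \<le> d"
    from fin[of \<epsilon> d] \<epsilon> d obtain m where m: "N \<epsilon> d = enat m" "1 \<le> m" by auto
    show "ereal (h (\<epsilon>, d) / D (\<epsilon>, d)) = (\<lambda>(\<epsilon>, d). ln_enat (N \<epsilon> d) / ereal ((1 + ln (1 / \<epsilon>)) powr s + real d powr t)) (\<epsilon>, d)"
      unfolding prod.case ln_enat_ratio[OF m denominator_pos[OF d]]
      using m by (simp add: h_def D_def)
  qed
  ultimately show ?thesis
    unfolding EXP_st_WT_def zero_ereal_def by (rule Lim_transform_eventually)
qed

lemma not_EXP_st_WT_I:
  assumes c: "0 < c" and e: "\<And>d. 1 \<le> d \<Longrightarrow> 0 < e d \<and> e d < 1"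
    and fin: "\<And>\<epsilon> d. 0 < \<epsilon> \<Longrightarrow> \<epsilon> < 1 \<Longrightarrow> 1 \<le> d \<Longrightarrow> \<exists>m. N \<epsilon> d = enat m \<and> 1 \<le> m"
    and large: "\<And>d m. d0 \<le> d \<Longrightarrow> 1 \<le> d \<Longrightarrow> N (e d) d = enat m \<Longrightarrow>
        c * ((1 + ln (1 / e d)) powr s + real d powr t) \<le> ln (real m)"
  shows "\<not> EXP_st_WT s t N"
proof
  assume "EXP_st_WT s t N"
  then have "eventually (\<lambda>z. (\<lambda>(\<epsilon>, d). ln_enat (N \<epsilon> d) / ereal ((1 + ln (1 / \<epsilon>)) powr s + real d powr t)) z < ereal c) eps_dim_filter"
    unfolding EXP_st_WT_def using c by (intro order_tendstoD(2)) auto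
  then obtain K where K: "\<forall>\<epsilon>\<in>{0<..<1}. \<forall>d\<ge>1. K \<le> 1 / \<epsilon> + real d \<longrightarrow>
      ln_enat (N \<epsilon> d) / ereal ((1 + ln (1 / \<epsilon>)) powr s + real d powr t) < ereal c"
    unfolding eventually_eps_dim_filter prod.case by (elim exE) (rule that)
  define d where "d = max 1 (max d0 (nat \<lceil>K\<rceil>))"
  have d: "1 \<le> d" "d0 \<le> d" by (auto simp: d_def)
  have "K \<le> real (nat \<lceil>K\<rceil>)" by linarith
  also have "\<dots> \<le> real d"
  proof -
    have "nat \<lceil>K\<rceil> \<le> d" unfolding d_def by (rule max.coboundedI2[OF max.cobounded2])
    then show ?thesis by (simp only: of_nat_le_iff)
  qed
  finally have "K \<le> 1 / e d + real d" using e[OF d(1)] by (simp add: add_increasing)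
  with K e[OF d(1)] d(1)
  have lt: "ln_enat (N (e d) d) / ereal ((1 + ln (1 / e d)) powr s + real d powr t) < ereal c" by simp
  from fin[of "e d" d] e[OF d(1)] d obtain m where m: "N (e d) d = enat m" "1 \<le> m" by auto
  have pos: "0 < (1 + ln (1 / e d)) powr s + real d powr t" by (rule denominator_pos[OF d(1)])
  from lt have "ln (real m) / ((1 + ln (1 / e d)) powr s + real d powr t) < c"
    unfolding ln_enat_ratio[OF m pos] by simp
  with large[OF d(2,1) m(1)] pos show False by (simp add: pos_divide_less_eq)
qed

text \<open>
  A power of \<open>1 + ln y\<close> is at most a multiple of \<open>y\<^bsup>\<sigma>/2\<^esup>\<close>, and the square is completed.
\<close>

lemma log_power_le:
  fixes a \<sigma> \<delta> :: real
  assumes a: "0 < a" and \<sigma>: "0 < \<sigma>" and \<delta>: "0 < \<delta>"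
  shows "\<exists>C\<ge>0. \<forall>y\<ge>1. (1 + ln y) powr a \<le> \<delta> * y powr \<sigma> + C"
proof -
  (* 1 + ln y \<le> (1 + 1/\<tau>) y powr \<tau>, and raising this to the power a gives y powr (\<sigma>/2) *)
  define \<tau> where "\<tau> = \<sigma> / (2 * a)"
  have \<tau>: "0 < \<tau>" using a \<sigma> by (simp add: \<tau>_def)
  define K where "K = (1 + 1 / \<tau>) powr a"
  have "(1 + ln y) powr a \<le> \<delta> * y powr \<sigma> + K\<^sup>2 / (4 * \<delta>)" if y: "1 \<le> y" for y
  proof -
    have y1: "1 \<le> y powr \<tau>" using y \<tau> by (intro ge_one_powr_ge_zero) auto
    have "ln (y powr \<tau>) \<le> y powr \<tau>" using y by (intro ln_bound) simp
    then have "ln y \<le> y powr \<tau> / \<tau>" using y \<tau> by (simp add: ln_powr field_simps)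
    then have "1 + ln y \<le> (1 + 1 / \<tau>) * y powr \<tau>" using y1 by (simp add: ring_distribs)
    then have "(1 + ln y) powr a \<le> ((1 + 1 / \<tau>) * y powr \<tau>) powr a"
      using y a by (intro powr_mono2) auto
    also have "\<dots> = K * y powr (\<sigma> / 2)"
      unfolding powr_mult K_def using a by (simp add: powr_powr \<tau>_def)
    finally have b: "(1 + ln y) powr a \<le> K * y powr (\<sigma> / 2)" .
    define z where "z = y powr (\<sigma> / 2)"
    have zz: "z\<^sup>2 = y powr \<sigma>" unfolding z_def power2_eq_square powr_add[symmetric] by simp
    have "0 \<le> (2 * \<delta> * z - K)\<^sup>2 / (4 * \<delta>)" using \<delta> by simp
    also have "\<dots> = \<delta> * z\<^sup>2 + K\<^sup>2 / (4 * \<delta>) - K * z"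
      using \<delta> by (simp add: power2_eq_square field_simps)
    finally show ?thesis using b unfolding z_def[symmetric] zz by simp
  qed
  moreover have "0 \<le> K\<^sup>2 / (4 * \<delta>)" using \<delta> by simp
  ultimately show ?thesis by blast
qed

text \<open>
  A form of Young's inequality, by distinguishing whether \<open>u\<close> is at most \<open>\<kappa> v\<^sup>\<sigma>\<close>.
\<close>

lemma young_powr:
  fixes u v \<kappa> q \<sigma> :: real
  assumes u: "0 \<le> u" and v: "1 \<le> v" and \<kappa>: "0 < \<kappa>" and q: "0 < q" and \<sigma>: "0 < \<sigma>"
  shows "u * v powr q \<le> \<kappa> * v powr (q + \<sigma>) + (1 / \<kappa>) powr (q / \<sigma>) * u powr (1 + q / \<sigma>)"
proof (cases "u \<le> \<kappa> * v powr \<sigma>")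
  case True
  then have "u * v powr q \<le> \<kappa> * v powr \<sigma> * v powr q" by (intro mult_right_mono) auto
  also have "\<dots> = \<kappa> * v powr (q + \<sigma>)" by (simp add: powr_add mult_ac)
  finally show ?thesis using \<kappa> by (simp add: add_increasing2)
next
  case False
  then have "v powr \<sigma> \<le> u / \<kappa>" using \<kappa> by (simp add: pos_le_divide_eq mult.commute)
  then have "(v powr \<sigma>) powr (q / \<sigma>) \<le> (1 / \<kappa> * u) powr (q / \<sigma>)"
    using q \<sigma> by (intro powr_mono2) auto
  then have "v powr q \<le> (1 / \<kappa>) powr (q / \<sigma>) * u powr (q / \<sigma>)"
    unfolding powr_mult using \<sigma> by (simp add: powr_powr)
  then have "u * v powr q \<le> u * ((1 / \<kappa>) powr (q / \<sigma>) * u powr (q / \<sigma>))"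
    using u by (intro mult_left_mono)
  also have "\<dots> = (1 / \<kappa>) powr (q / \<sigma>) * u powr (1 + q / \<sigma>)"
    using u by (cases "u = 0") (auto simp: powr_add)
  finally show ?thesis using \<kappa> by (simp add: add_increasing)
qed

text \<open>
  This separates the two variables in the mixed terms of the complexity bounds: an arbitrarily small
  increase of the exponent of one variable absorbs a logarithm of the other one.
\<close>

lemma log_times_power_le:
  fixes q \<sigma> t \<delta> :: real
  assumes q: "0 < q" and \<sigma>: "0 < \<sigma>" and t: "0 < t" and \<delta>: "0 < \<delta>"
  shows "\<exists>C\<ge>0. \<forall>v\<ge>1. \<forall>y\<ge>1. (1 + ln y) * v powr q \<le> \<delta> * v powr (q + \<sigma>) + \<delta> * y powr t + C"
proof -
  define K where "K = (1 / \<delta>) powr (q / \<sigma>)"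
  have K: "0 < K" using \<delta> by (simp add: K_def)
  have "0 < 1 + q / \<sigma>" using q \<sigma> by (simp add: add_pos_pos)
  from log_power_le[OF this t, of "\<delta> / K"] \<delta> K
  obtain C where C: "0 \<le> C" and CF: "\<forall>y\<ge>1. (1 + ln y) powr (1 + q / \<sigma>) \<le> \<delta> / K * y powr t + C" by auto
  have "(1 + ln y) * v powr q \<le> \<delta> * v powr (q + \<sigma>) + \<delta> * y powr t + K * C" if v: "1 \<le> v" and y: "1 \<le> y" for v y
  proof -
    have "0 \<le> 1 + ln y" using y by (simp add: add_increasing)
    from young_powr[OF this v \<delta> q \<sigma>]
    have "(1 + ln y) * v powr q \<le> \<delta> * v powr (q + \<sigma>) + K * (1 + ln y) powr (1 + q / \<sigma>)"
      by (simp add: K_def)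
    also have "K * (1 + ln y) powr (1 + q / \<sigma>) \<le> K * (\<delta> / K * y powr t + C)"
      using K CF y by (intro mult_left_mono) auto
    also have "\<dots> = \<delta> * y powr t + K * C" using K by (simp add: ring_distribs)
    finally show ?thesis by simp
  qed
  then show ?thesis using K C by (intro exI[of _ "K * C"]) auto
qed

text \<open>
  With \<open>ln (1/\<epsilon>)\<close> of order \<open>d\<^sup>g\<close>, the quasi-polynomial bound is the exponential of
  \<open>O((1 + ln d)\<^sup>2)\<close>, which is smaller than \<open>3\<^sup>d\<close> for large \<open>d\<close>.
\<close>

lemma not_EXP_QPT_I:
  fixes B g :: real
  assumes B: "0 < B" and g: "0 < g"
    and fin: "\<And>\<epsilon> d. 0 < \<epsilon> \<Longrightarrow> \<epsilon> < 1 \<Longrightarrow> 1 \<le> d \<Longrightarrow> \<exists>m. N \<epsilon> d = enat m \<and> 1 \<le> m"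
    and large: "\<And>d m. 1 \<le> d \<Longrightarrow> N (exp (- (B * real d powr g))) d = enat m \<Longrightarrow> 3 ^ d \<le> m"
  shows "\<not> EXP_QPT N"
proof
  assume "EXP_QPT N"
  then obtain C a where C: "0 < C" and a: "0 \<le> a" and N: "\<forall>d\<ge>1. \<forall>\<epsilon>\<in>{0<..<1}.
        ereal_of_enat (N \<epsilon> d) \<le> ereal (C * exp (a * (1 + ln (real d)) * (1 + ln (ln (1 / \<epsilon>) + 1))))"
    unfolding EXP_QPT_def by blast
  define G where "G = 1 + ln (1 + B) + g"
  have G: "0 < G" unfolding G_def using B g by (intro add_pos_pos add_pos_nonneg) auto
  have b: "real d * ln 3 \<le> ln C + a * G * (1 + ln (real d)) powr 2" if d: "1 \<le> d" for d :: nat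
  proof -
    define \<epsilon> where "\<epsilon> = exp (- (B * real d powr g))"
    have \<epsilon>: "0 < \<epsilon>" "\<epsilon> < 1" using B d by (auto simp: \<epsilon>_def)
    have le: "ln (1 / \<epsilon>) = B * real d powr g" by (simp add: \<epsilon>_def ln_div)
    define l where "l = 1 + ln (real d)"
    have l: "1 \<le> l" using d by (simp add: l_def)
    have dg: "1 \<le> real d powr g" using d g by (intro ge_one_powr_ge_zero) auto
    have Bd: "0 < B * real d powr g" using B d by simp
    have "ln (ln (1 / \<epsilon>) + 1) \<le> ln ((1 + B) * real d powr g)"
      unfolding le ring_distribs using Bd dg by (subst ln_le_cancel_iff) linarith+
    also have "\<dots> = ln (1 + B) + g * ln (real d)" using B d by (simp add: ln_mult ln_powr)
    also have "\<dots> \<le> ln (1 + B) * l + g * l"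
      using B g l by (intro add_mono mult_left_mono) (auto simp: l_def mult_le_cancel_left1)
    finally have "1 + ln (ln (1 / \<epsilon>) + 1) \<le> G * l" using l by (simp add: G_def ring_distribs)
    then have "a * l * (1 + ln (ln (1 / \<epsilon>) + 1)) \<le> a * l * (G * l)"
      using a l by (intro mult_left_mono) auto
    also have "\<dots> = a * G * l powr 2" using l by (simp add: power2_eq_square)
    finally have ex: "a * l * (1 + ln (ln (1 / \<epsilon>) + 1)) \<le> a * G * l powr 2" .
    from fin[OF \<epsilon> d] obtain m where m: "N \<epsilon> d = enat m" "1 \<le> m" by auto
    have "3 ^ d \<le> m" using large[OF d] m by (simp add: \<epsilon>_def)
    then have "(3::real) ^ d \<le> real m" by (metis of_nat_le_iff of_nat_numeral of_nat_power)
    also have "\<dots> \<le> C * exp (a * l * (1 + ln (ln (1 / \<epsilon>) + 1)))"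
      using N[rule_format, OF d, of \<epsilon>] \<epsilon> m by (simp add: l_def)
    also have "\<dots> \<le> C * exp (a * G * l powr 2)" using C ex by simp
    finally have "ln ((3::real) ^ d) \<le> ln (C * exp (a * G * l powr 2))"
      using C by (subst ln_le_cancel_iff) auto
    then show ?thesis using C by (simp add: ln_mult ln_realpow l_def)
  qed
  have ln3: "0 < ln (3::real)" by simp
  define \<delta> where "\<delta> = ln 3 / (2 * (a * G + 1))"
  have aG: "0 \<le> a * G" using a G by simp
  have \<delta>: "0 < \<delta>" unfolding \<delta>_def using ln3 aG by (intro divide_pos_pos) auto
  from log_power_le[of 2 1 \<delta>] \<delta> obtain K where K: "0 \<le> K" and KF: "\<forall>y\<ge>1. (1 + ln y) powr 2 \<le> \<delta> * y powr 1 + K"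
    by auto
  have lin: "real d * (ln 3 / 2) \<le> ln C + a * G * K" if d: "1 \<le> d" for d :: nat
  proof -
    have "a * G * (1 + ln (real d)) powr 2 \<le> a * G * (\<delta> * real d + K)"
      using KF[rule_format, of "real d"] d aG by (intro mult_left_mono) auto
    also have "\<dots> = (a * G * \<delta>) * real d + a * G * K" by (simp add: ring_distribs)
    also have "a * G * \<delta> \<le> ln 3 / 2"
    proof -
      have "a * G * \<delta> \<le> (a * G + 1) * \<delta>" using \<delta> by (intro mult_right_mono) auto
      also have "\<dots> = ln 3 / 2" unfolding \<delta>_def using aG by (simp add: field_simps)
      finally show ?thesis .
    qed
    finally have "a * G * (1 + ln (real d)) powr 2 \<le> ln 3 / 2 * real d + a * G * K"
      by (simp add: mult_right_mono)
    then show ?thesis using b[OF d] by (simp add: field_simps)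
  qed
  obtain d :: nat where "(ln C + a * G * K) / (ln 3 / 2) < real d" using reals_Archimedean2 by blast
  then have "(ln C + a * G * K) / (ln 3 / 2) < real (Suc d)" by simp
  then have "ln C + a * G * K < real (Suc d) * (ln 3 / 2)" using ln3 by (simp add: pos_divide_less_eq)
  with lin[of "Suc d"] show False by simp
qed

lemma EXP_PT_imp_QPT: "EXP_PT N \<Longrightarrow> EXP_QPT N"
proof -
  assume "EXP_PT N"
  then obtain C a b where C: "0 < C" and a: "0 \<le> a" and b: "0 \<le> b" and N: "\<forall>d\<ge>1. \<forall>\<epsilon>\<in>{0<..<1}.
        ereal_of_enat (N \<epsilon> d) \<le> ereal (C * real d powr b * (ln (1 / \<epsilon>) + 1) powr a)"
    unfolding EXP_PT_def by blast
  have "ereal_of_enat (N \<epsilon> d) \<le> ereal (C * exp ((a + b) * (1 + ln (real d)) * (1 + ln (ln (1 / \<epsilon>) + 1))))"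
    if d: "1 \<le> d" and \<epsilon>: "\<epsilon> \<in> {0<..<1}" for d \<epsilon>
  proof -
    define u where "u = ln (real d)"
    define v where "v = ln (ln (1 / \<epsilon>) + 1)"
    have u: "0 \<le> u" using d by (simp add: u_def)
    have v: "0 \<le> v" using \<epsilon> by (simp add: v_def)
    have x: "0 < ln (1 / \<epsilon>) + 1" using \<epsilon> by (intro add_nonneg_pos) auto
    have "C * real d powr b * (ln (1 / \<epsilon>) + 1) powr a = C * exp (b * u + a * v)"
      using d x by (simp add: powr_def u_def v_def exp_add)
    also have "\<dots> \<le> C * exp ((a + b) * (1 + u) * (1 + v))"
    proof -
      have "b * u + a * v \<le> (a + b) * u + (a + b) * v" using a b u v by (intro add_mono mult_right_mono) auto
      also have "\<dots> \<le> (a + b) * ((1 + u) * (1 + v))"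
        unfolding distrib_left[symmetric] using a b u v by (intro mult_left_mono) (auto simp: ring_distribs)
      finally show ?thesis using C by (simp add: mult.assoc)
    qed
    finally show ?thesis
      using order_trans[OF N[rule_format, OF d \<epsilon>]] by (simp add: u_def v_def)
  qed
  then show ?thesis unfolding EXP_QPT_def using C a b by (intro exI[of _ C] conjI exI[of _ "a + b"]) auto
qed

lemma EXP_SPT_imp_PT: "EXP_SPT N \<Longrightarrow> EXP_PT N"
proof -
  assume "EXP_SPT N"
  then obtain C a where C: "0 < C" and a: "0 \<le> a" and N: "\<forall>d\<ge>1. \<forall>\<epsilon>\<in>{0<..<1}.
        ereal_of_enat (N \<epsilon> d) \<le> ereal (C * (ln (1 / \<epsilon>) + 1) powr a)"
    unfolding EXP_SPT_def by blast
  show ?thesis unfolding EXP_PT_def using C a N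
    by (intro exI[of _ C] conjI exI[of _ a] exI[of _ 0]) auto
qed

section \<open>Exponential tractability of Gevrey approximation\<close>

context gevrey_problem
begin

lemma info_finite:
  assumes "0 < \<epsilon>" "\<epsilon> < 1" "1 \<le> d"
  shows "\<exists>m. info_complexity crit \<mu> \<epsilon> d = enat m \<and> 1 \<le> m"
proof -
  from info_bound_general[of crit] obtain C where "\<forall>\<epsilon>\<in>{0<..<1}. \<forall>d\<ge>1. \<exists>m. info_complexity crit \<mu> \<epsilon> d = enat m \<and> 1 \<le> m \<and>
      ln (real m) \<le> C * (real d * (1 + ln (real d) + ln (1 + ln (1 / \<epsilon>))))"
    by (elim exE conjE) (rule that)
  from this[rule_format, of \<epsilon> d] assms show ?thesis by auto
qed

lemma WT_large_t:
  assumes s: "0 < s" and t: "1 < t"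
  shows "EXP_st_WT s t (info_complexity crit \<mu>)"
proof (rule EXP_st_WT_I)
  show "0 < s" "0 < t" using s t by auto
  show "\<exists>m. info_complexity crit \<mu> \<epsilon> d = enat m \<and> 1 \<le> m" if "0 < \<epsilon>" "\<epsilon> < 1" "1 \<le> d" for \<epsilon> d
    by (rule info_finite[OF that])
  fix \<delta> :: real assume \<delta>: "0 < \<delta>"
  from info_bound_general[of crit] obtain C where C: "0 < C" and CF: "\<forall>\<epsilon>\<in>{0<..<1}. \<forall>d\<ge>1. \<exists>m. info_complexity crit \<mu> \<epsilon> d = enat m \<and> 1 \<le> m \<and>
      ln (real m) \<le> C * (real d * (1 + ln (real d) + ln (1 + ln (1 / \<epsilon>))))"
    by (elim exE conjE) (rule that)
  define \<eta> where "\<eta> = \<delta> / (3 * C)"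
  have \<eta>: "0 < \<eta>" using \<delta> C by (simp add: \<eta>_def)
  have t1: "0 < t - 1" "0 < t" using t by auto
  from log_times_power_le[OF zero_less_one t1(1) t1(2) \<eta>] obtain C1
    where C1: "\<forall>v\<ge>1. \<forall>y\<ge>1. (1 + ln y) * v powr 1 \<le> \<eta> * v powr (1 + (t - 1)) + \<eta> * y powr t + C1" by (elim exE conjE) (rule that)
  from log_times_power_le[OF zero_less_one t1(1) s \<eta>] obtain C2
    where C2: "\<forall>v\<ge>1. \<forall>y\<ge>1. (1 + ln y) * v powr 1 \<le> \<eta> * v powr (1 + (t - 1)) + \<eta> * y powr s + C2" by (elim exE conjE) (rule that)
  have "ln (real m) \<le> \<delta> * ((1 + ln (1 / \<epsilon>)) powr s + real d powr t) + C * (C1 + C2)"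
    if \<epsilon>: "0 < \<epsilon>" "\<epsilon> < 1" and d: "1 \<le> d" and m: "info_complexity crit \<mu> \<epsilon> d = enat m" for \<epsilon> d m
  proof -
    define x where "x = 1 + ln (1 / \<epsilon>)"
    have x: "1 \<le> x" using \<epsilon> by (simp add: x_def)
    have "(1 + ln (real d)) * real d \<le> \<eta> * real d powr t + \<eta> * real d powr t + C1"
      using C1[rule_format, of "real d" "real d"] d by simp
    moreover have "(1 + ln x) * real d \<le> \<eta> * real d powr t + \<eta> * x powr s + C2"
      using C2[rule_format, of "real d" x] d x by simp
    moreover have "real d * (1 + ln (real d) + ln x) = (1 + ln (real d)) * real d + (1 + ln x) * real d - real d"
      by (simp add: algebra_simps)
    moreover have "0 \<le> 2 * \<eta> * x powr s" using \<eta> by simp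
    ultimately have "real d * (1 + ln (real d) + ln x) \<le> 3 * \<eta> * real d powr t + 3 * \<eta> * x powr s + (C1 + C2)"
      by (simp only: algebra_simps)
    then have "C * (real d * (1 + ln (real d) + ln x)) \<le> C * (3 * \<eta> * real d powr t + 3 * \<eta> * x powr s + (C1 + C2))"
      using C by (intro mult_left_mono) auto
    also have "\<dots> = \<delta> * (x powr s + real d powr t) + C * (C1 + C2)"
      unfolding \<eta>_def using C by (simp add: field_simps)
    finally have "C * (real d * (1 + ln (real d) + ln x)) \<le> \<delta> * (x powr s + real d powr t) + C * (C1 + C2)" .
    moreover have "ln (real m) \<le> C * (real d * (1 + ln (real d) + ln x))"
      using CF[rule_format, of \<epsilon> d] \<epsilon> d m by (simp add: x_def)
    ultimately show ?thesis by (simp add: x_def)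
  qed
  then show "\<exists>C. \<forall>\<epsilon> d m. 0 < \<epsilon> \<longrightarrow> \<epsilon> < 1 \<longrightarrow> 1 \<le> d \<longrightarrow> info_complexity crit \<mu> \<epsilon> d = enat m \<longrightarrow>
        ln (real m) \<le> \<delta> * ((1 + ln (1 / \<epsilon>)) powr s + real d powr t) + C"
    by (intro exI[of _ "C * (C1 + C2)"] allI impI)
qed

lemma WT_smooth:
  assumes g1: "1 < \<gamma>" and s: "p / \<alpha> < s" and t: "0 < t"
  shows "EXP_st_WT s t (info_complexity crit \<mu>)"
proof (rule EXP_st_WT_I)
  have \<theta>: "0 < p / \<alpha>" using p alpha by simp
  then show s0: "0 < s" and "0 < t" using s t by auto
  show "\<exists>m. info_complexity crit \<mu> \<epsilon> d = enat m \<and> 1 \<le> m" if "0 < \<epsilon>" "\<epsilon> < 1" "1 \<le> d" for \<epsilon> d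
    by (rule info_finite[OF that])
  fix \<delta> :: real assume \<delta>: "0 < \<delta>"
  from info_bound_polylog[OF g1, of crit] obtain C a where C: "0 < C" and a: "0 < a"
    and CF: "\<forall>\<epsilon>\<in>{0<..<1}. \<forall>d\<ge>1. \<forall>m. info_complexity crit \<mu> \<epsilon> d = enat m \<longrightarrow>
      ln (real m) \<le> C * ((1 + ln (real d)) powr a + (1 + ln (real d)) * (1 + ln (1 / \<epsilon>)) powr (p / \<alpha>))"
    by (elim exE conjE) (rule that)
  define \<eta> where "\<eta> = \<delta> / (2 * C)"
  have \<eta>: "0 < \<eta>" using \<delta> C by (simp add: \<eta>_def)
  have ds: "0 < s - p / \<alpha>" using s by simp
  from log_times_power_le[OF \<theta> ds t \<eta>] obtain C1
    where C1: "\<forall>v\<ge>1. \<forall>y\<ge>1. (1 + ln y) * v powr (p / \<alpha>) \<le> \<eta> * v powr (p / \<alpha> + (s - p / \<alpha>)) + \<eta> * y powr t + C1" by (elim exE conjE) (rule that)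
  from log_power_le[OF a t \<eta>] obtain C2
    where C2: "\<forall>y\<ge>1. (1 + ln y) powr a \<le> \<eta> * y powr t + C2" by (elim exE conjE) (rule that)
  have "ln (real m) \<le> \<delta> * ((1 + ln (1 / \<epsilon>)) powr s + real d powr t) + C * (C1 + C2)"
    if \<epsilon>: "0 < \<epsilon>" "\<epsilon> < 1" and d: "1 \<le> d" and m: "info_complexity crit \<mu> \<epsilon> d = enat m" for \<epsilon> d m
  proof -
    define x where "x = 1 + ln (1 / \<epsilon>)"
    have x: "1 \<le> x" using \<epsilon> by (simp add: x_def)
    have "(1 + ln (real d)) * x powr (p / \<alpha>) \<le> \<eta> * x powr s + \<eta> * real d powr t + C1"
      using C1[rule_format, of x "real d"] d x by simp
    moreover have "(1 + ln (real d)) powr a \<le> \<eta> * real d powr t + C2"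
      using C2[rule_format, of "real d"] d by simp
    moreover have "0 \<le> \<eta> * x powr s" using \<eta> by simp
    ultimately have "(1 + ln (real d)) powr a + (1 + ln (real d)) * x powr (p / \<alpha>) \<le> 2 * \<eta> * real d powr t + 2 * \<eta> * x powr s + (C1 + C2)"
      by linarith
    then have "C * ((1 + ln (real d)) powr a + (1 + ln (real d)) * x powr (p / \<alpha>)) \<le> C * (2 * \<eta> * real d powr t + 2 * \<eta> * x powr s + (C1 + C2))"
      using C by (intro mult_left_mono) auto
    also have "\<dots> = \<delta> * (x powr s + real d powr t) + C * (C1 + C2)"
      unfolding \<eta>_def using C by (simp add: field_simps)
    finally have "C * ((1 + ln (real d)) powr a + (1 + ln (real d)) * x powr (p / \<alpha>)) \<le> \<delta> * (x powr s + real d powr t) + C * (C1 + C2)" .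
    moreover have "ln (real m) \<le> C * ((1 + ln (real d)) powr a + (1 + ln (real d)) * x powr (p / \<alpha>))"
      using CF[rule_format, of \<epsilon> d m] \<epsilon> d m by (simp add: x_def)
    ultimately show ?thesis by (simp add: x_def)
  qed
  then show "\<exists>C. \<forall>\<epsilon> d m. 0 < \<epsilon> \<longrightarrow> \<epsilon> < 1 \<longrightarrow> 1 \<le> d \<longrightarrow> info_complexity crit \<mu> \<epsilon> d = enat m \<longrightarrow>
        ln (real m) \<le> \<delta> * ((1 + ln (1 / \<epsilon>)) powr s + real d powr t) + C"
    by (intro exI[of _ "C * (C1 + C2)"] allI impI)
qed

text \<open>
  At accuracy \<open>ln (1/\<epsilon>) = B d\<^sup>g\<close> both terms of the denominator are \<open>O(d)\<close>, because
  \<open>g s \<le> 1\<close> and \<open>t \<le> 1\<close>, while the logarithm of the complexity is at least \<open>d ln 3\<close>.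
\<close>

lemma not_WT_coupled:
  assumes g: "1 < g" "\<gamma> \<le> g" and s: "0 < s" "g * s \<le> 1" and t: "t \<le> 1"
  shows "\<not> EXP_st_WT s t (info_complexity crit \<mu>)"
proof -
  from info_lower_exponential[OF g, of crit] obtain B where B: "0 < B"
    and BF: "\<forall>d\<ge>1. \<forall>m. info_complexity crit \<mu> (exp (- (B * real d powr g))) d = enat m \<longrightarrow> 3 ^ d \<le> m"
    by (elim exE conjE) (rule that)
  define c where "c = ln 3 / ((1 + B) powr s + 1)"
  have c: "0 < c" unfolding c_def using B by (intro divide_pos_pos add_nonneg_pos) auto
  show ?thesis
  proof (rule not_EXP_st_WT_I[OF c])
    show "0 < exp (- (B * real d powr g)) \<and> exp (- (B * real d powr g)) < 1" if "1 \<le> d" for d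
      using B that by simp
    show "\<exists>m. info_complexity crit \<mu> \<epsilon> d = enat m \<and> 1 \<le> m" if "0 < \<epsilon>" "\<epsilon> < 1" "1 \<le> d" for \<epsilon> d
      by (rule info_finite[OF that])
    fix d m assume d: "1 \<le> d" and m: "info_complexity crit \<mu> (exp (- (B * real d powr g))) d = enat m"
    have dg: "1 \<le> real d powr g" using d g by (intro ge_one_powr_ge_zero) auto
    have "1 + ln (1 / exp (- (B * real d powr g))) = 1 + B * real d powr g" by (simp add: ln_div)
    also have "\<dots> \<le> (1 + B) * real d powr g" using dg by (simp add: ring_distribs)
    finally have "(1 + ln (1 / exp (- (B * real d powr g)))) powr s \<le> ((1 + B) * real d powr g) powr s"
      using s B by (intro powr_mono2) (auto simp: ln_div)
    also have "\<dots> = (1 + B) powr s * real d powr (g * s)" by (simp only: powr_mult powr_powr)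
    also have "real d powr (g * s) \<le> real d powr 1" using d s by (intro powr_mono) auto
    finally have "(1 + ln (1 / exp (- (B * real d powr g)))) powr s \<le> (1 + B) powr s * real d"
      by (simp add: mult_left_mono)
    moreover have "real d powr t \<le> real d powr 1" using d t by (intro powr_mono) auto
    ultimately have "(1 + ln (1 / exp (- (B * real d powr g)))) powr s + real d powr t \<le> ((1 + B) powr s + 1) * real d"
      by (simp add: ring_distribs)
    then have "c * ((1 + ln (1 / exp (- (B * real d powr g)))) powr s + real d powr t) \<le> c * (((1 + B) powr s + 1) * real d)"
      using c by (intro mult_left_mono) auto
    also have "\<dots> = real d * ln 3"
    proof -
      have "(1 + B) powr s + 1 \<noteq> 0" using powr_ge_zero[of "1 + B" s] by linarith
      then show ?thesis unfolding c_def by simp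
    qed
    also have "\<dots> = ln (3 ^ d)" by (simp add: ln_realpow)
    also have "\<dots> \<le> ln (real m)"
    proof -
      have "3 ^ d \<le> m" using BF d m by blast
      then have "(3::real) ^ d \<le> real m" by (metis of_nat_le_iff of_nat_numeral of_nat_power)
      moreover have "0 < (3::real) ^ d" by simp
      ultimately show ?thesis by (subst ln_le_cancel_iff) linarith+
    qed
    finally show "c * ((1 + ln (1 / exp (- (B * real d powr g)))) powr s + real d powr t) \<le> ln (real m)" .
  qed
qed

text \<open>
  The accuracy stays fixed at \<open>1/2\<close>, so the denominator is \<open>O(d)\<close>, whereas the logarithm of the
  complexity grows at least linearly in \<open>d\<close>.
\<close>

lemma not_WT_rough:
  assumes g: "\<gamma> \<le> 1" and t: "t \<le> 1"
  shows "\<not> EXP_st_WT s t (info_complexity crit \<mu>)"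
proof -
  define b where "b = 1 + 2 * exp (- (2 * \<beta>))"
  have "1 < b" by (simp add: b_def)
  then have lnb: "0 < ln b" by simp
  define A where "A = (1 + ln 2) powr s + (1::real)"
  have A: "0 < A" unfolding A_def by (intro add_nonneg_pos) auto
  define c where "c = ln b / (2 * A)"
  have c: "0 < c" using lnb A by (simp add: c_def)
  (* from d0 on, the constant 3/4 costs at most half of the exponential growth *)
  define d0 where "d0 = nat \<lceil>2 * ln (4 / 3) / ln b\<rceil>"
  show ?thesis
  proof (rule not_EXP_st_WT_I[OF c, where e="\<lambda>d. 1 / 2" and ?d0.0=d0])
    show "\<exists>m. info_complexity crit \<mu> \<epsilon> d = enat m \<and> 1 \<le> m" if "0 < \<epsilon>" "\<epsilon> < 1" "1 \<le> d" for \<epsilon> d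
      by (rule info_finite[OF that])
    fix d m assume d0: "d0 \<le> d" and d: "1 \<le> d" and m: "info_complexity crit \<mu> (1 / 2) d = enat m"
    have "2 * ln (4 / 3) / ln b \<le> real d0" unfolding d0_def by linarith
    also have "\<dots> \<le> real d" using d0 by simp
    finally have big: "2 * ln (4 / 3) \<le> real d * ln b" using lnb by (simp add: pos_divide_le_eq)
    have "real d powr t \<le> real d powr 1" using d t by (intro powr_mono) auto
    moreover have "(1 + ln 2) powr s * 1 \<le> (1 + ln 2) powr s * real d" using d by (intro mult_left_mono) auto
    ultimately have "(1 + ln (1 / (1 / 2))) powr s + real d powr t \<le> A * real d"
      by (simp add: A_def ring_distribs)
    then have "c * ((1 + ln (1 / (1 / 2))) powr s + real d powr t) \<le> c * (A * real d)"
      using c by (intro mult_left_mono) auto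
    also have "\<dots> = real d * ln b / 2" using A by (simp add: c_def)
    also have "\<dots> \<le> real d * ln b - ln (4 / 3)" using big by simp
    also have "\<dots> = ln (3 / 4 * b ^ d)"
    proof -
      have "0 < b" by (simp add: b_def add_pos_pos)
      then have "ln (3 / 4 * b ^ d) = ln (3 / 4) + ln (b ^ d)" by (intro ln_mult_pos) simp_all
      also have "ln (b ^ d) = real d * ln b" by (rule ln_realpow)
      finally have "ln (3 / 4 * b ^ d) = ln (3 / 4) + real d * ln b" .
      moreover have "ln (3 / 4) = - ln (4 / 3 :: real)" by (simp add: ln_div)
      ultimately show ?thesis by simp
    qed
    also have "\<dots> \<le> ln (real m)"
    proof -
      have "3 / 4 * b ^ d \<le> real m" unfolding b_def by (rule info_lower_fixed[OF g d m])
      moreover have "0 < 3 / 4 * b ^ d" by (simp add: b_def add_pos_pos)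
      ultimately show ?thesis by (subst ln_le_cancel_iff) linarith+
    qed
    finally show "c * ((1 + ln (1 / (1 / 2))) powr s + real d powr t) \<le> ln (real m)" .
  qed auto
qed

lemma not_QPT: "\<not> EXP_QPT (info_complexity crit \<mu>)"
proof -
  define g where "g = \<gamma> + 1"
  have g: "1 < g" "\<gamma> \<le> g" "0 < g" using gamma by (auto simp: g_def)
  from info_lower_exponential[OF g(1,2), of crit] obtain B where B: "0 < B"
    and BF: "\<forall>d\<ge>1. \<forall>m. info_complexity crit \<mu> (exp (- (B * real d powr g))) d = enat m \<longrightarrow> 3 ^ d \<le> m"
    by (elim exE conjE) (rule that)
  show ?thesis
    by (rule not_EXP_QPT_I[OF B g(3) info_finite]) (use BF in auto)
qed

lemma not_UWT: "\<not> EXP_UWT (info_complexity crit \<mu>)"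
proof -
  define g where "g = \<gamma> + 1"
  have g: "1 < g" "\<gamma> \<le> g" "0 < g" using gamma by (auto simp: g_def)
  have "\<not> EXP_st_WT (1 / g) 1 (info_complexity crit \<mu>)"
    by (rule not_WT_coupled[OF g(1,2)]) (use g in auto)
  then show ?thesis unfolding EXP_UWT_def using g by (metis zero_less_divide_1_iff zero_less_one)
qed

lemma EXP_exponent_eq:
  assumes d: "1 \<le> d"
  shows "EXP_exponent (avg_error \<mu>) d = ereal (\<alpha> / real d)"
  unfolding EXP_exponent_def
proof (rule antisym)
  show "(SUP r\<in>{r. exp_rate (avg_error \<mu>) r}. ereal (r d)) \<le> ereal (\<alpha> / real d)"
    by (rule SUP_least) (simp add: exp_rate_bound[OF _ d])
  show "ereal (\<alpha> / real d) \<le> (SUP r\<in>{r. exp_rate (avg_error \<mu>) r}. ereal (r d))"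
    by (rule SUP_upper2[of "\<lambda>d. \<alpha> / real d"]) (simp_all add: exp_rate_attained)
qed

lemma not_UEXP: "\<not> is_UEXP (avg_error \<mu>)"
proof
  assume "is_UEXP (avg_error \<mu>)"
  then obtain r where r: "0 < r" "exp_rate (avg_error \<mu>) (\<lambda>d. r)" unfolding is_UEXP_def by blast
  obtain n :: nat where n: "\<alpha> / r < real n" using reals_Archimedean2 by blast
  have "r \<le> \<alpha> / real (Suc n)" by (rule exp_rate_bound[OF r(2)]) simp
  then have "real (Suc n) \<le> \<alpha> / r" using r(1) by (simp add: field_simps)
  then show False using n by simp
qed

lemma WT_iff_small_t:
  assumes t: "0 < t" "t \<le> 1" and s: "0 < s"
  shows "EXP_st_WT s t (info_complexity crit \<mu>) \<longleftrightarrow> p < \<alpha> \<and> p / \<alpha> < s"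
proof
  assume WT: "EXP_st_WT s t (info_complexity crit \<mu>)"
  then have "\<not> \<gamma> \<le> 1" using not_WT_rough t by blast
  then have g: "1 < \<gamma>" by simp
  have "\<not> \<gamma> * s \<le> 1" using WT not_WT_coupled[OF g order_refl s _ t(2)] by blast
  then show "p < \<alpha> \<and> p / \<alpha> < s" using g p alpha by (simp add: field_simps)
next
  assume "p < \<alpha> \<and> p / \<alpha> < s"
  then show "EXP_st_WT s t (info_complexity crit \<mu>)"
    using p t by (intro WT_smooth) auto
qed

end

theorem theorem2p3:
  fixes \<alpha> \<beta> p :: real
    and \<mu> :: "nat \<Rightarrow> ((nat \<Rightarrow> real) \<Rightarrow>\<^sub>C real) measure"
    and crit :: criterion
  assumes "0 < \<alpha>" and "0 < \<beta>" and "0 < p"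
    and "\<And>d. 1 \<le> d \<Longrightarrow> gaussian_measure d (\<mu> d)"
    and "\<And>d. 1 \<le> d \<Longrightarrow> zero_mean d (\<mu> d)"
    and "\<And>d. 1 \<le> d \<Longrightarrow> has_covariance_kernel d (\<mu> d) (gevrey_kernel d \<alpha> \<beta> p)"
  shows
    "(is_EXP (avg_error \<mu>) \<and>
      (\<forall>d\<ge>1. EXP_exponent (avg_error \<mu>) d = ereal (\<alpha> / real d)) \<and>
      \<not> is_UEXP (avg_error \<mu>)) \<and>
     (\<not> EXP_UWT (info_complexity crit \<mu>) \<and> \<not> EXP_QPT (info_complexity crit \<mu>) \<and>
      \<not> EXP_PT (info_complexity crit \<mu>) \<and> \<not> EXP_SPT (info_complexity crit \<mu>)) \<and>
     (EXP_WT (info_complexity crit \<mu>) \<longleftrightarrow> \<alpha> > p) \<and>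
     (\<forall>s t. s > 0 \<and> t > 1 \<longrightarrow> EXP_st_WT s t (info_complexity crit \<mu>)) \<and>
     (\<forall>s t. 0 < t \<and> t \<le> 1 \<and> 0 < s \<and> s \<le> 1 \<longrightarrow>
        (EXP_st_WT s t (info_complexity crit \<mu>) \<longleftrightarrow> s > p / \<alpha>)) \<and>
     (\<forall>s t. 0 < t \<and> t \<le> 1 \<and> s > 1 \<longrightarrow>
        (EXP_st_WT s t (info_complexity crit \<mu>) \<longleftrightarrow> \<alpha> > p))"
proof -
  interpret gevrey_problem \<alpha> \<beta> p \<mu> by (rule gevrey_problem.intro[OF assms])
  have quotient: "p / \<alpha> < 1 \<longleftrightarrow> p < \<alpha>" using assms(1,3) by simp
  have "is_EXP (avg_error \<mu>)" unfolding is_EXP_def using exp_rate_attained by blast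
  moreover have "\<not> EXP_PT (info_complexity crit \<mu>)" "\<not> EXP_SPT (info_complexity crit \<mu>)"
    using not_QPT EXP_PT_imp_QPT EXP_SPT_imp_PT by blast+
  moreover have "EXP_WT (info_complexity crit \<mu>) \<longleftrightarrow> p < \<alpha>"
    unfolding EXP_WT_def using WT_iff_small_t[of 1 1 crit] quotient by simp
  moreover have "EXP_st_WT s t (info_complexity crit \<mu>) \<longleftrightarrow> p / \<alpha> < s" if "0 < t" "t \<le> 1" "0 < s" "s \<le> 1" for s t
    using WT_iff_small_t[OF that(1-3), of crit] quotient that(4) by (metis order_less_le_trans)
  moreover have "EXP_st_WT s t (info_complexity crit \<mu>) \<longleftrightarrow> p < \<alpha>" if "0 < t" "t \<le> 1" "1 < s" for s t
    using WT_iff_small_t[OF that(1,2), of s crit] quotient that(3) by (metis order_less_trans zero_less_one)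
  ultimately show ?thesis
    using EXP_exponent_eq not_UEXP not_UWT not_QPT WT_large_t by (intro conjI allI impI) auto
qed

end
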